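(* Let $\varepsilon\in\{1,-1\}$, $k\ge0$ an integer, $g(z)=\sum_{n\ge0}b_nq^n\in M^{-\varepsilon}_{2k+1}(\Gamma)$ with $q=e^{2\pi i z/\lambda}$, and let $f:\mathbb R^2\to\mathbb C$ be a radial Schwartz function, $f^\varepsilon=f+\varepsilon\mathcal F(f)$. Then \[ \sum_{n\ge0}b_n\frac{d^k}{du^k}f^{\varepsilon}\Big(\sqrt{2n/\lambda}\Big)=0. \]
   Context: Fix an integer $l\ge6$ with $l\equiv 2\pmod4$, $\lambda=2\cos(\pi/l)$, $\mathbb H$ the upper half-plane, $\Gamma$ the group of Möbius transformations generated by $z\mapsto -1/z$ and $z\mapsto z+\lambda$ (Hecke triangle group $(2,l,\infty)$). For $\eta\in\{\pm1\}$ and odd $r$, $M^\eta_r(\Gamma)$ is the space of holomorphic $g:\mathbb H\to\mathbb C$ with $g(z)=\eta(i/z)^rg(-1/z)$, $g(z+\lambda)=g(z)$, and $q$-expansion $\sum_{n\ge0}b_nq^n$. Fourier transform: $\mathcal F(f)(\xi)=\int_{\mathbb R^2}f(x)e^{2\pi i\langle x,\xi\rangle}dx$. For a radial $h(x)=H(|x|^2)$ and $u=|x|^2$, $\frac{d^k}{du^k}h(\sqrt t)$ means $H^{(k)}(t)$ (one-sided at $t=0$). *)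

theory Defs
  imports "HOL-Complex_Analysis.Complex_Analysis"
begin

section \<open>Modular forms for the Hecke triangle group\<close>

definition upper_half_plane :: "complex set" where
  "upper_half_plane = {z. Im z > 0}"

definition hecke_lambda :: "nat \<Rightarrow> real" where
  "hecke_lambda l = 2 * cos (pi / real l)"

definition hecke_q :: "nat \<Rightarrow> complex \<Rightarrow> complex" where
  "hecke_q l z = exp (2 * of_real pi * \<i> * z / of_real (hecke_lambda l))"

definition has_q_expansion :: "nat \<Rightarrow> (complex \<Rightarrow> complex) \<Rightarrow> (nat \<Rightarrow> complex) \<Rightarrow> bool" where
  "has_q_expansion l g b \<longleftrightarrow>
     (\<forall>z\<in>upper_half_plane. (\<lambda>n. b n * hecke_q l z ^ n) sums g z)"

text \<open>
  The space of forms of weight \<open>r\<close> and sign \<open>\<eta>\<close> for the group generated by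
  \<open>z \<mapsto> -1/z\<close> and \<open>z \<mapsto> z + \<lambda>\<close>.  As usual, the group enters only through the
  transformation laws under its two generators; values of \<open>g\<close> off the upper
  half-plane are irrelevant.
\<close>
definition hecke_forms :: "nat \<Rightarrow> complex \<Rightarrow> int \<Rightarrow> (complex \<Rightarrow> complex) set" where
  "hecke_forms l \<eta> r =
     {g. g holomorphic_on upper_half_plane \<and>
         (\<forall>z\<in>upper_half_plane. g z = \<eta> * (\<i> / z) powi r * g (- 1 / z)) \<and>
         (\<forall>z\<in>upper_half_plane. g (z + of_real (hecke_lambda l)) = g z) \<and>
         (\<exists>b. has_q_expansion l g b)}"

section \<open>Schwartz functions and the Fourier transform\<close>

definition partial_deriv :: "'n \<Rightarrow> (real ^ 'n \<Rightarrow> complex) \<Rightarrow> real ^ 'n \<Rightarrow> complex" where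
  "partial_deriv i f x = vector_derivative (\<lambda>t. f (x + t *\<^sub>R axis i 1)) (at 0)"

definition iter_partial_deriv ::
    "'n list \<Rightarrow> (real ^ 'n \<Rightarrow> complex) \<Rightarrow> real ^ 'n \<Rightarrow> complex" where
  "iter_partial_deriv js f = foldr partial_deriv js f"

text \<open>
  Differentiability of every iterated partial derivative (the list \<open>js\<close> is the sequence of
  coordinate directions, possibly empty) is smoothness: in particular all of them are continuous.
\<close>
definition schwartz :: "(real ^ 'n::finite \<Rightarrow> complex) \<Rightarrow> bool" where
  "schwartz f \<longleftrightarrow>
     (\<forall>js x. iter_partial_deriv js f differentiable (at x)) \<and>
     (\<forall>\<alpha> js. bounded (range (\<lambda>x. (\<Prod>i\<in>UNIV. x $ i ^ \<alpha> i) *\<^sub>R iter_partial_deriv js f x)))"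

definition radial :: "(real ^ 2 \<Rightarrow> complex) \<Rightarrow> bool" where
  "radial h \<longleftrightarrow> (\<exists>H :: real \<Rightarrow> complex. \<forall>x. h x = H ((norm x)\<^sup>2))"

text \<open>The sign in the exponent is positive.\<close>
definition fourier :: "(real ^ 2 \<Rightarrow> complex) \<Rightarrow> real ^ 2 \<Rightarrow> complex" where
  "fourier f \<xi> = (LINT x|lborel. f x * exp (2 * of_real pi * \<i> * of_real (x \<bullet> \<xi>)))"

definition fourier_sym :: "complex \<Rightarrow> (real ^ 2 \<Rightarrow> complex) \<Rightarrow> real ^ 2 \<Rightarrow> complex" where
  "fourier_sym \<epsilon> f x = f x + \<epsilon> * fourier f x"

section \<open>Derivatives in the squared radius\<close>

text \<open>
  For a radial \<open>h\<close> with \<open>h x = H (\<bar>x\<bar>\<^sup>2)\<close> this is \<open>H\<close> on \<open>[0, \<infinity>)\<close>: the chosen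
  representative \<open>x = (\<surd>t, 0)\<close> has squared norm \<open>t\<close>.
\<close>
definition radial_profile :: "(real ^ 2 \<Rightarrow> complex) \<Rightarrow> real \<Rightarrow> complex" where
  "radial_profile h t = h (sqrt t *\<^sub>R axis 1 1)"

text \<open>
  \<open>radial_deriv k h t\<close> is \<open>H\<^sup>(\<^sup>k\<^sup>) (t)\<close> for \<open>t \<ge> 0\<close>. Differentiating within \<open>{0..}\<close> gives the
  ordinary derivative for \<open>t > 0\<close> and the one-sided derivative at \<open>t = 0\<close>.
\<close>
definition radial_deriv :: "nat \<Rightarrow> (real ^ 2 \<Rightarrow> complex) \<Rightarrow> real \<Rightarrow> complex" where
  "radial_deriv k h =
     ((\<lambda>G t. vector_derivative G (at t within {0..})) ^^ k) (radial_profile h)"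

text \<open>The next two lemmas confirm that the encoding does not depend on the choices made.\<close>

lemma radial_profile_eq:
  assumes "\<And>x. h x = H ((norm x)\<^sup>2)" and "t \<ge> 0"
  shows "radial_profile h t = H t"
  using assms by (simp add: radial_profile_def norm_axis_1)

lemma at_within_nonneg_eq_at:
  fixes t :: real
  assumes "t > 0"
  shows "at t within {0..} = at t"
  using assms by (intro at_within_interior) simp

end

theory Submission
  imports Defs "HOL-Probability.Sinc_Integral" "HOL-Probability.Distributions" "HOL-Real_Asymp.Real_Asymp"
begin

text \<open>
  Write \<open>H(u)\<close> for the profile of \<open>f\<close> in \<open>u = \<bar>x\<bar>\<^sup>2\<close>.  For a Gaussian \<open>H(u) = exp (- \<pi> a u)\<close> the
  Fourier transform has profile \<open>exp (- \<pi> u / a) / a\<close>, and the identity is the transformation law of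
  \<open>g\<close> at \<open>z = \<i> a\<close>.  The general case follows by density, for which the functional has to be continuous.
  On the one hand, \<open>b\<^sub>n\<close> grows polynomially, because \<open>\<bar>g z\<bar> \<le> C / (Im z)\<^sup>r\<close> near the real axis.  On the
  other hand, the planar Fourier transform of a radial function is the cosine transform of its Abel
  transform, and as a function of \<open>s = \<bar>\<xi>\<bar>\<^sup>2\<close> the cosine transform \<open>\<Phi>\<close> turns the derivative in \<open>u\<close> into an
  antiderivative in \<open>s\<close>, \<open>(\<Phi> H')' = \<pi>\<^sup>2 \<Phi> H\<close>, and a second order operator into multiplication by \<open>1 + s\<close>;
  so each derivative of the transform is dominated by finitely many weighted suprema of derivatives
  of \<open>H\<close>.  Finite sums of \<open>exp (- a u)\<close> with \<open>a > 0\<close> are dense for such norms: the Weierstrass theorem in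
  the variable \<open>exp (- \<delta> u)\<close> approximates the highest derivative, and integration from infinity gives
  the lower ones.
\<close>

section \<open>Sequences of iterated derivatives\<close>

text \<open>The weight \<open>2 * k + 1\<close> is dictated by the Gaussian case: \<open>k\<close>
  derivatives in \<open>u\<close> bring out \<open>(- pi * a) ^ k\<close> on one side and
  \<open>(1 / a) * (- pi / a) ^ k\<close> on the other, and the quotient of the two is
  \<open>a\<close> to the power \<open>-(2 * k + 1)\<close>. The obstacle is the point
  \<open>u = 0\<close>, where derivatives are one-sided and \<open>sqrt\<close> is not smooth:
  smoothness there of the profile of \<open>f\<close>, and of its transform in \<open>s\<close>, has
  to be proved. In both cases all derivatives are exhibited at once by explicit integrals. A
  function is therefore carried together with the sequence of its derivatives, and the operators on
  profiles act on whole sequences. The detour through the Abel transform replaces the Bessel kernel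
  of the planar transform by a cosine, so that decay and differentiability reduce to integration by
  parts on the line. Moderate growth of \<open>g\<close> at the real axis is not part of the
  definition of a form. It is extracted from \<open>\<lambda> < 2\<close>: inverting a low point of
  the strip \<open>|Re z| <= \<lambda> / 2\<close> raises it by a factor bounded away from
  1.\<close>

text \<open>
  Here \<open>h m\<close> plays the role of the \<open>m\<close>-th derivative of \<open>h 0\<close>; only the values on \<open>S\<close> matter.
\<close>

definition deriv_seq_on :: "real set \<Rightarrow> (nat \<Rightarrow> real \<Rightarrow> complex) \<Rightarrow> bool" where
  "deriv_seq_on S h \<longleftrightarrow>
     (\<forall>m. \<forall>u\<in>S. (h m has_vector_derivative h (Suc m) u) (at u within S))"

text \<open>With \<open>S = {0..}\<close> this is the Schwartz space of the half-line, used for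
  profiles in \<open>u\<close>; with \<open>S = UNIV\<close> that of the line, used for the
  restriction of \<open>f\<close> to a coordinate axis.\<close>

definition rapid_on :: "real set \<Rightarrow> (nat \<Rightarrow> real \<Rightarrow> complex) \<Rightarrow> bool" where
  "rapid_on S h \<longleftrightarrow> deriv_seq_on S h \<and>
     (\<forall>m N. \<exists>B. \<forall>u\<in>S. (1 + \<bar>u\<bar>) ^ N * norm (h m u) \<le> B)"

lemma deriv_seq_onD:
  "deriv_seq_on S h \<Longrightarrow> u \<in> S \<Longrightarrow> (h m has_vector_derivative h (Suc m) u) (at u within S)"
  by (simp add: deriv_seq_on_def)

lemma rapid_on_deriv_seq: "rapid_on S h \<Longrightarrow> deriv_seq_on S h"
  by (simp add: rapid_on_def)

lemma rapid_onD:
  "rapid_on S h \<Longrightarrow> u \<in> S \<Longrightarrow> (h m has_vector_derivative h (Suc m) u) (at u within S)"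
  by (simp add: rapid_on_def deriv_seq_on_def)

lemma rapid_on_bound:
  assumes "rapid_on S h"
  obtains B where "B \<ge> 0" "\<And>u. u \<in> S \<Longrightarrow> (1 + \<bar>u\<bar>) ^ N * norm (h m u) \<le> B"
proof -
  obtain B where B: "\<forall>u\<in>S. (1 + \<bar>u\<bar>) ^ N * norm (h m u) \<le> B"
    using assms unfolding rapid_on_def by blast
  show ?thesis
    by (rule that[of "max B 0"]) (use B in \<open>auto intro: max.coboundedI1\<close>)
qed

lemma deriv_seq_on_continuous: "deriv_seq_on S h \<Longrightarrow> continuous_on S (h m)"
  by (auto simp: deriv_seq_on_def continuous_on_eq_continuous_within
      intro: has_vector_derivative_continuous)

lemma at_within_Ici_neq_bot: "u \<ge> 0 \<Longrightarrow> at u within {0..} \<noteq> (bot :: real filter)"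
proof -
  assume "u \<ge> 0"
  hence "at u within {u..u+1} \<le> at u within {0..}" by (intro at_le) auto
  moreover have "at u within {u..u+1} \<noteq> bot"
    by (simp add: trivial_limit_within islimpt_Icc)
  ultimately show ?thesis by (metis bot.extremum_uniqueI)
qed

text \<open>Derivatives within \<open>S\<close> are unique when no point of \<open>S\<close> is
  isolated. An identity between sequences therefore has to be checked at index 0 only; linearity,
  the Gaussian formula, the recursion for \<open>hadamard\<close> and parity all rest on
  this.\<close>

lemma deriv_seq_on_unique:
  assumes h: "deriv_seq_on S h" and g: "deriv_seq_on S g"
    and S: "\<And>u. u \<in> S \<Longrightarrow> at u within S \<noteq> bot"
    and eq: "\<And>u. u \<in> S \<Longrightarrow> h 0 u = g 0 u" and u: "u \<in> S"
  shows "h m u = g m u"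
  using u
proof (induction m arbitrary: u)
  case (Suc m)
  have "(h m has_vector_derivative g (Suc m) u) (at u within S)"
    by (rule has_vector_derivative_transform[OF _ _ deriv_seq_onD[OF g]])
       (use Suc in auto)
  thus ?case
    using vector_derivative_unique_within[OF S[OF Suc.prems] deriv_seq_onD[OF h]] Suc.prems by auto
qed (use eq in auto)

text \<open>Makes the iterated one-sided derivative computable: any explicit sequence that starts
  with the profile yields its values, at \<open>t = 0\<close> as well.\<close>

lemma radial_deriv_eq:
  assumes h: "deriv_seq_on {0..} h" and eq: "\<And>t. t \<ge> 0 \<Longrightarrow> radial_profile f t = h 0 t"
  shows "t \<ge> 0 \<Longrightarrow> radial_deriv k f t = h k t"
proof (induction k arbitrary: t)
  case 0
  thus ?case by (simp add: radial_deriv_def eq)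
next
  case (Suc k)
  have "radial_deriv (Suc k) f t = vector_derivative (radial_deriv k f) (at t within {0..})"
    by (simp add: radial_deriv_def)
  also have "\<dots> = h (Suc k) t"
  proof (rule vector_derivative_within[OF at_within_Ici_neq_bot[OF Suc.prems]])
    show "(radial_deriv k f has_vector_derivative h (Suc k) t) (at t within {0..})"
      by (rule has_vector_derivative_transform[OF _ _ deriv_seq_onD[OF h]])
         (use Suc in auto)
  qed
  finally show ?case .
qed

section \<open>Calculus on the half-line and integrals over the line\<close>

lemma has_vector_derivative_iff_quotient:
  "(f has_vector_derivative D) (at t within S) \<longleftrightarrow>
     ((\<lambda>s. (f s - f t) /\<^sub>R (s - t)) \<longlongrightarrow> D) (at t within S)"
proof -
  have "norm ((1 / norm (s - t)) *\<^sub>R (f s - (f t + (s - t) *\<^sub>R D))) = norm ((f s - f t) /\<^sub>R (s - t) - D)"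
    if "s \<noteq> t" for s
  proof -
    have "(f s - f t) /\<^sub>R (s - t) - D = (f s - (f t + (s - t) *\<^sub>R D)) /\<^sub>R (s - t)"
      using that by (simp add: scaleR_diff_right scaleR_add_right)
    thus ?thesis by (simp add: divide_inverse)
  qed
  hence "eventually (\<lambda>s. norm ((1 / norm (s - t)) *\<^sub>R (f s - (f t + (s - t) *\<^sub>R D))) =
      norm ((f s - f t) /\<^sub>R (s - t) - D)) (at t within S)"
    by (auto simp: eventually_at_filter)
  hence "((\<lambda>s. (1 / norm (s - t)) *\<^sub>R (f s - (f t + (s - t) *\<^sub>R D))) \<longlongrightarrow> 0) (at t within S) \<longleftrightarrow>
      ((\<lambda>s. (f s - f t) /\<^sub>R (s - t) - D) \<longlongrightarrow> 0) (at t within S)"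
    unfolding tendsto_norm_zero_iff[symmetric, of "\<lambda>s. (1 / norm (s - t)) *\<^sub>R _ s"]
      tendsto_norm_zero_iff[symmetric, of "\<lambda>s. (f s - f t) /\<^sub>R (s - t) - D"]
    by (rule filterlim_cong[OF refl refl])
  thus ?thesis
    by (simp add: has_vector_derivative_def has_derivative_within bounded_linear_scaleR_left
        Lim_null[symmetric])
qed

text \<open>Dominated convergence along sequences, applied to difference quotients. Working within a
  convex \<open>S\<close> includes the right-hand derivative at 0.\<close>

lemma has_vector_derivative_lborel_integral:
  fixes f :: "real \<Rightarrow> real \<Rightarrow> complex"
  assumes S: "convex S" "t \<in> S"
    and int: "\<And>t. t \<in> S \<Longrightarrow> integrable lborel (f t)"
    and meas: "f' t \<in> borel_measurable lborel"
    and deriv: "\<And>t x. t \<in> S \<Longrightarrow> ((\<lambda>t. f t x) has_vector_derivative f' t x) (at t within S)"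
    and bound: "\<And>t x. t \<in> S \<Longrightarrow> norm (f' t x) \<le> w x"
    and w: "integrable lborel w"
  shows "((\<lambda>t. LINT x|lborel. f t x) has_vector_derivative (LINT x|lborel. f' t x)) (at t within S)"
proof -
  let ?Q = "\<lambda>s x. (f s x - f t x) /\<^sub>R (s - t)"
  have "((\<lambda>s. LINT x|lborel. ?Q s x) \<longlongrightarrow> (LINT x|lborel. f' t x)) (at t within S)"
  proof (subst tendsto_at_iff_sequentially, intro allI impI)
    fix X :: "nat \<Rightarrow> real"
    assume X: "\<forall>i. X i \<in> S - {t}" and lim: "X \<longlonglongrightarrow> t"
    have XS: "X i \<in> S" "X i \<noteq> t" for i using X by auto
    show "((\<lambda>s. LINT x|lborel. ?Q s x) \<circ> X) \<longlonglongrightarrow> (LINT x|lborel. f' t x)"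
      unfolding o_def
    proof (rule integral_dominated_convergence[where w = w])
      show "f' t \<in> borel_measurable lborel" by fact
      show "?Q (X i) \<in> borel_measurable lborel" for i
        using int[OF XS(1)[of i]] int[OF S(2)] by (auto intro!: borel_measurable_scaleR)
      show "integrable lborel w" by fact
      show "AE x in lborel. (\<lambda>i. ?Q (X i) x) \<longlonglongrightarrow> f' t x"
      proof (rule AE_I2)
        fix x
        have "((\<lambda>s. ?Q s x) \<longlongrightarrow> f' t x) (at t within S)"
          using deriv[OF S(2), of x]
          by (simp add: has_vector_derivative_iff_quotient)
        thus "(\<lambda>i. ?Q (X i) x) \<longlonglongrightarrow> f' t x"
          using X lim unfolding tendsto_at_iff_sequentially o_def by blast
      qed
      show "AE x in lborel. norm (?Q (X i) x) \<le> w x" for i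
      proof (rule AE_I2)
        fix x
        \<comment> \<open>The mean value inequality on \<open>S\<close> turns the bound on the
          derivative into a majorant of the quotients that does not depend on
          \<open>i\<close>.\<close>
        have "norm (f (X i) x - f t x) \<le> w x * norm (X i - t)"
        proof (rule differentiable_bound[OF S(1), where f' = "\<lambda>s h. h *\<^sub>R f' s x"])
          show "((\<lambda>s. f s x) has_derivative (\<lambda>h. h *\<^sub>R f' s x)) (at s within S)" if "s \<in> S" for s
            using deriv[OF that] by (simp add: has_vector_derivative_def)
          show "onorm (\<lambda>h. h *\<^sub>R f' s x) \<le> w x" if "s \<in> S" for s
            by (rule onorm_le) (use bound[OF that, of x] in \<open>simp add: mult.commute mult_left_mono\<close>)
        qed (use XS S in auto)
        thus "norm (?Q (X i) x) \<le> w x"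
          using XS(2)[of i] by (simp add: divide_simps)
      qed
    qed
  qed
  hence "((\<lambda>s. ((LINT x|lborel. f s x) - (LINT x|lborel. f t x)) /\<^sub>R (s - t)) \<longlongrightarrow> (LINT x|lborel. f' t x)) (at t within S)"
    by (rule Lim_transform_eventually)
       (auto simp: eventually_at_topological int S intro!: exI[of _ UNIV])
  thus ?thesis
    by (simp add: has_vector_derivative_iff_quotient)
qed

lemma integrable_inverse_1_plus_square_real: "integrable lborel (\<lambda>x::real. inverse (1 + x\<^sup>2))"
  using integrable_inverse_1_plus_square by (simp add: set_integrable_def)

text \<open>The form in which every integration by parts is carried out: \<open>G\<close> collects
  the boundary terms.\<close>

lemma lborel_integral_derivative_eq_0:
  fixes G :: "real \<Rightarrow> complex"
  assumes "\<And>x. (G has_vector_derivative g x) (at x)" and "continuous_on UNIV g"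
    and "integrable lborel g" and "(G \<longlongrightarrow> 0) at_top" and "(G \<longlongrightarrow> 0) at_bot"
  shows "(LINT x|lborel. g x) = 0"
proof -
  have "(LBINT x=-\<infinity>..\<infinity>. g x) = 0 - 0"
    by (rule interval_integral_FTC_integrable[where F = G])
       (use assms in \<open>auto simp: set_integrable_def ereal_tendsto_simps continuous_on_eq_continuous_at\<close>)
  thus ?thesis by (simp add: interval_lebesgue_integral_def set_lebesgue_integral_def)
qed

lemma integral_bound_inverse_1_plus_square:
  fixes p :: "real \<Rightarrow> complex"
  assumes cont: "continuous_on UNIV p" and bound: "\<And>x. norm (p x) \<le> B * inverse (1 + x\<^sup>2)"
  shows "integrable lborel p" and "norm (LINT x|lborel. p x) \<le> B * pi"
proof -
  have w: "integrable lborel (\<lambda>x. B * inverse (1 + x\<^sup>2))"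
    using integrable_inverse_1_plus_square_real by simp
  show int: "integrable lborel p"
  proof (rule Bochner_Integration.integrable_bound[OF w])
    show "p \<in> borel_measurable lborel"
      using borel_measurable_continuous_onI[OF cont] by simp
    show "AE x in lborel. norm (p x) \<le> norm (B * inverse (1 + x\<^sup>2))"
      using bound by (intro AE_I2) (auto intro: order_trans[OF _ abs_ge_self])
  qed
  have "norm (LINT x|lborel. p x) \<le> (LINT x|lborel. B * inverse (1 + x\<^sup>2))"
    using bound by (intro order_trans[OF integral_norm_bound] integral_mono integrable_norm int w) auto
  also have "(LINT x|lborel. inverse (1 + x\<^sup>2)) = pi"
    using LBINT_inverse_1_plus_square
    by (simp add: interval_lebesgue_integral_def set_lebesgue_integral_def)
  hence "(LINT x|lborel. B * inverse (1 + x\<^sup>2)) = B * pi" by simp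
  finally show "norm (LINT x|lborel. p x) \<le> B * pi" .
qed

text \<open>The fundamental theorem of calculus asks for the derivative in the interior only, so
  \<open>F\<close> is \<open>F 0\<close> plus the integral of \<open>F'\<close>, and the right-hand
  derivative at 0 follows from continuity of \<open>F'\<close>. This is how the singularity of
  \<open>sqrt\<close> at 0 is circumvented in the later chain rules.\<close>

lemma has_vector_derivative_Ici_I:
  fixes F :: "real \<Rightarrow> complex"
  assumes contF: "continuous_on {0..} F" and contF': "continuous_on {0..} F'"
    and deriv: "\<And>t. t > 0 \<Longrightarrow> (F has_vector_derivative F' t) (at t)" and t: "t \<ge> 0"
  shows "(F has_vector_derivative F' t) (at t within {0..})"
proof -
  have eq: "F x = F 0 + integral {0..x} F'" if "x \<in> {0..t+1}" for x
  proof -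
    have "(F' has_integral (F x - F 0)) {0..x}"
      by (rule fundamental_theorem_of_calculus_interior)
         (use that deriv in \<open>auto intro: continuous_on_subset[OF contF]\<close>)
    thus ?thesis by (simp add: integral_unique)
  qed
  have "((\<lambda>x. integral {0..x} F') has_vector_derivative F' t) (at t within {0..t+1})"
    by (rule integral_has_vector_derivative) (use t in \<open>auto intro: continuous_on_subset[OF contF']\<close>)
  hence "((\<lambda>x. F 0 + integral {0..x} F') has_vector_derivative F' t) (at t within {0..t+1})"
    using has_vector_derivative_add[OF has_vector_derivative_const, of "\<lambda>x. integral {0..x} F'" "F' t" _ "F 0"]
    by simp
  hence "(F has_vector_derivative F' t) (at t within {0..t+1})"
    by (rule has_vector_derivative_transform[rotated 2]) (use t in \<open>auto intro: eq\<close>)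
  moreover have "at t within {0..t+1} = at t within {0..}"
    by (rule at_within_nhd[of t "{..<t+1}"]) (use t in auto)
  ultimately show ?thesis by simp
qed

text \<open>The seminorms of the Schwartz space of the half-line. The constant \<open>B\<close> is
  kept visible because the density argument needs bounds that are uniform in
  \<open>h\<close>.\<close>

definition seq_bound :: "nat \<Rightarrow> nat \<Rightarrow> real \<Rightarrow> (nat \<Rightarrow> real \<Rightarrow> complex) \<Rightarrow> bool" where
  "seq_bound M N B h \<longleftrightarrow> (\<forall>m\<le>M. \<forall>u\<ge>0. (1 + u) ^ N * norm (h m u) \<le> B)"

lemma seq_boundD: "seq_bound M N B h \<Longrightarrow> m \<le> M \<Longrightarrow> u \<ge> 0 \<Longrightarrow> (1 + u) ^ N * norm (h m u) \<le> B"
  by (simp add: seq_bound_def)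

lemma seq_bound_nonneg: "seq_bound M N B h \<Longrightarrow> B \<ge> 0"
  using seq_boundD[of M N B h 0 0] order_trans[OF norm_ge_zero[of "h 0 0"]] by simp

lemma seq_boundD_le:
  assumes "seq_bound M N B h" "m \<le> M" "u \<ge> 0" "N' \<le> N"
  shows "(1 + u) ^ N' * norm (h m u) \<le> B"
  using seq_boundD[OF assms(1-3)] mult_right_mono[OF power_increasing[OF assms(4), of "1+u"], of "norm (h m u)"] assms
  by simp

lemma seq_bound_mono:
  "seq_bound M N B h \<Longrightarrow> M' \<le> M \<Longrightarrow> N' \<le> N \<Longrightarrow> B \<le> B' \<Longrightarrow> seq_bound M' N' B' h"
  unfolding seq_bound_def[of M']
  by (intro allI impI order_trans[OF seq_boundD_le[of M N B h]]) auto

lemma rapid_on_seq_bound: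
  assumes "rapid_on {0..} h"
  obtains B where "seq_bound M N B h"
proof -
  have "\<exists>B. seq_bound M N B h"
  proof (induction M)
    case 0
    show ?case using rapid_on_bound[OF assms, of N 0] by (auto simp: seq_bound_def)
  next
    case (Suc M)
    then obtain B where B: "seq_bound M N B h" by blast
    obtain C where "\<And>u. u \<in> {0..} \<Longrightarrow> (1 + \<bar>u\<bar>) ^ N * norm (h (Suc M) u) \<le> C"
      using rapid_on_bound[OF assms, of N "Suc M"] by blast
    hence "seq_bound (Suc M) N (max B C) h"
      using B by (auto simp: seq_bound_def le_Suc_eq intro: max.coboundedI1 max.coboundedI2)
    thus ?case by blast
  qed
  thus ?thesis using that by blast
qed

lemma rapid_onI:
  assumes "deriv_seq_on {0..} h" and "\<And>m N. \<exists>M B. m \<le> M \<and> seq_bound M N B h"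
  shows "rapid_on {0..} h"
  unfolding rapid_on_def
proof (intro conjI allI)
  fix m N
  obtain M B where "m \<le> M" "seq_bound M N B h" using assms(2)[of m N] by blast
  thus "\<exists>B. \<forall>u\<in>{0..}. (1 + \<bar>u\<bar>) ^ N * norm (h m u) \<le> B"
    by (intro exI[of _ B]) (auto simp: seq_bound_def)
qed fact

lemma continuous_on_square_comp:
  assumes "rapid_on {0..} h" "v \<ge> 0"
  shows "continuous_on A (\<lambda>y. h m (v + y\<^sup>2))"
  by (rule continuous_on_compose2[OF deriv_seq_on_continuous[OF rapid_on_deriv_seq[OF assms(1)]]])
     (use assms in \<open>auto intro!: continuous_intros\<close>)

lemma continuous_on_square_comp0 [continuous_intros]:
  "rapid_on {0..} h \<Longrightarrow> continuous_on A (\<lambda>y. h m (y\<^sup>2))"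
  using continuous_on_square_comp[of h 0 A m] by simp

section \<open>Abel and cosine transforms\<close>

text \<open>For \<open>m = 0\<close> and \<open>v = x^2\<close> this is the integral of the planar
  radial function over the vertical line at abscissa \<open>x\<close>. Differentiation in
  \<open>v\<close> falls on \<open>h\<close>, so the index is handed through.\<close>

definition abel :: "(nat \<Rightarrow> real \<Rightarrow> complex) \<Rightarrow> nat \<Rightarrow> real \<Rightarrow> complex" where
  "abel h m v = (LINT y|lborel. h m (v + y\<^sup>2))"

text \<open>One power of the weight is traded for integrability:
  \<open>(1 + v) ^ N * (1 + y^2)\<close> is at most \<open>(1 + v + y^2) ^ Suc N\<close>, and
  \<open>pi\<close> is the integral of \<open>1 / (1 + y^2)\<close>.\<close>

lemma abel_bound:
  assumes h: "rapid_on {0..} h" and B: "seq_bound m (Suc N) B h" and v: "v \<ge> 0"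
  shows "integrable lborel (\<lambda>y. h m (v + y\<^sup>2))"
    and "(1 + v) ^ N * norm (abel h m v) \<le> B * pi"
    and "(1 + v) ^ N * norm (h m (v + y\<^sup>2)) \<le> B * inverse (1 + y\<^sup>2)"
proof -
  show bd: "(1 + v) ^ N * norm (h m (v + y\<^sup>2)) \<le> B * inverse (1 + y\<^sup>2)" for y
  proof -
    have "(1 + v) ^ N * (1 + y\<^sup>2) * norm (h m (v + y\<^sup>2)) \<le>
        (1 + (v + y\<^sup>2)) ^ N * (1 + (v + y\<^sup>2)) * norm (h m (v + y\<^sup>2))"
      by (intro mult_right_mono mult_mono power_mono) (use v in auto)
    also have "\<dots> \<le> B"
      using seq_boundD[OF B, of m "v + y\<^sup>2"] v by (simp add: mult_ac)
    finally show ?thesis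
      by (simp add: field_simps add_pos_nonneg)
  qed
  have pos: "(1 + v) ^ N > 0" using v by simp
  have *: "continuous_on UNIV (\<lambda>y. (1 + v) ^ N *\<^sub>R h m (v + y\<^sup>2))"
    by (intro continuous_intros continuous_on_square_comp h v)
  have "norm ((1 + v) ^ N *\<^sub>R h m (v + y\<^sup>2)) \<le> B * inverse (1 + y\<^sup>2)" for y
    using bd[of y] v by simp
  note ** = integral_bound_inverse_1_plus_square[OF * this]
  show "integrable lborel (\<lambda>y. h m (v + y\<^sup>2))"
  proof -
    define c where "c = (1 + v) ^ N"
    have "c \<noteq> 0" using pos unfolding c_def by linarith
    thus ?thesis
      using integrable_scaleR_right[of "inverse c", OF **(1)[folded c_def]] by simp
  qed
  show "(1 + v) ^ N * norm (abel h m v) \<le> B * pi"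
    using **(2) v by (simp add: abel_def)
qed

lemma seq_bound_abel:
  assumes h: "rapid_on {0..} h" and B: "seq_bound M (Suc N) B h"
  shows "seq_bound M N (B * pi) (abel h)"
  unfolding seq_bound_def
  by (intro allI impI abel_bound(2)[OF h]) (use seq_bound_mono[OF B] in auto)

lemma rapid_on_abel:
  assumes h: "rapid_on {0..} h"
  shows "rapid_on {0..} (abel h)"
proof (rule rapid_onI)
  show "\<exists>M B. m \<le> M \<and> seq_bound M N B (abel h)" for m N
    using rapid_on_seq_bound[OF h] seq_bound_abel[OF h] by (metis order_refl)
  show "deriv_seq_on {0..} (abel h)"
    unfolding deriv_seq_on_def
  proof (intro allI ballI)
    fix m and v :: real assume v: "v \<in> {0..}"
    obtain B where B: "seq_bound (Suc m) 1 B h" using rapid_on_seq_bound[OF h] .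
    show "(abel h m has_vector_derivative abel h (Suc m) v) (at v within {0..})"
      unfolding abel_def
    proof (rule has_vector_derivative_lborel_integral)
      show "integrable lborel (\<lambda>x. h m (t + x\<^sup>2))" if "t \<in> {0..}" for t
        using abel_bound(1)[OF h seq_bound_mono[OF B, of m "Suc 0"]] that by auto
      show "(\<lambda>x. h (Suc m) (v + x\<^sup>2)) \<in> borel_measurable lborel"
        using borel_measurable_continuous_onI[OF continuous_on_square_comp[OF h]] v by simp
      show "norm (h (Suc m) (t + x\<^sup>2)) \<le> B * inverse (1 + x\<^sup>2)" if "t \<in> {0..}" for t x
        using abel_bound(3)[OF h, of "Suc m" 0 B] B that by simp
      show "integrable lborel (\<lambda>x. B * inverse (1 + x\<^sup>2))"
        using integrable_inverse_1_plus_square_real by simp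
      show "((\<lambda>t. h m (t + x\<^sup>2)) has_vector_derivative h (Suc m) (t + x\<^sup>2)) (at t within {0..})"
        if "t \<in> {0..}" for t x
      proof -
        have "(h m has_vector_derivative h (Suc m) (t + x\<^sup>2)) (at (t + x\<^sup>2) within (\<lambda>t. t + x\<^sup>2) ` {0..})"
          by (rule has_vector_derivative_within_subset[OF rapid_onD[OF h]]) (use that in auto)
        moreover have "((\<lambda>t. t + x\<^sup>2) has_vector_derivative 1) (at t within {0..})"
          by (auto intro!: derivative_eq_intros simp flip: has_real_derivative_iff_has_vector_derivative)
        ultimately show ?thesis
          using vector_diff_chain_within[of "\<lambda>t. t + x\<^sup>2" 1 t "{0..}" "h m"] by (simp add: o_def)
      qed
    qed (use v in auto)
  qed
qed

section \<open>The cosine transform as a function of the squared frequency\<close>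

definition fcos :: "(nat \<Rightarrow> real \<Rightarrow> complex) \<Rightarrow> real \<Rightarrow> complex" where
  "fcos h s = (LINT x|lborel. h 0 (x\<^sup>2) * of_real (cos (2 * pi * sqrt s * x)))"

lemma has_vector_derivative_square_comp:
  assumes h: "rapid_on {0..} h"
  shows "((\<lambda>x. h m (x\<^sup>2)) has_vector_derivative of_real (2 * x) * h (Suc m) (x\<^sup>2)) (at x)"
proof -
  have "(h m has_vector_derivative h (Suc m) (x\<^sup>2)) (at (x\<^sup>2) within range (\<lambda>x. x\<^sup>2))"
    by (rule has_vector_derivative_within_subset[OF rapid_onD[OF h]]) auto
  moreover have "((\<lambda>x::real. x\<^sup>2) has_vector_derivative 2 * x) (at x)"
    by (auto intro!: derivative_eq_intros simp flip: has_real_derivative_iff_has_vector_derivative)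
  ultimately show ?thesis
    using vector_diff_chain_within[of "\<lambda>x. x\<^sup>2" "2 * x" x UNIV "h m" "h (Suc m) (x\<^sup>2)"]
    by (simp add: o_def scaleR_conv_of_real)
qed

text \<open>All three are instances of \<open>c <= 1 + x^2\<close>, with \<open>c\<close> one of the
  factors produced by the chain rule for \<open>x^2\<close> and by differentiating the
  cosine.\<close>

lemma square_comp_bound:
  assumes "seq_bound M 3 B h" "m \<le> M"
  shows "norm (h m (x\<^sup>2)) \<le> B * inverse (1 + x\<^sup>2)"
    and "\<bar>x\<bar> * norm (h m (x\<^sup>2)) \<le> B * inverse (1 + x\<^sup>2)"
    and "x\<^sup>2 * norm (h m (x\<^sup>2)) \<le> B * inverse (1 + x\<^sup>2)"
proof -
  have pos: "1 + x\<^sup>2 > 0" by (simp add: add_pos_nonneg)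
  have a: "c * norm (h m (x\<^sup>2)) \<le> B * inverse (1 + x\<^sup>2)" if "c \<le> 1 + x\<^sup>2" for c
  proof -
    have "c * norm (h m (x\<^sup>2)) * (1 + x\<^sup>2) \<le> (1 + x\<^sup>2) * norm (h m (x\<^sup>2)) * (1 + x\<^sup>2)"
      by (intro mult_right_mono that) auto
    also have "\<dots> = (1 + x\<^sup>2) ^ 2 * norm (h m (x\<^sup>2))" by (simp add: power2_eq_square)
    also have "\<dots> \<le> B" by (rule seq_boundD_le[OF assms(1)]) (use assms in auto)
    finally show ?thesis using pos by (simp add: field_simps)
  qed
  have "\<bar>x\<bar> \<le> 1 + x\<^sup>2"
    using zero_le_power2[of "\<bar>x\<bar> - 1"] by (simp add: power2_diff)
  with a[of 1] a[of "\<bar>x\<bar>"] a[of "x\<^sup>2"] show "norm (h m (x\<^sup>2)) \<le> B * inverse (1 + x\<^sup>2)"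
    and "\<bar>x\<bar> * norm (h m (x\<^sup>2)) \<le> B * inverse (1 + x\<^sup>2)"
    and "x\<^sup>2 * norm (h m (x\<^sup>2)) \<le> B * inverse (1 + x\<^sup>2)"
    by auto
qed

lemma integrable_fcos:
  assumes h: "rapid_on {0..} h"
  shows "integrable lborel (\<lambda>x. h m (x\<^sup>2) * of_real (cos (c * x)))"
proof -
  obtain B where B: "seq_bound m 3 B h" using rapid_on_seq_bound[OF h] .
  show ?thesis
  proof (rule integral_bound_inverse_1_plus_square)
    show "continuous_on UNIV (\<lambda>x. h m (x\<^sup>2) * complex_of_real (cos (c * x)))"
      by (intro continuous_intros h)
    show "norm (h m (x\<^sup>2) * complex_of_real (cos (c * x))) \<le> B * inverse (1 + x\<^sup>2)" for x
    proof -
      have "norm (h m (x\<^sup>2) * complex_of_real (cos (c * x))) \<le> norm (h m (x\<^sup>2)) * 1"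
        unfolding norm_mult by (intro mult_left_mono) auto
      thus ?thesis using square_comp_bound(1)[OF B, of m x] by simp
    qed
  qed
qed

lemma fcos_bound:
  assumes h: "rapid_on {0..} h" and B: "seq_bound 0 1 B h"
  shows "norm (fcos h s) \<le> B * pi"
  unfolding fcos_def
proof (rule integral_bound_inverse_1_plus_square)
  show "continuous_on UNIV (\<lambda>x. h 0 (x\<^sup>2) * complex_of_real (cos (2 * pi * sqrt s * x)))"
    by (intro continuous_intros h)
  show "norm (h 0 (x\<^sup>2) * complex_of_real (cos (2 * pi * sqrt s * x))) \<le> B * inverse (1 + x\<^sup>2)" for x
  proof -
    have "norm (h 0 (x\<^sup>2) * complex_of_real (cos (2 * pi * sqrt s * x))) \<le> norm (h 0 (x\<^sup>2)) * 1"
      unfolding norm_mult by (intro mult_left_mono) auto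
    also have "\<dots> \<le> B * inverse (1 + x\<^sup>2)"
      using seq_boundD[OF B, of 0 "x\<^sup>2"] by (simp add: field_simps add_pos_nonneg)
    finally show ?thesis .
  qed
qed

text \<open>Disposes of the boundary terms; the hypothesis on \<open>G\<close> is shaped to cover
  both \<open>h 0 (x^2) * sin (c * x)\<close> and
  \<open>2 * x * h 1 (x^2) * cos (c * x)\<close>.\<close>

lemma square_comp_tendsto_0:
  assumes h: "rapid_on {0..} h"
    and G: "\<And>x. norm (G x :: complex) \<le> C * ((1 + \<bar>x\<bar>) * norm (h 0 (x\<^sup>2)) + (1 + \<bar>x\<bar>) * norm (h 1 (x\<^sup>2)))"
    and "C \<ge> 0"
  shows "(G \<longlongrightarrow> 0) at_top" "(G \<longlongrightarrow> 0) at_bot"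
proof -
  obtain B where B: "seq_bound 1 3 B h" using rapid_on_seq_bound[OF h] .
  have b: "norm (G x) \<le> 4 * C * B * inverse (1 + x\<^sup>2)" for x
  proof -
    have "(1 + \<bar>x\<bar>) * norm (h 0 (x\<^sup>2)) + (1 + \<bar>x\<bar>) * norm (h 1 (x\<^sup>2)) \<le> 4 * (B * inverse (1 + x\<^sup>2))"
      using square_comp_bound(1,2)[OF B, of 0 x] square_comp_bound(1,2)[OF B, of 1 x]
      by (simp add: distrib_right)
    from mult_left_mono[OF this \<open>C \<ge> 0\<close>] G[of x] show ?thesis by (simp add: mult_ac)
  qed
  have top: "((\<lambda>x::real. 4 * C * B * inverse (1 + x\<^sup>2)) \<longlongrightarrow> 0) at_top" by real_asymp
  show "(G \<longlongrightarrow> 0) at_top" by (rule Lim_null_comparison[OF _ top]) (use b in auto)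
  have bot: "((\<lambda>x::real. 4 * C * B * inverse (1 + x\<^sup>2)) \<longlongrightarrow> 0) at_bot" by real_asymp
  show "(G \<longlongrightarrow> 0) at_bot" by (rule Lim_null_comparison[OF _ bot]) (use b in auto)
qed

text \<open>Integration by parts, since \<open>2 * x * h 1 (x^2)\<close> is the derivative of
  \<open>h 0 (x^2)\<close>.\<close>

lemma integral_square_comp_sin:
  assumes h: "rapid_on {0..} h"
  shows "(LINT x|lborel. of_real (2 * x) * h 1 (x\<^sup>2) * of_real (sin (c * x))) =
    - of_real c * (LINT x|lborel. h 0 (x\<^sup>2) * of_real (cos (c * x)))"
proof -
  obtain B where B: "seq_bound 1 3 B h" using rapid_on_seq_bound[OF h] .
  have int1: "integrable lborel (\<lambda>x. of_real (2 * x) * h 1 (x\<^sup>2) * of_real (sin (c * x)))"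
  proof (rule integral_bound_inverse_1_plus_square)
    show "continuous_on UNIV (\<lambda>x. complex_of_real (2 * x) * h 1 (x\<^sup>2) * of_real (sin (c * x)))"
      by (intro continuous_intros h)
    show "norm (complex_of_real (2 * x) * h 1 (x\<^sup>2) * of_real (sin (c * x))) \<le> (2 * B) * inverse (1 + x\<^sup>2)" for x
    proof -
      have "norm (complex_of_real (2 * x) * h 1 (x\<^sup>2) * of_real (sin (c * x))) \<le> norm (complex_of_real (2 * x) * h 1 (x\<^sup>2)) * 1"
        unfolding norm_mult[of _ "of_real (sin (c * x))"] by (intro mult_left_mono) auto
      thus ?thesis using square_comp_bound(2)[OF B, of 1 x] by (simp add: norm_mult)
    qed
  qed
  note int2 = integrable_fcos[OF h, of 0 c]
  have "(LINT x|lborel. of_real (2 * x) * h 1 (x\<^sup>2) * of_real (sin (c * x)) +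
      of_real c * (h 0 (x\<^sup>2) * of_real (cos (c * x)))) = 0"
  proof (rule lborel_integral_derivative_eq_0)
    let ?G = "\<lambda>x. h 0 (x\<^sup>2) * complex_of_real (sin (c * x))"
    show "(?G has_vector_derivative of_real (2 * x) * h 1 (x\<^sup>2) * of_real (sin (c * x)) +
      of_real c * (h 0 (x\<^sup>2) * of_real (cos (c * x)))) (at x)" for x
    proof -
      have "((\<lambda>x. complex_of_real (sin (c * x))) has_vector_derivative of_real (cos (c * x) * c)) (at x)"
        by (intro has_vector_derivative_of_real) (auto intro!: derivative_eq_intros)
      from has_vector_derivative_mult[OF has_vector_derivative_square_comp[OF h, of 0 x] this]
      show ?thesis by (simp add: mult_ac add_ac)
    qed
    show "continuous_on UNIV (\<lambda>x. of_real (2 * x) * h 1 (x\<^sup>2) * of_real (sin (c * x)) +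
      of_real c * (h 0 (x\<^sup>2) * of_real (cos (c * x))))"
      by (intro continuous_intros h)
    show "integrable lborel (\<lambda>x. of_real (2 * x) * h 1 (x\<^sup>2) * of_real (sin (c * x)) +
      of_real c * (h 0 (x\<^sup>2) * of_real (cos (c * x))))"
      by (intro Bochner_Integration.integrable_add int1 integrable_mult_right int2)
    have G: "norm (?G x) \<le> 1 * ((1 + \<bar>x\<bar>) * norm (h 0 (x\<^sup>2)) + (1 + \<bar>x\<bar>) * norm (h 1 (x\<^sup>2)))" for x
    proof -
      have "norm (?G x) \<le> norm (h 0 (x\<^sup>2)) * 1"
        unfolding norm_mult by (intro mult_left_mono) auto
      also have "\<dots> \<le> (1 + \<bar>x\<bar>) * norm (h 0 (x\<^sup>2)) + (1 + \<bar>x\<bar>) * norm (h 1 (x\<^sup>2))"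
        by (simp add: distrib_right add_nonneg_nonneg)
      finally show ?thesis by simp
    qed
    show "(?G \<longlongrightarrow> 0) at_top" "(?G \<longlongrightarrow> 0) at_bot"
      by (rule square_comp_tendsto_0[OF h G]; simp)+
  qed
  thus ?thesis
    by (subst (asm) Bochner_Integration.integral_add[OF int1 integrable_mult_right[OF int2]])
       (simp add: add_eq_0_iff)
qed

text \<open>The variable is the frequency itself, in which nothing is singular at 0;
  \<open>sqrt s\<close> is substituted afterwards.\<close>

lemma has_vector_derivative_integral_cos:
  assumes h: "rapid_on {0..} h"
  shows "((\<lambda>\<xi>. LINT x|lborel. h m (x\<^sup>2) * of_real (cos (2 * pi * \<xi> * x))) has_vector_derivative
    (LINT x|lborel. h m (x\<^sup>2) * of_real (- (2 * pi * x) * sin (2 * pi * \<xi> * x)))) (at \<xi>)"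
proof -
  obtain B where B: "seq_bound m 3 B h" using rapid_on_seq_bound[OF h] .
  show ?thesis
  proof (rule has_vector_derivative_lborel_integral[where S = UNIV])
    show "integrable lborel (\<lambda>x. h m (x\<^sup>2) * of_real (cos (2 * pi * \<xi> * x)))" for \<xi>
      using integrable_fcos[OF h, of m "2 * pi * \<xi>"] .
    have "continuous_on UNIV (\<lambda>x. h m (x\<^sup>2) * complex_of_real (- (2 * pi * x) * sin (2 * pi * \<xi> * x)))"
      by (intro continuous_intros h)
    thus "(\<lambda>x. h m (x\<^sup>2) * of_real (- (2 * pi * x) * sin (2 * pi * \<xi> * x))) \<in> borel_measurable lborel"
      unfolding measurable_lborel2 by (rule borel_measurable_continuous_onI)
    show "((\<lambda>\<xi>. h m (x\<^sup>2) * of_real (cos (2 * pi * \<xi> * x))) has_vector_derivative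
        h m (x\<^sup>2) * of_real (- (2 * pi * x) * sin (2 * pi * \<xi> * x))) (at \<xi>)" for \<xi> x
      by (intro has_vector_derivative_mult_right has_vector_derivative_of_real)
         (auto intro!: derivative_eq_intros)
    show "norm (h m (x\<^sup>2) * of_real (- (2 * pi * x) * sin (2 * pi * \<xi> * x))) \<le> (2 * pi * B) * inverse (1 + x\<^sup>2)" for \<xi> x
    proof -
      have "norm (h m (x\<^sup>2) * of_real (- (2 * pi * x) * sin (2 * pi * \<xi> * x))) =
          (2 * pi) * (\<bar>x\<bar> * norm (h m (x\<^sup>2))) * \<bar>sin (2 * pi * \<xi> * x)\<bar>"
        by (simp add: norm_mult abs_mult)
      also have "\<dots> \<le> (2 * pi) * (\<bar>x\<bar> * norm (h m (x\<^sup>2))) * 1"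
        by (intro mult_left_mono) auto
      also have "\<dots> \<le> (2 * pi) * (B * inverse (1 + x\<^sup>2))"
        using square_comp_bound(2)[OF B, of m x] by simp
      finally show ?thesis by simp
    qed
    show "integrable lborel (\<lambda>x. (2 * pi * B) * inverse (1 + x\<^sup>2))"
      using integrable_inverse_1_plus_square_real by simp
  qed auto
qed

lemma continuous_on_fcos:
  assumes h: "rapid_on {0..} h"
  shows "continuous_on A (fcos h)"
proof -
  have "continuous_on UNIV (\<lambda>\<xi>. LINT x|lborel. h 0 (x\<^sup>2) * complex_of_real (cos (2 * pi * \<xi> * x)))"
    using has_vector_derivative_continuous[OF has_vector_derivative_integral_cos[OF h]]
    by (simp add: continuous_on_eq_continuous_within)
  from continuous_on_compose2[OF this, of A sqrt] show ?thesis
    by (simp add: fcos_def[abs_def] continuous_intros)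
qed

lemma rapid_on_Suc: "rapid_on S h \<Longrightarrow> rapid_on S (\<lambda>m. h (Suc m))"
  by (auto simp: rapid_on_def deriv_seq_on_def)

text \<open>Differentiating the cosine brings down \<open>x\<close>, which together with
  \<open>h 1 (x^2)\<close> is again a derivative, so integration by parts returns \<open>h 0\<close>
  with the factor \<open>2 * pi^2 * sqrt s\<close>. The chain rule contributes
  \<open>1 / (2 * sqrt s)\<close>, and the singularity cancels.\<close>

lemma has_vector_derivative_fcos:
  assumes h: "rapid_on {0..} h" and s: "s \<ge> 0"
  shows "(fcos (\<lambda>m. h (Suc m)) has_vector_derivative of_real (pi\<^sup>2) * fcos h s) (at s within {0..})"
proof (rule has_vector_derivative_Ici_I[OF _ _ _ s])
  fix s :: real assume s: "s > 0"
  let ?c = "\<lambda>\<xi>. LINT x|lborel. h 1 (x\<^sup>2) * complex_of_real (cos (2 * pi * \<xi> * x))"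
  have "(\<lambda>x. h 1 (x\<^sup>2) * of_real (- (2 * pi * x) * sin (2 * pi * sqrt s * x))) =
      (\<lambda>x. - of_real pi * (of_real (2 * x) * h 1 (x\<^sup>2) * of_real (sin (2 * pi * sqrt s * x))))"
    by (simp add: fun_eq_iff)
  hence "(LINT x|lborel. h 1 (x\<^sup>2) * of_real (- (2 * pi * x) * sin (2 * pi * sqrt s * x))) =
      of_real (2 * pi\<^sup>2 * sqrt s) * fcos h s"
    using integral_square_comp_sin[OF h, of "2 * pi * sqrt s"]
    by (simp add: fcos_def power2_eq_square)
  hence "(?c has_vector_derivative of_real (2 * pi\<^sup>2 * sqrt s) * fcos h s) (at (sqrt s))"
    using has_vector_derivative_integral_cos[OF h, of 1 "sqrt s"] by simp
  moreover have "(sqrt has_vector_derivative (inverse (sqrt s) / 2)) (at s)"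
    using DERIV_real_sqrt[OF s] by (simp add: has_real_derivative_iff_has_vector_derivative)
  ultimately have "(?c \<circ> sqrt has_vector_derivative
      (inverse (sqrt s) / 2) *\<^sub>R (of_real (2 * pi\<^sup>2 * sqrt s) * fcos h s)) (at s)"
    by (intro vector_diff_chain_at)
  moreover have "(inverse (sqrt s) / 2) *\<^sub>R (of_real (2 * pi\<^sup>2 * sqrt s) * fcos h s) = of_real (pi\<^sup>2) * fcos h s"
    using s by (simp add: scaleR_conv_of_real field_simps power2_eq_square)
  ultimately show "(fcos (\<lambda>m. h (Suc m)) has_vector_derivative of_real (pi\<^sup>2) * fcos h s) (at s)"
    by (simp add: o_def fcos_def[abs_def])
qed (intro continuous_intros continuous_on_fcos rapid_on_Suc h)+

text \<open>
  On profiles, \<open>laplace_op\<close> is \<open>1 - (d/dx)\<^sup>2 / (4 \<pi>\<^sup>2)\<close> acting on \<open>h 0 (x\<^sup>2)\<close>; the term with factor \<open>m\<close> comes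
  from differentiating the factor \<open>u\<close> in \<open>4 u H'' + 2 H'\<close>.
\<close>
definition laplace_op :: "(nat \<Rightarrow> real \<Rightarrow> complex) \<Rightarrow> nat \<Rightarrow> real \<Rightarrow> complex" where
  "laplace_op h m u = h m u - of_real (1 / (4 * pi\<^sup>2)) *
     (2 * h (Suc m) u + 4 * (of_real u * h (Suc (Suc m)) u + of_nat m * h (Suc m) u))"

text \<open>The second derivative costs two indices, its factor \<open>u\<close> one power of the
  weight. The constant is \<open>1 + 2 + 4 + 4 * M\<close>, with \<open>1 / (4 * pi^2)\<close>
  estimated by 1.\<close>

lemma seq_bound_laplace_op:
  assumes B: "seq_bound (M + 2) (Suc N) B h"
  shows "seq_bound M N ((7 + 4 * M) * B) (laplace_op h)"
  unfolding seq_bound_def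
proof (intro allI impI)
  fix m and u :: real assume m: "m \<le> M" and u: "u \<ge> 0"
  let ?w = "(1 + u) ^ N"
  have B0: "B \<ge> 0" using seq_bound_nonneg[OF B] .
  have 0: "?w * norm (h m u) \<le> B" and 1: "?w * norm (h (Suc m) u) \<le> B"
    by (rule seq_boundD_le[OF B]; use m u in simp)+
  have 2: "?w * (u * norm (h (Suc (Suc m)) u)) \<le> B"
  proof -
    have "?w * (u * norm (h (Suc (Suc m)) u)) \<le> ?w * ((1 + u) * norm (h (Suc (Suc m)) u))"
      using u by (intro mult_left_mono mult_right_mono) auto
    also have "\<dots> = (1 + u) ^ Suc N * norm (h (Suc (Suc m)) u)" by simp
    also have "\<dots> \<le> B" by (rule seq_boundD[OF B]) (use m u in auto)
    finally show ?thesis .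
  qed
  let ?t = "2 * h (Suc m) u + 4 * (of_real u * h (Suc (Suc m)) u + of_nat m * h (Suc m) u)"
  have "norm ?t \<le> 2 * norm (h (Suc m) u) + 4 * (u * norm (h (Suc (Suc m)) u) + m * norm (h (Suc m) u))"
    using u by (intro order_trans[OF norm_triangle_ineq] add_mono)
      (auto simp: norm_mult intro!: order_trans[OF norm_triangle_ineq])
  hence "?w * norm ?t \<le> ?w * (2 * norm (h (Suc m) u) + 4 * (u * norm (h (Suc (Suc m)) u) + m * norm (h (Suc m) u)))"
    using u by (intro mult_left_mono) auto
  also have "\<dots> = 2 * (?w * norm (h (Suc m) u)) + 4 * (?w * (u * norm (h (Suc (Suc m)) u)) + m * (?w * norm (h (Suc m) u)))"
    by (simp add: algebra_simps)
  also have "\<dots> \<le> 2 * B + 4 * (B + M * B)"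
    using m u B0 by (intro add_mono mult_left_mono mult_mono 1 2) auto
  finally have t: "?w * norm ?t \<le> (6 + 4 * M) * B" by (simp add: algebra_simps)
  have "1 / (4 * pi\<^sup>2) \<le> 1"
    using pi_ge_two power_mono[of 2 pi 2] by (simp add: divide_simps)
  hence "norm (of_real (1 / (4 * pi\<^sup>2)) * ?t) \<le> norm ?t"
    unfolding norm_mult norm_of_real by (intro mult_left_le_one_le) auto
  hence "norm (laplace_op h m u) \<le> norm (h m u) + norm ?t"
    unfolding laplace_op_def by (intro order_trans[OF norm_triangle_ineq4]) auto
  hence "?w * norm (laplace_op h m u) \<le> ?w * (norm (h m u) + norm ?t)"
    using u by (intro mult_left_mono) auto
  thus "?w * norm (laplace_op h m u) \<le> (7 + 4 * real M) * B"
    using t 0 by (simp add: algebra_simps)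
qed

lemma rapid_on_laplace_op:
  assumes h: "rapid_on {0..} h"
  shows "rapid_on {0..} (laplace_op h)"
proof (rule rapid_onI)
  show "\<exists>M B. m \<le> M \<and> seq_bound M N B (laplace_op h)" for m N
    using rapid_on_seq_bound[OF h] seq_bound_laplace_op by (metis order_refl)
  show "deriv_seq_on {0..} (laplace_op h)"
    unfolding deriv_seq_on_def
  proof (intro allI ballI)
    fix m and u :: real assume u: "u \<in> {0..}"
    note d = rapid_onD[OF h u]
    have id: "((\<lambda>u. complex_of_real u) has_vector_derivative of_real 1) (at u within {0..})"
      by (rule has_vector_derivative_of_real) auto
    have "((\<lambda>u. h m u - of_real (1 / (4 * pi\<^sup>2)) *
        (2 * h (Suc m) u + 4 * (of_real u * h (Suc (Suc m)) u + of_nat m * h (Suc m) u)))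
      has_vector_derivative
        h (Suc m) u - of_real (1 / (4 * pi\<^sup>2)) *
        (2 * h (Suc (Suc m)) u + 4 * ((of_real u * h (Suc (Suc (Suc m))) u + of_real 1 * h (Suc (Suc m)) u)
          + of_nat m * h (Suc (Suc m)) u))) (at u within {0..})"
      by (intro has_vector_derivative_diff has_vector_derivative_mult_right has_vector_derivative_add
            has_vector_derivative_mult d id)
    thus "(laplace_op h m has_vector_derivative laplace_op h (Suc m) u) (at u within {0..})"
      unfolding laplace_op_def[abs_def]
      by (rule has_vector_derivative_eq_rhs) (simp add: algebra_simps)
  qed
qed

text \<open>Write \<open>p x = h 0 (x^2)\<close>, so that
  \<open>p'' x = 2 * h 1 (x^2) + 4 * x^2 * h 2 (x^2)\<close>. Two integrations by parts turn
  \<open>- p'' / (4 * pi^2)\<close> into multiplication by \<open>s\<close>.\<close>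

lemma fcos_laplace_op:
  assumes h: "rapid_on {0..} h" and s: "s \<ge> 0"
  shows "fcos (laplace_op h) s = of_real (1 + s) * fcos h s"
proof -
  obtain B where B: "seq_bound 2 3 B h" using rapid_on_seq_bound[OF h] .
  define c where "c = 2 * pi * sqrt s"
  have c2: "c\<^sup>2 = 4 * pi\<^sup>2 * s" using s by (simp add: c_def power_mult_distrib)
  let ?q = "\<lambda>x. of_real 2 * h 1 (x\<^sup>2) + of_real (4 * x\<^sup>2) * h 2 (x\<^sup>2)"
  let ?cos = "\<lambda>x. complex_of_real (cos (c * x))" and ?sin = "\<lambda>x. complex_of_real (sin (c * x))"
  have int1: "integrable lborel (\<lambda>x. ?q x * ?cos x)"
  proof (rule integral_bound_inverse_1_plus_square)
    show "continuous_on UNIV (\<lambda>x. ?q x * ?cos x)"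
      by (intro continuous_intros h)
    show "norm (?q x * ?cos x) \<le> (6 * B) * inverse (1 + x\<^sup>2)" for x
    proof -
      have "norm (?q x * ?cos x) \<le> norm (?q x) * 1"
        unfolding norm_mult[of "?q x"] by (intro mult_left_mono) auto
      also have "norm (?q x) \<le> 2 * norm (h 1 (x\<^sup>2)) + 4 * (x\<^sup>2 * norm (h 2 (x\<^sup>2)))"
        by (rule order_trans[OF norm_triangle_ineq]) (simp add: norm_mult norm_power)
      also have "\<dots> \<le> 2 * (B * inverse (1 + x\<^sup>2)) + 4 * (B * inverse (1 + x\<^sup>2))"
        by (intro add_mono mult_left_mono square_comp_bound[OF B]) auto
      finally show ?thesis by simp
    qed
  qed
  note int2 = integrable_fcos[OF h, of 0 c]
  have "(LINT x|lborel. ?q x * ?cos x + of_real (c\<^sup>2) * (h 0 (x\<^sup>2) * ?cos x)) = 0"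
  proof (rule lborel_integral_derivative_eq_0)
    \<comment> \<open>Both integrations by parts at once: with \<open>p x = h 0 (x^2)\<close> the
      derivative of \<open>p' * cos + c * p * sin\<close> is \<open>(p'' + c^2 * p) * cos\<close>,
      the mixed terms cancelling.\<close>
    let ?G = "\<lambda>x. of_real (2 * x) * h 1 (x\<^sup>2) * ?cos x + of_real c * (h 0 (x\<^sup>2) * ?sin x)"
    show "(?G has_vector_derivative ?q x * ?cos x + of_real (c\<^sup>2) * (h 0 (x\<^sup>2) * ?cos x)) (at x)" for x
    proof -
      have s: "(?sin has_vector_derivative of_real (cos (c * x) * c)) (at x)"
        by (intro has_vector_derivative_of_real) (auto intro!: derivative_eq_intros)
      have cs: "(?cos has_vector_derivative of_real (- sin (c * x) * c)) (at x)"
        by (intro has_vector_derivative_of_real) (auto intro!: derivative_eq_intros)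
      have x: "((\<lambda>x. complex_of_real (2 * x)) has_vector_derivative of_real 2) (at x)"
        by (intro has_vector_derivative_of_real) (auto intro!: derivative_eq_intros)
      note hd = has_vector_derivative_square_comp[OF h]
      have "(?G has_vector_derivative
          (of_real (2 * x) * h 1 (x\<^sup>2) * of_real (- sin (c * x) * c) +
            (of_real (2 * x) * (of_real (2 * x) * h (Suc 1) (x\<^sup>2)) + of_real 2 * h 1 (x\<^sup>2)) * ?cos x) +
          of_real c * (h 0 (x\<^sup>2) * of_real (cos (c * x) * c) + of_real (2 * x) * h (Suc 0) (x\<^sup>2) * ?sin x)) (at x)"
        by (intro has_vector_derivative_add has_vector_derivative_mult has_vector_derivative_mult_right s cs x hd)
      thus ?thesis
        by (rule has_vector_derivative_eq_rhs) (simp add: algebra_simps power2_eq_square numeral_2_eq_2)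
    qed
    show "continuous_on UNIV (\<lambda>x. ?q x * ?cos x + of_real (c\<^sup>2) * (h 0 (x\<^sup>2) * ?cos x))"
      by (intro continuous_intros h)
    show "integrable lborel (\<lambda>x. ?q x * ?cos x + of_real (c\<^sup>2) * (h 0 (x\<^sup>2) * ?cos x))"
      by (intro Bochner_Integration.integrable_add int1 integrable_mult_right int2)
    have G: "norm (?G x) \<le> (2 + \<bar>c\<bar>) * ((1 + \<bar>x\<bar>) * norm (h 0 (x\<^sup>2)) + (1 + \<bar>x\<bar>) * norm (h 1 (x\<^sup>2)))" for x
    proof -
      have 1: "norm (of_real (2 * x) * h 1 (x\<^sup>2) * ?cos x) \<le> 2 * ((1 + \<bar>x\<bar>) * norm (h 1 (x\<^sup>2)))"
      proof -
        have "norm (of_real (2 * x) * h 1 (x\<^sup>2) * ?cos x) \<le> norm (of_real (2 * x) * h 1 (x\<^sup>2)) * 1"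
          unfolding norm_mult[of _ "?cos x"] by (intro mult_left_mono) auto
        also have "\<dots> \<le> 2 * ((1 + \<bar>x\<bar>) * norm (h 1 (x\<^sup>2)))"
          by (simp add: norm_mult distrib_right)
        finally show ?thesis .
      qed
      have 2: "norm (of_real c * (h 0 (x\<^sup>2) * ?sin x)) \<le> \<bar>c\<bar> * ((1 + \<bar>x\<bar>) * norm (h 0 (x\<^sup>2)))"
      proof -
        have "norm (of_real c * (h 0 (x\<^sup>2) * ?sin x)) = \<bar>c\<bar> * (norm (h 0 (x\<^sup>2)) * \<bar>sin (c * x)\<bar>)"
          by (simp add: norm_mult)
        also have "\<dots> \<le> \<bar>c\<bar> * (norm (h 0 (x\<^sup>2)) * 1)"
          by (intro mult_left_mono) auto
        also have "\<dots> \<le> \<bar>c\<bar> * ((1 + \<bar>x\<bar>) * norm (h 0 (x\<^sup>2)))"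
          by (intro mult_left_mono) (auto simp: distrib_right)
        finally show ?thesis .
      qed
      have "2 * ((1 + \<bar>x\<bar>) * norm (h 1 (x\<^sup>2))) + \<bar>c\<bar> * ((1 + \<bar>x\<bar>) * norm (h 0 (x\<^sup>2))) \<le>
          (2 + \<bar>c\<bar>) * ((1 + \<bar>x\<bar>) * norm (h 1 (x\<^sup>2))) + (2 + \<bar>c\<bar>) * ((1 + \<bar>x\<bar>) * norm (h 0 (x\<^sup>2)))"
        by (intro add_mono mult_right_mono) auto
      with 1 2 show ?thesis
        using norm_triangle_ineq[of "of_real (2 * x) * h 1 (x\<^sup>2) * ?cos x" "of_real c * (h 0 (x\<^sup>2) * ?sin x)"]
        unfolding distrib_left[of "2 + \<bar>c\<bar>"] by linarith
    qed
    show "(?G \<longlongrightarrow> 0) at_top" "(?G \<longlongrightarrow> 0) at_bot"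
      by (rule square_comp_tendsto_0[OF h G]; simp)+
  qed
  hence eq: "(LINT x|lborel. ?q x * ?cos x) = - of_real (c\<^sup>2) * (LINT x|lborel. h 0 (x\<^sup>2) * ?cos x)"
    by (subst (asm) Bochner_Integration.integral_add[OF int1 integrable_mult_right[OF int2]])
       (simp add: add_eq_0_iff)
  have "fcos (laplace_op h) s =
      (LINT x|lborel. h 0 (x\<^sup>2) * ?cos x - of_real (1 / (4 * pi\<^sup>2)) * (?q x * ?cos x))"
    unfolding fcos_def c_def by (rule arg_cong[where f = "integral\<^sup>L lborel"])
      (auto simp: fun_eq_iff laplace_op_def algebra_simps numeral_2_eq_2)
  also have "\<dots> = fcos h s - of_real (1 / (4 * pi\<^sup>2)) * (LINT x|lborel. ?q x * ?cos x)"
    unfolding fcos_def c_def[symmetric]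
    by (subst Bochner_Integration.integral_diff[OF int2 integrable_mult_right[OF int1]]) simp
  also have "(LINT x|lborel. ?q x * ?cos x) = - of_real (c\<^sup>2) * fcos h s"
    using eq by (simp add: fcos_def c_def)
  also have "fcos h s - of_real (1 / (4 * pi\<^sup>2)) * (- of_real (c\<^sup>2) * fcos h s) = of_real (1 + s) * fcos h s"
    unfolding c2 by (simp add: field_simps)
  finally show ?thesis .
qed

text \<open>Of all primitives of \<open>h 0\<close> only the one that vanishes at infinity decays.
  The operator inverts the shift of indices, so that the derivative of \<open>fcos h\<close> is
  \<open>pi^2\<close> times \<open>fcos (antideriv h)\<close>.\<close>

definition antideriv :: "(nat \<Rightarrow> real \<Rightarrow> complex) \<Rightarrow> nat \<Rightarrow> real \<Rightarrow> complex" where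
  "antideriv h = case_nat (\<lambda>v. - (LBINT t:{v<..}. h 0 t)) h"

lemma antideriv_Suc [simp]: "antideriv h (Suc m) = h m"
  by (simp add: antideriv_def)

text \<open>Two powers of the weight are spent: for \<open>t > v\<close> the product
  \<open>(1 + v) ^ N * (1 + t^2)\<close> is at most \<open>(1 + t) ^ (N + 2)\<close>.\<close>

lemma set_integral_Ioi_bound:
  assumes h: "rapid_on {0..} h" and B: "seq_bound 0 (N + 2) B h" and v: "v \<ge> 0"
  shows "set_integrable lborel {v<..} (h 0)"
    and "(1 + v) ^ N * norm (LBINT t:{v<..}. h 0 t) \<le> B * pi"
proof -
  have pos: "(1 + v) ^ N > 0" using v by simp
  let ?p = "\<lambda>t. indicator {v<..} t *\<^sub>R h 0 t"
  have bd: "(1 + v) ^ N * norm (?p t) \<le> B * inverse (1 + t\<^sup>2)" for t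
  proof (cases "t > v")
    case True
    have "(1 + v) ^ N * (1 + t\<^sup>2) * norm (h 0 t) \<le> (1 + t) ^ N * (1 + t)\<^sup>2 * norm (h 0 t)"
      using True v by (intro mult_right_mono mult_mono power_mono) (auto simp: power2_sum)
    also have "\<dots> \<le> B"
      using seq_boundD[OF B, of 0 t] True v by (simp add: power_add power2_eq_square mult_ac)
    finally show ?thesis using True by (simp add: field_simps add_pos_nonneg)
  next
    case False
    thus ?thesis using seq_bound_nonneg[OF B] by simp
  qed
  have meas: "?p \<in> borel_measurable lborel"
    unfolding measurable_lborel2
    by (rule borel_measurable_continuous_on_indicator)
      (use v in \<open>auto intro: continuous_on_subset[OF deriv_seq_on_continuous[OF rapid_on_deriv_seq[OF h]]]\<close>)
  have w: "integrable lborel (\<lambda>x. (B / (1 + v) ^ N) * inverse (1 + x\<^sup>2))"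
    using integrable_inverse_1_plus_square_real by simp
  have bd': "norm (?p t) \<le> (B / (1 + v) ^ N) * inverse (1 + t\<^sup>2)" for t
    using bd[of t] pos by (simp only: times_divide_eq_left pos_le_divide_eq mult.commute[of _ "(1 + v) ^ N"])
  show int: "set_integrable lborel {v<..} (h 0)"
    unfolding set_integrable_def
    by (rule Bochner_Integration.integrable_bound[OF w meas])
       (rule AE_I2, rule order_trans[OF bd' order_trans[OF abs_ge_self]], simp only: real_norm_def)
  have "norm (LBINT t:{v<..}. h 0 t) \<le> (LINT x|lborel. (B / (1 + v) ^ N) * inverse (1 + x\<^sup>2))"
    unfolding set_lebesgue_integral_def
    by (rule order_trans[OF integral_norm_bound],
        rule integral_mono[OF integrable_norm[OF int[unfolded set_integrable_def]] w bd'])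
  also have "\<dots> = (B / (1 + v) ^ N) * pi"
    using LBINT_inverse_1_plus_square
    by (simp add: interval_lebesgue_integral_def set_lebesgue_integral_def)
  finally have "(1 + v) ^ N * norm (LBINT t:{v<..}. h 0 t) \<le> (1 + v) ^ N * ((B / (1 + v) ^ N) * pi)"
    using pos by (intro mult_left_mono) auto
  thus "(1 + v) ^ N * norm (LBINT t:{v<..}. h 0 t) \<le> B * pi"
    using v by simp
qed

lemma seq_bound_antideriv:
  assumes h: "rapid_on {0..} h" and B: "seq_bound M (N + 2) B h"
  shows "seq_bound (Suc M) N (B * pi) (antideriv h)"
  unfolding seq_bound_def
proof (intro allI impI)
  fix m and u :: real assume m: "m \<le> Suc M" and u: "u \<ge> 0"
  show "(1 + u) ^ N * norm (antideriv h m u) \<le> B * pi"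
  proof (cases m)
    case 0
    thus ?thesis
      using set_integral_Ioi_bound(2)[OF h seq_bound_mono[OF B] u, of N] by (simp add: antideriv_def)
  next
    case (Suc j)
    have "(1 + u) ^ N * norm (h j u) \<le> B"
      by (rule seq_boundD_le[OF B]) (use m u Suc in auto)
    also have "B * 1 \<le> B * pi"
      using seq_bound_nonneg[OF B] pi_ge_two by (intro mult_left_mono) auto
    finally show ?thesis using Suc by simp
  qed
qed

lemma rapid_on_antideriv:
  assumes h: "rapid_on {0..} h"
  shows "rapid_on {0..} (antideriv h)"
proof (rule rapid_onI)
  show "\<exists>M B. m \<le> M \<and> seq_bound M N B (antideriv h)" for m N
    using rapid_on_seq_bound[OF h, of m "N + 2"] seq_bound_antideriv[OF h, of m N] by (metis le_SucI order_refl)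
  show "deriv_seq_on {0..} (antideriv h)"
    unfolding deriv_seq_on_def
  proof (intro allI ballI)
    fix m and u :: real assume u: "u \<in> {0..}"
    show "(antideriv h m has_vector_derivative antideriv h (Suc m) u) (at u within {0..})"
    proof (cases m)
      case 0
      obtain B where B: "seq_bound 0 2 B h" using rapid_on_seq_bound[OF h] .
      have cont: "continuous_on {0..} (h 0)"
        using deriv_seq_on_continuous[OF rapid_on_deriv_seq[OF h]] .
      define c where "c = - (LBINT t:{0<..}. h 0 t)"
      \<comment> \<open>Rewritten as a constant plus an integral over a compact interval, the tail
        integral falls under the fundamental theorem of calculus.\<close>
      have eq: "antideriv h 0 v = c + integral {0..v} (h 0)" if "v \<ge> 0" for v
      proof -
        have i1: "set_integrable lborel {0..v} (h 0)"
          by (rule borel_integrable_atLeastAtMost') (auto intro: continuous_on_subset[OF cont])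
        hence i1': "set_integrable lborel {0<..v} (h 0)"
          by (rule set_integrable_subset) auto
        have i2: "set_integrable lborel {v<..} (h 0)"
          by (rule set_integral_Ioi_bound(1)[OF h, of 0 B]) (use B that in \<open>auto simp: numeral_2_eq_2\<close>)
        have "{0<..v} \<union> {v<..} = {0<..}" using that by auto
        moreover have "(LBINT t:{0<..v} \<union> {v<..}. h 0 t) = (LBINT t:{0<..v}. h 0 t) + (LBINT t:{v<..}. h 0 t)"
          by (rule set_integral_Un[OF _ i1' i2]) auto
        ultimately have "(LBINT t:{0<..}. h 0 t) = (LBINT t:{0<..v}. h 0 t) + (LBINT t:{v<..}. h 0 t)"
          by (simp only:)
        also have "(LBINT t:{0<..v}. h 0 t) = (LBINT t:{0..v}. h 0 t)"
        proof (rule set_integral_cong_set)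
          show "set_borel_measurable lborel {0<..v} (h 0)" "set_borel_measurable lborel {0..v} (h 0)"
            using i1 i1' by (simp_all add: set_integrable_def set_borel_measurable_def
                borel_measurable_integrable)
          show "AE x in lborel. (x \<in> {0..v}) = (x \<in> {0<..v})"
            using AE_lborel_singleton[of 0] by eventually_elim auto
        qed
        also have "\<dots> = integral {0..v} (h 0)"
          by (rule set_borel_integral_eq_integral(2)[OF i1])
        finally show ?thesis by (simp add: c_def antideriv_def)
      qed
      show ?thesis unfolding 0
      proof (rule has_vector_derivative_Ici_I)
        fix t :: real assume t: "t > 0"
        have "((\<lambda>v. integral {0..v} (h 0)) has_vector_derivative h 0 t) (at t within {0..t+1})"
          by (rule integral_has_vector_derivative) (use t in \<open>auto intro: continuous_on_subset[OF cont]\<close>)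
        hence "((\<lambda>v. c + integral {0..v} (h 0)) has_vector_derivative h 0 t) (at t within {0..t+1})"
          using has_vector_derivative_add[OF has_vector_derivative_const, of "\<lambda>v. integral {0..v} (h 0)" "h 0 t" _ c]
          by simp
        moreover have "at t within {0..t+1} = at t"
          by (rule at_within_interior) (use t in auto)
        ultimately have "((\<lambda>v. c + integral {0..v} (h 0)) has_vector_derivative h 0 t) (at t)" by simp
        thus "(antideriv h 0 has_vector_derivative antideriv h (Suc 0) t) (at t)"
          by (subst antideriv_Suc, rule has_vector_derivative_transform_within_open[of _ _ _ "{0<..}"])
             (use t eq in auto)
      next
        have "continuous_on {0..} (\<lambda>v. c + integral {0..v} (h 0))"
        proof (intro continuous_intros, subst continuous_on_eq_continuous_within, intro ballI)
          fix v :: real assume v: "v \<in> {0..}"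
          have "continuous_on {0..v+1} (\<lambda>v. integral {0..v} (h 0))"
            by (intro indefinite_integral_continuous_1 integrable_continuous_interval continuous_on_subset[OF cont]) auto
          moreover have "at v within {0..v+1} = at v within {0..}"
            by (rule at_within_nhd[of v "{..<v+1}"]) (use v in auto)
          ultimately show "continuous (at v within {0..}) (\<lambda>v. integral {0..v} (h 0))"
            using v by (simp add: continuous_on_eq_continuous_within)
               (metis atLeastAtMost_iff add_increasing2 order_refl zero_le_one)
        qed
        thus "continuous_on {0..} (antideriv h 0)"
          by (rule continuous_on_eq) (use eq in auto)
        show "continuous_on {0..} (antideriv h (Suc 0))" using cont by simp
      qed (use u in auto)
    next
      case (Suc j)
      thus ?thesis using rapid_onD[OF h u] by simp
    qed
  qed
qed

lemma rapid_on_antideriv_funpow: "rapid_on {0..} h \<Longrightarrow> rapid_on {0..} ((antideriv ^^ k) h)"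
  by (induction k) (auto intro: rapid_on_antideriv)

lemma rapid_on_laplace_op_funpow: "rapid_on {0..} h \<Longrightarrow> rapid_on {0..} ((laplace_op ^^ k) h)"
  by (induction k) (auto intro: rapid_on_laplace_op)

text \<open>Each differentiation in \<open>s\<close> is absorbed as one more antiderivative inside,
  so all derivatives of the transform are again cosine transforms of rapidly decreasing
  sequences.\<close>

lemma deriv_seq_on_fcos:
  assumes h: "rapid_on {0..} h"
  shows "deriv_seq_on {0..} (\<lambda>k s. of_real (pi\<^sup>2) ^ k * fcos ((antideriv ^^ k) h) s)"
  unfolding deriv_seq_on_def
proof (intro allI ballI)
  fix k and s :: real assume s: "s \<in> {0..}"
  have "(fcos (\<lambda>m. (antideriv ^^ Suc k) h (Suc m)) has_vector_derivative
      of_real (pi\<^sup>2) * fcos ((antideriv ^^ Suc k) h) s) (at s within {0..})"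
    by (rule has_vector_derivative_fcos[OF rapid_on_antideriv_funpow[OF h]]) (use s in auto)
  hence "(fcos ((antideriv ^^ k) h) has_vector_derivative
      of_real (pi\<^sup>2) * fcos ((antideriv ^^ Suc k) h) s) (at s within {0..})"
    by simp
  from has_vector_derivative_mult_right[OF this, of "of_real (pi\<^sup>2) ^ k"]
  show "((\<lambda>s. of_real (pi\<^sup>2) ^ k * fcos ((antideriv ^^ k) h) s) has_vector_derivative
      of_real (pi\<^sup>2) ^ Suc k * fcos ((antideriv ^^ Suc k) h) s) (at s within {0..})"
    by (simp only: power_Suc2 mult.assoc)
qed

lemma seq_bound_antideriv_funpow:
  assumes h: "rapid_on {0..} h" and B: "seq_bound M (N + 2 * k) B h"
  shows "seq_bound M N (B * pi ^ k) ((antideriv ^^ k) h)"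
  using B
proof (induction k arbitrary: N)
  case (Suc k)
  have "seq_bound M (N + 2) (B * pi ^ k) ((antideriv ^^ k) h)"
    by (rule Suc.IH) (use Suc.prems in simp)
  from seq_bound_antideriv[OF rapid_on_antideriv_funpow[OF h] this] show ?case
    by (auto simp: mult_ac intro: seq_bound_mono)
qed simp

lemma seq_bound_laplace_op_funpow:
  "\<exists>C. \<forall>h B. rapid_on {0..} h \<longrightarrow> seq_bound (2 * k) (Suc k) B h \<longrightarrow>
    seq_bound 0 1 (C * B) ((laplace_op ^^ k) h)"
proof -
  \<comment> \<open>Generalised over \<open>M\<close> and \<open>N\<close>: the outermost
    \<open>laplace_op\<close> uses up two derivatives and one power of the weight, so the induction
    hypothesis is needed at \<open>M + 2\<close> and \<open>Suc N\<close>.\<close>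
  have "\<exists>C. \<forall>h B. rapid_on {0..} h \<longrightarrow> seq_bound (M + 2 * k) (N + k) B h \<longrightarrow>
    seq_bound M N (C * B) ((laplace_op ^^ k) h)" for M N
  proof (induction k arbitrary: M N)
    case 0
    show ?case by (intro exI[of _ 1]) auto
  next
    case (Suc k)
    obtain C where C: "\<And>h B. rapid_on {0..} h \<Longrightarrow> seq_bound (M + 2 + 2 * k) (Suc N + k) B h \<Longrightarrow>
        seq_bound (M + 2) (Suc N) (C * B) ((laplace_op ^^ k) h)"
      using Suc.IH[of "M + 2" "Suc N"] by blast
    show ?case
    proof (intro exI[of _ "(7 + 4 * real M) * C"] allI impI)
      fix h B assume h: "rapid_on {0..} h" and B: "seq_bound (M + 2 * Suc k) (N + Suc k) B h"
      have "seq_bound (M + 2) (Suc N) (C * B) ((laplace_op ^^ k) h)"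
        by (rule C[OF h]) (use B in simp)
      from seq_bound_laplace_op[OF this]
      show "seq_bound M N ((7 + 4 * real M) * C * B) ((laplace_op ^^ Suc k) h)"
        by (simp add: mult.assoc)
    qed
  qed
  from this[of 0 1] show ?thesis by simp
qed

lemma fcos_laplace_op_funpow:
  assumes h: "rapid_on {0..} h" and s: "s \<ge> 0"
  shows "fcos ((laplace_op ^^ k) h) s = of_real ((1 + s) ^ k) * fcos h s"
  by (induction k)
     (simp_all add: fcos_laplace_op[OF rapid_on_laplace_op_funpow[OF h] s] mult_ac del: of_real_add)

text \<open>Continuity of the transform in the seminorms, with constants independent of
  \<open>h\<close>. The factor \<open>(1 + s) ^ N\<close> moves inside as
  \<open>laplace_op ^^ N\<close>, after which the integral of the absolute value is estimate
  enough.\<close>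

lemma fcos_abel_deriv_bound:
  "\<exists>C M N'. \<forall>h B s. rapid_on {0..} h \<longrightarrow> seq_bound M N' B h \<longrightarrow> s \<ge> 0 \<longrightarrow>
    (1 + s) ^ N * norm (of_real (pi\<^sup>2) ^ k * fcos ((antideriv ^^ k) (abel h)) s) \<le> C * B"
proof -
  obtain C where C: "\<And>h B. rapid_on {0..} h \<Longrightarrow> seq_bound (2 * N) (Suc N) B h \<Longrightarrow>
    seq_bound 0 1 (C * B) ((laplace_op ^^ N) h)"
    using seq_bound_laplace_op_funpow[of N] by blast
  show ?thesis
  proof (intro exI allI impI)
    fix h B and s :: real
    \<comment> \<open>Budget of weights: \<open>N\<close> for the \<open>laplace_op\<close>s and one
      for the last integral, \<open>2 * k\<close> for the antiderivatives, one for
      \<open>abel\<close>.\<close>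
    assume h: "rapid_on {0..} h" and B: "seq_bound (2 * N) (Suc (Suc N + 2 * k)) B h" and s: "s \<ge> 0"
    let ?J = "(antideriv ^^ k) (abel h)"
    have J: "rapid_on {0..} ?J"
      by (intro rapid_on_antideriv_funpow rapid_on_abel h)
    have "seq_bound (2 * N) (Suc N) (B * pi * pi ^ k) ?J"
      by (intro seq_bound_antideriv_funpow rapid_on_abel seq_bound_abel h B)
    note C[OF J this]
    from fcos_bound[OF rapid_on_laplace_op_funpow[OF J] this, of s]
    have "(1 + s) ^ N * norm (fcos ?J s) \<le> C * (B * pi * pi ^ k) * pi"
      using s by (simp add: fcos_laplace_op_funpow[OF J s] norm_mult norm_power del: of_real_add)
    hence "(pi\<^sup>2) ^ k * ((1 + s) ^ N * norm (fcos ?J s)) \<le> (pi\<^sup>2) ^ k * (C * (B * pi * pi ^ k) * pi)"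
      by (intro mult_left_mono) auto
    thus "(1 + s) ^ N * norm (of_real (pi\<^sup>2) ^ k * fcos ?J s) \<le> ((pi\<^sup>2) ^ k * C * pi * pi ^ k * pi) * B"
      by (simp add: norm_mult norm_power mult_ac)
  qed
qed

section \<open>Gaussians and their density\<close>

definition expseq :: "real \<Rightarrow> nat \<Rightarrow> real \<Rightarrow> complex" where
  "expseq a m u = of_real ((- a) ^ m * exp (- a * u))"

text \<open>With \<open>q = (N + 1) / a\<close> one has
  \<open>1 + u <= (1 + q) * (1 + u / q) <= (1 + q) * exp (u / q)\<close>, and the power
  \<open>N\<close> of this has exponent \<open>a * u * N / (N + 1)\<close>. Taking
  \<open>Suc N\<close> in \<open>q\<close> keeps it positive for \<open>N = 0\<close>.\<close>

lemma power_mult_exp_le: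
  fixes a :: real
  assumes a: "a > 0"
  obtains K where "K > 0" "\<And>u. u \<ge> 0 \<Longrightarrow> (1 + u) ^ N * exp (- a * u) \<le> K"
proof
  define q where "q = Suc N / a"
  have q: "q > 0" using a by (simp add: q_def)
  show "(1 + q) ^ N > 0" using q by simp
  fix u :: real assume u: "u \<ge> 0"
  have "1 + u \<le> (1 + q) * (1 + u / q)"
    using q u by (simp add: field_simps)
  also have "\<dots> \<le> (1 + q) * exp (u / q)"
    using q by (intro mult_left_mono exp_ge_add_one_self) simp
  finally have "(1 + u) ^ N \<le> ((1 + q) * exp (u / q)) ^ N"
    using u by (intro power_mono) auto
  also have "\<dots> = (1 + q) ^ N * exp (N * (u / q))"
    by (subst exp_of_nat_mult) (simp add: power_mult_distrib)
  also have "N * (u / q) = a * u * (N / Suc N)" using a by (simp add: q_def)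
  also have "(1 + q) ^ N * exp \<dots> \<le> (1 + q) ^ N * exp (a * u * 1)"
    using a u q by (intro mult_left_mono iffD2[OF exp_le_cancel_iff]) auto
  finally show "(1 + u) ^ N * exp (- a * u) \<le> (1 + q) ^ N"
    by (simp add: exp_minus field_simps)
qed

lemma deriv_seq_on_expseq: "deriv_seq_on S (expseq a)"
  unfolding deriv_seq_on_def expseq_def[abs_def]
  by (intro allI ballI has_vector_derivative_of_real) (auto intro!: derivative_eq_intros)

lemma rapid_on_expseq:
  assumes "a > 0"
  shows "rapid_on {0..} (expseq a)"
proof (rule rapid_onI[OF deriv_seq_on_expseq])
  fix m N
  obtain K where K: "K > 0" "\<And>u. u \<ge> 0 \<Longrightarrow> (1 + u) ^ N * exp (- a * u) \<le> K"
    using power_mult_exp_le[OF assms] by blast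
  have "seq_bound m N ((1 + a) ^ m * K) (expseq a)"
    unfolding seq_bound_def
  proof (intro allI impI)
    fix j and u :: real assume j: "j \<le> m" and u: "u \<ge> 0"
    have "(1 + u) ^ N * norm (expseq a j u) = a ^ j * ((1 + u) ^ N * exp (- a * u))"
      using assms by (simp add: expseq_def norm_mult norm_power power_abs abs_mult)
    also have "\<dots> \<le> (1 + a) ^ m * K"
      using assms K u j
      by (intro mult_mono order_trans[OF power_mono power_increasing]) auto
    finally show "(1 + u) ^ N * norm (expseq a j u) \<le> (1 + a) ^ m * K" .
  qed
  thus "\<exists>M B. m \<le> M \<and> seq_bound M N B (expseq a)" by blast
qed

lemma integral_exp_minus_square:
  assumes a: "a > 0"
  shows "(LINT y|lborel. exp (- a * y\<^sup>2)) = sqrt (pi / a)"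
proof -
  \<comment> \<open>The variance \<open>1 / (2 * a)\<close> makes the normal density proportional to
    \<open>exp (- a * y^2)\<close>.\<close>
  define \<sigma> where "\<sigma> = 1 / sqrt (2 * a)"
  have \<sigma>: "\<sigma> > 0" "\<sigma>\<^sup>2 = 1 / (2 * a)" using a by (auto simp: \<sigma>_def power_divide)
  have "exp (- a * y\<^sup>2) = sqrt (pi / a) * normal_density 0 \<sigma> y" for y
    using a by (simp add: normal_density_def \<sigma>(2) real_sqrt_divide)
  hence "(LINT y|lborel. exp (- a * y\<^sup>2)) = (LINT y|lborel. sqrt (pi / a) * normal_density 0 \<sigma> y)"
    by simp
  also have "\<dots> = sqrt (pi / a)" using \<sigma>(1) by simp
  finally show ?thesis .
qed

lemma abel_expseq:
  assumes a: "a > 0"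
  shows "abel (expseq a) m v = of_real (sqrt (pi / a)) * expseq a m v"
proof -
  have "abel (expseq a) m v = (LINT y|lborel. of_real ((- a) ^ m * exp (- a * v) * exp (- a * y\<^sup>2)))"
    by (simp add: abel_def expseq_def distrib_left exp_add exp_diff field_simps exp_minus)
  also have "\<dots> = of_real ((- a) ^ m * exp (- a * v) * (LINT y|lborel. exp (- a * y\<^sup>2)))"
    by (simp only: integral_complex_of_real integral_mult_right_zero)
  also have "\<dots> = of_real (sqrt (pi / a)) * expseq a m v"
    by (simp only: integral_exp_minus_square[OF a]) (simp add: expseq_def)
  finally show ?thesis .
qed

text \<open>On exponentials the shift of indices is multiplication by \<open>- a\<close>, so
  \<open>has_vector_derivative_fcos\<close> becomes the differential equation
  \<open>F' = - (pi^2 / a) * F\<close>, whose initial value is the Gaussian integral.\<close>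

lemma fcos_expseq:
  assumes a: "a > 0" and s: "s \<ge> 0"
  shows "fcos (expseq a) s = of_real (sqrt (pi / a) * exp (- (pi\<^sup>2 / a) * s))"
proof -
  let ?F = "fcos (expseq a)"
  have d: "(?F has_vector_derivative - of_real (pi\<^sup>2 / a) * ?F s) (at s within {0..})" if "s \<ge> 0" for s
  proof -
    have "fcos (\<lambda>m. expseq a (Suc m)) s = - of_real a * ?F s" for s
    proof -
      have "(\<lambda>x. expseq a (Suc 0) (x\<^sup>2) * of_real (cos (2 * pi * sqrt s * x))) =
          (\<lambda>x. - of_real a * (expseq a 0 (x\<^sup>2) * of_real (cos (2 * pi * sqrt s * x))))"
        by (simp add: expseq_def mult.assoc)
      thus ?thesis by (simp add: fcos_def)
    qed
    hence "(\<lambda>s. - of_real (1 / a) * fcos (\<lambda>m. expseq a (Suc m)) s) = ?F"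
      using a by (simp add: fun_eq_iff)
    moreover have "((\<lambda>s. - of_real (1 / a) * fcos (\<lambda>m. expseq a (Suc m)) s) has_vector_derivative
        - of_real (1 / a) * (of_real (pi\<^sup>2) * ?F s)) (at s within {0..})"
      by (intro has_vector_derivative_mult_right has_vector_derivative_fcos rapid_on_expseq a that)
    ultimately have "(?F has_vector_derivative - of_real (1 / a) * (of_real (pi\<^sup>2) * ?F s)) (at s within {0..})"
      by (simp only:)
    thus ?thesis by simp
  qed
  let ?E = "\<lambda>s. complex_of_real (exp (pi\<^sup>2 / a * s))"
  have "((\<lambda>s. ?F s * ?E s) has_vector_derivative 0) (at s within {0..})" if "s \<in> {0..}" for s
  proof -
    have "(?E has_vector_derivative of_real (exp (pi\<^sup>2 / a * s) * (pi\<^sup>2 / a))) (at s within {0..})"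
      using a by (intro has_vector_derivative_of_real) (auto intro!: derivative_eq_intros)
    from has_vector_derivative_mult[OF d[of s] this] that show ?thesis
      using a by (simp add: algebra_simps)
  qed
  then obtain c where c: "\<And>s. s \<in> {0..} \<Longrightarrow> ?F s * ?E s = c"
    using has_vector_derivative_zero_constant[of "{0..}" "\<lambda>s. ?F s * ?E s"] by blast
  have "?F 0 = of_real (LINT y|lborel. exp (- a * y\<^sup>2))"
    by (simp add: fcos_def expseq_def)
  hence "?F s * ?E s = of_real (sqrt (pi / a))"
    using c[of 0] c[of s] s integral_exp_minus_square[OF a] by simp
  hence "?F s = of_real (sqrt (pi / a)) / ?E s"
    by (simp add: eq_divide_eq)
  thus ?thesis by (simp add: exp_minus field_simps)
qed

lemma deriv_seq_on_diff_scale: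
  "deriv_seq_on S h \<Longrightarrow> deriv_seq_on S g \<Longrightarrow> deriv_seq_on S (\<lambda>m u. h m u - c * g m u)"
  unfolding deriv_seq_on_def
  by (intro allI ballI has_vector_derivative_diff has_vector_derivative_mult_right) auto

lemma rapid_on_diff_scale:
  assumes h: "rapid_on {0..} h" and g: "rapid_on {0..} g"
  shows "rapid_on {0..} (\<lambda>m u. h m u - c * g m u)"
proof (rule rapid_onI)
  show "deriv_seq_on {0..} (\<lambda>m u. h m u - c * g m u)"
    by (intro deriv_seq_on_diff_scale rapid_on_deriv_seq h g)
  fix m N
  obtain A where A: "seq_bound m N A h" using rapid_on_seq_bound[OF h] .
  obtain B where B: "seq_bound m N B g" using rapid_on_seq_bound[OF g] .
  have "seq_bound m N (A + norm c * B) (\<lambda>m u. h m u - c * g m u)"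
    unfolding seq_bound_def
  proof (intro allI impI)
    fix j and u :: real assume j: "j \<le> m" "u \<ge> 0"
    have "(1 + u) ^ N * norm (h j u - c * g j u) \<le> (1 + u) ^ N * (norm (h j u) + norm c * norm (g j u))"
      using j by (intro mult_left_mono order_trans[OF norm_triangle_ineq4]) (auto simp: norm_mult)
    also have "\<dots> = (1 + u) ^ N * norm (h j u) + norm c * ((1 + u) ^ N * norm (g j u))"
      by (simp add: algebra_simps)
    also have "\<dots> \<le> A + norm c * B"
      by (intro add_mono mult_left_mono seq_boundD[OF A] seq_boundD[OF B] j) auto
    finally show "(1 + u) ^ N * norm (h j u - c * g j u) \<le> A + norm c * B" .
  qed
  thus "\<exists>M B. m \<le> M \<and> seq_bound M N B (\<lambda>m u. h m u - c * g m u)" by blast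
qed

section \<open>The planar transform of a profile and its derivatives\<close>

definition radial_fourier_deriv :: "(nat \<Rightarrow> real \<Rightarrow> complex) \<Rightarrow> nat \<Rightarrow> real \<Rightarrow> complex" where
  "radial_fourier_deriv h k s = of_real (pi\<^sup>2) ^ k * fcos ((antideriv ^^ k) (abel h)) s"

lemma deriv_seq_on_radial_fourier_deriv:
  "rapid_on {0..} h \<Longrightarrow> deriv_seq_on {0..} (radial_fourier_deriv h)"
  unfolding radial_fourier_deriv_def[abs_def] by (intro deriv_seq_on_fcos rapid_on_abel)

text \<open>Linearity is plain for the integrals at index 0; uniqueness of derivative sequences
  carries it to every \<open>k\<close>.\<close>

lemma radial_fourier_deriv_diff_scale:
  assumes h: "rapid_on {0..} h" and g: "rapid_on {0..} g" and s: "s \<ge> 0"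
  shows "radial_fourier_deriv (\<lambda>m u. h m u - c * g m u) k s =
    radial_fourier_deriv h k s - c * radial_fourier_deriv g k s"
proof (rule deriv_seq_on_unique[of "{0..}" _ "\<lambda>k s. radial_fourier_deriv h k s - c * radial_fourier_deriv g k s"])
  show "deriv_seq_on {0..} (radial_fourier_deriv (\<lambda>m u. h m u - c * g m u))"
    by (intro deriv_seq_on_radial_fourier_deriv rapid_on_diff_scale h g)
  show "deriv_seq_on {0..} (\<lambda>k s. radial_fourier_deriv h k s - c * radial_fourier_deriv g k s)"
    by (intro deriv_seq_on_diff_scale deriv_seq_on_radial_fourier_deriv h g)
  fix s :: real assume "s \<in> {0..}"
  have int: "integrable lborel (\<lambda>y. f 0 (v + y\<^sup>2))" if f: "rapid_on {0..} f" and v: "v \<ge> 0" for f v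
  proof -
    obtain B where "seq_bound 0 (Suc 0) B f" using rapid_on_seq_bound[OF f] .
    from abel_bound(1)[OF f this v] show ?thesis .
  qed
  have ab: "abel (\<lambda>m u. h m u - c * g m u) 0 v = abel h 0 v - c * abel g 0 v" if "v \<ge> 0" for v
    unfolding abel_def using int[OF h that] int[OF g that] by simp
  have "fcos (abel (\<lambda>m u. h m u - c * g m u)) s =
      (LINT x|lborel. abel h 0 (x\<^sup>2) * of_real (cos (2 * pi * sqrt s * x)) -
        c * (abel g 0 (x\<^sup>2) * of_real (cos (2 * pi * sqrt s * x))))"
    by (simp add: fcos_def ab algebra_simps)
  also have "\<dots> = fcos (abel h) s - c * fcos (abel g) s"
    unfolding fcos_def
    by (subst Bochner_Integration.integral_diff[OF integrable_fcos[OF rapid_on_abel[OF h]]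
          integrable_mult_right[OF integrable_fcos[OF rapid_on_abel[OF g]]]]) simp
  finally show "radial_fourier_deriv (\<lambda>m u. h m u - c * g m u) 0 s =
      radial_fourier_deriv h 0 s - c * radial_fourier_deriv g 0 s"
    by (simp add: radial_fourier_deriv_def)
qed (use s at_within_Ici_neq_bot in auto)

text \<open>The factor \<open>sqrt (pi / a)\<close> arises twice, from the Abel and from the cosine
  transform, which makes up the planar factor \<open>pi / a\<close>.\<close>

lemma radial_fourier_deriv_expseq:
  assumes a: "a > 0" and s: "s \<ge> 0"
  shows "radial_fourier_deriv (expseq a) k s = of_real (pi / a) * expseq (pi\<^sup>2 / a) k s"
proof (rule deriv_seq_on_unique[of "{0..}" _ "\<lambda>k s. of_real (pi / a) * expseq (pi\<^sup>2 / a) k s"])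
  show "deriv_seq_on {0..} (radial_fourier_deriv (expseq a))"
    by (intro deriv_seq_on_radial_fourier_deriv rapid_on_expseq a)
  show "deriv_seq_on {0..} (\<lambda>k s. of_real (pi / a) * expseq (pi\<^sup>2 / a) k s)"
    using deriv_seq_on_expseq[of "{0..}" "pi\<^sup>2 / a"]
    by (auto simp only: deriv_seq_on_def intro!: has_vector_derivative_mult_right)
  fix s :: real assume s: "s \<in> {0..}"
  have "fcos (abel (expseq a)) s = of_real (sqrt (pi / a)) * fcos (expseq a) s"
    by (simp add: fcos_def abel_expseq[OF a] mult.assoc)
  also have "\<dots> = of_real (sqrt (pi / a) * sqrt (pi / a) * exp (- (pi\<^sup>2 / a) * s))"
    using s by (simp only: fcos_expseq[OF a] of_real_mult mult.assoc atLeast_iff)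
  also have "sqrt (pi / a) * sqrt (pi / a) = pi / a" using a by simp
  also have "of_real (pi / a * exp (- (pi\<^sup>2 / a) * s)) = of_real (pi / a) * expseq (pi\<^sup>2 / a) 0 s"
    by (simp add: expseq_def)
  finally show "radial_fourier_deriv (expseq a) 0 s = of_real (pi / a) * expseq (pi\<^sup>2 / a) 0 s"
    by (simp add: radial_fourier_deriv_def)
qed (use s at_within_Ici_neq_bot in auto)

section \<open>Density of exponential sums in the weighted seminorms\<close>

lemma rapid_on_eq_antideriv:
  assumes g: "rapid_on {0..} g" and v: "v \<ge> 0"
  shows "antideriv (\<lambda>m. g (Suc m)) 0 v = g 0 v"
proof -
  let ?A = "antideriv (\<lambda>m. g (Suc m))"
  have A: "rapid_on {0..} ?A" by (intro rapid_on_antideriv rapid_on_Suc g)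
  have D: "rapid_on {0..} (\<lambda>m u. ?A m u - 1 * g m u)" by (intro rapid_on_diff_scale A g)
  obtain c where c: "\<And>u. u \<in> {0..} \<Longrightarrow> ?A 0 u - 1 * g 0 u = c"
    using has_vector_derivative_zero_constant[of "{0..}" "\<lambda>u. ?A 0 u - 1 * g 0 u"] rapid_onD[OF D, of _ 0]
    by auto
  obtain B where B: "seq_bound 0 1 B (\<lambda>m u. ?A m u - 1 * g m u)" using rapid_on_seq_bound[OF D] .
  have "norm c = 0"
  proof (rule ccontr)
    assume nz: "norm c \<noteq> 0"
    have "(1 + u) * norm c \<le> B" if "u \<ge> 0" for u
      using seq_boundD[OF B, of 0 u] c[of u] that by simp
    from this[of "\<bar>B\<bar> / norm c"] have "norm c + \<bar>B\<bar> \<le> B"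
      using nz by (simp add: field_simps)
    thus False using nz norm_ge_zero[of c] by linarith
  qed
  thus ?thesis using c[of v] v by simp
qed

text \<open>Every entry is recovered from the next one by integration from infinity, at the cost of
  two powers of the weight and a factor \<open>pi\<close>. Hence it is enough to approximate a
  single function, the \<open>M\<close>-th derivative.\<close>

lemma seq_bound_from_top_derivative:
  assumes "rapid_on {0..} g" and "seq_bound 0 (N + 2 * M) B (\<lambda>m. g (m + M))"
  shows "seq_bound M N (B * pi ^ M) g"
  using assms
proof (induction M arbitrary: g N)
  case (Suc M)
  have "seq_bound M (N + 2) (B * pi ^ M) (\<lambda>m. g (Suc m))"
    by (rule Suc.IH[OF rapid_on_Suc[OF Suc.prems(1)]]) (use Suc.prems(2) in simp)
  from seq_bound_antideriv[OF rapid_on_Suc[OF Suc.prems(1)] this]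
  have *: "seq_bound (Suc M) N (B * pi ^ M * pi) (antideriv (\<lambda>m. g (Suc m)))" .
  have "antideriv (\<lambda>m. g (Suc m)) m u = g m u" if "u \<ge> 0" for m u
    using rapid_on_eq_antideriv[OF Suc.prems(1) that] by (cases m) auto
  thus ?case using * by (simp add: seq_bound_def mult_ac)
qed simp

lemma complex_Weierstrass:
  fixes f :: "real \<Rightarrow> complex"
  assumes f: "continuous_on {0..1} f" and e: "e > 0"
  shows "\<exists>n c. \<forall>w\<in>{0..1}. norm (f w - (\<Sum>i<n. c i * of_real (w ^ i))) < e"
proof -
  obtain g where g: "polynomial_function g" "\<And>w. w \<in> {0..1} \<Longrightarrow> norm (f w - g w) < e"
    using Stone_Weierstrass_polynomial_function[OF _ f e] by auto
  have "real_polynomial_function (\<lambda>x. Re (g x))" "real_polynomial_function (\<lambda>x. Im (g x))"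
    using g(1) unfolding polynomial_function_def o_def by (auto intro: bounded_linear_Re bounded_linear_Im)
  then obtain a n b m where a: "(\<lambda>x. Re (g x)) = (\<lambda>x. \<Sum>i\<le>n::nat. a i * x ^ i)"
    and b: "(\<lambda>x. Im (g x)) = (\<lambda>x. \<Sum>i\<le>m::nat. b i * x ^ i)"
    unfolding real_polynomial_function_iff_sum by blast
  \<comment> \<open>Padding with zeros brings real and imaginary part to a common length.\<close>
  define c where "c i = of_real (if i \<le> n then a i else 0) + \<i> * of_real (if i \<le> m then b i else 0)" for i
  have "g w = (\<Sum>i<Suc (n + m). c i * of_real (w ^ i))" for w
  proof -
    have 1: "(\<Sum>i<Suc (n + m). (if i \<le> n then a i else 0) * w ^ i) = (\<Sum>i\<le>n. a i * w ^ i)"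
      by (rule sum.mono_neutral_cong_right) auto
    have 2: "(\<Sum>i<Suc (n + m). (if i \<le> m then b i else 0) * w ^ i) = (\<Sum>i\<le>m. b i * w ^ i)"
      by (rule sum.mono_neutral_cong_right) auto
    have "(\<Sum>i<Suc (n + m). c i * of_real (w ^ i)) =
        of_real (\<Sum>i<Suc (n + m). (if i \<le> n then a i else 0) * w ^ i) +
        \<i> * of_real (\<Sum>i<Suc (n + m). (if i \<le> m then b i else 0) * w ^ i)"
      unfolding c_def of_real_sum sum_distrib_left sum.distrib[symmetric]
      by (rule sum.cong) (auto simp: algebra_simps)
    also have "\<dots> = of_real (Re (g w)) + \<i> * of_real (Im (g w))"
      unfolding 1 2 using fun_cong[OF a, of w] fun_cong[OF b, of w] by simp
    also have "\<dots> = g w" by (simp add: complex_eq_iff)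
    finally show ?thesis ..
  qed
  thus ?thesis using g(2) by metis
qed

text \<open>Uniform approximation in \<open>w = exp (- \<delta> * u)\<close> alone does not control
  the unbounded weight. So \<open>exp (- 2 * \<delta> * u) * f u\<close> is approximated instead:
  one factor \<open>w\<close> makes the function of \<open>w\<close> continuous at 0, the other
  multiplies the error and compensates \<open>(1 + u) ^ N\<close>. The damping itself costs at most
  \<open>2 * \<delta> * u * |f u|\<close>, which the spare power of the weight in the hypothesis
  absorbs for small \<open>\<delta>\<close>.\<close>

lemma exp_dense_weighted:
  fixes f :: "real \<Rightarrow> complex"
  assumes cont: "continuous_on {0..} f" and B: "\<And>u. u \<ge> 0 \<Longrightarrow> (1 + u) ^ Suc N * norm (f u) \<le> B"
    and \<eta>: "\<eta> > 0"
  shows "\<exists>n c. \<exists>\<delta>::real>0. \<forall>u\<ge>0.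
    (1 + u) ^ N * norm (f u - (\<Sum>i<n. c i * of_real (exp (- (Suc i * \<delta>) * u)))) \<le> \<eta>"
proof -
  have B0: "B \<ge> 0" by (rule order_trans[OF norm_ge_zero[of "f 0"]]) (use B[of 0] in simp)
  \<comment> \<open>Chosen so that the cost \<open>2 * \<delta> * B\<close> of the damping is at
    most half of \<open>\<eta>\<close>.\<close>
  define \<delta> where "\<delta> = \<eta> / (4 * (B + 1))"
  have \<delta>: "\<delta> > 0" "2 * \<delta> * B \<le> \<eta> / 2"
    using \<eta> B0 by (simp_all add: \<delta>_def field_simps)
  obtain K where K: "K > 0" "\<And>u. u \<ge> 0 \<Longrightarrow> (1 + u) ^ N * exp (- \<delta> * u) \<le> K"
    using power_mult_exp_le[OF \<delta>(1)] by blast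
  \<comment> \<open>Here \<open>- ln w / \<delta>\<close> is \<open>u\<close>. At
    \<open>w = 0\<close> the first factor gives the value 0, whatever \<open>ln 0\<close>
    is.\<close>
  define \<psi> where "\<psi> w = of_real w * f (- ln w / \<delta>)" for w
  have fb: "norm (f u) \<le> B" if "u \<ge> 0" for u
  proof -
    have "1 * norm (f u) \<le> (1 + u) ^ Suc N * norm (f u)"
      using that by (intro mult_right_mono one_le_power) auto
    with B[OF that] show ?thesis by simp
  qed
  have "continuous_on {0..1} \<psi>"
    unfolding continuous_on_eq_continuous_within
  proof
    fix w :: real assume w: "w \<in> {0..1}"
    show "continuous (at w within {0..1}) \<psi>"
    proof (cases "w = 0")
      case True
      have "((\<lambda>w. B * \<bar>w\<bar>) \<longlongrightarrow> B * \<bar>0\<bar>) (at (0::real) within {0..1})"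
        by (intro tendsto_intros)
      hence lim: "((\<lambda>w. B * \<bar>w\<bar>) \<longlongrightarrow> 0) (at (0::real) within {0..1})" by simp
      have "eventually (\<lambda>w. norm (\<psi> w) \<le> B * \<bar>w\<bar>) (at 0 within {0..1})"
        unfolding eventually_at_filter
      proof (intro always_eventually allI impI)
        fix w :: real assume w: "w \<noteq> 0" "w \<in> {0..1}"
        hence "norm (f (- ln w / \<delta>)) \<le> B" using \<delta>(1)
          by (intro fb divide_nonneg_pos) auto
        hence "\<bar>w\<bar> * norm (f (- ln w / \<delta>)) \<le> \<bar>w\<bar> * B" by (intro mult_left_mono) auto
        thus "norm (\<psi> w) \<le> B * \<bar>w\<bar>" by (simp add: \<psi>_def norm_mult mult_ac)
      qed
      hence "(\<psi> \<longlongrightarrow> 0) (at 0 within {0..1})"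
        by (rule Lim_null_comparison[OF _ lim])
      thus ?thesis by (simp add: True continuous_within \<psi>_def)
    next
      case False
      have "continuous_on {0<..1} (\<lambda>w. of_real w * f (- ln w / \<delta>))"
        by (intro continuous_intros continuous_on_compose2[OF cont])
           (use \<delta>(1) in \<open>auto intro!: divide_nonpos_pos\<close>)
      hence "continuous (at w within {0<..1}) \<psi>"
        using w False by (auto simp: continuous_on_eq_continuous_within \<psi>_def[abs_def])
      moreover have "at w within {0<..1} = at w within {0..1}"
        by (rule at_within_nhd[of w "{0<..}"]) (use w False in auto)
      ultimately show ?thesis by simp
    qed
  qed
  moreover have "\<eta> / (2 * K) > 0" using \<eta> K(1) by simp
  ultimately obtain n c where p: "\<And>w. w \<in> {0..1} \<Longrightarrow> norm (\<psi> w - (\<Sum>i<n. c i * of_real (w ^ i))) < \<eta> / (2 * K)"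
    using complex_Weierstrass by blast
  show ?thesis
  proof (intro exI[of _ n] exI[of _ c] exI[of _ \<delta>] conjI allI impI \<delta>(1))
    fix u :: real assume u: "u \<ge> 0"
    let ?w = "exp (- \<delta> * u)" and ?W = "(1 + u) ^ N"
    let ?S = "\<Sum>i<n. c i * of_real (exp (- (Suc i * \<delta>) * u))"
    have W0: "?W \<ge> 0" using u by simp
    \<comment> \<open>The second factor \<open>w\<close> raises the exponents from \<open>i\<close>
      to \<open>Suc i\<close>, so every exponential in the sum decays.\<close>
    have S: "?S = of_real ?w * (\<Sum>i<n. c i * of_real (?w ^ i))"
      unfolding sum_distrib_left
      by (intro sum.cong refl) (simp add: exp_of_nat_mult[symmetric] exp_add[symmetric] algebra_simps
          flip: of_real_mult)
    have \<psi>w: "\<psi> ?w = of_real ?w * f u" using \<delta>(1) by (simp add: \<psi>_def)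
    have "norm (of_real (?w * ?w) * f u - ?S) = ?w * norm (\<psi> ?w - (\<Sum>i<n. c i * of_real (?w ^ i)))"
      unfolding S \<psi>w by (simp add: norm_mult right_diff_distrib[symmetric] mult.assoc)
    also have "\<dots> \<le> ?w * (\<eta> / (2 * K))"
      by (intro mult_left_mono less_imp_le[OF p]) (use u \<delta>(1) in auto)
    finally have "?W * norm (of_real (?w * ?w) * f u - ?S) \<le> (?W * ?w) * (\<eta> / (2 * K))"
      using mult_left_mono[OF _ W0] by (simp only: mult.assoc)
    also have "\<dots> \<le> K * (\<eta> / (2 * K))"
      using \<eta> K u by (intro mult_right_mono) auto
    also have "\<dots> = \<eta> / 2" using K by simp
    finally have 1: "?W * norm (of_real (?w * ?w) * f u - ?S) \<le> \<eta> / 2" .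
    have ww: "?w * ?w = exp (- (2 * \<delta>) * u)" by (simp flip: exp_add)
    have "1 - ?w * ?w \<le> 2 * \<delta> * u"
      unfolding ww using exp_ge_add_one_self[of "- (2 * \<delta>) * u"] by simp
    moreover have "?w * ?w \<le> 1" unfolding ww using u \<delta>(1) by simp
    ultimately have "norm (f u - of_real (?w * ?w) * f u) \<le> 2 * \<delta> * u * norm (f u)"
    proof -
      have "f u - of_real (?w * ?w) * f u = of_real (1 - ?w * ?w) * f u" by (simp add: algebra_simps)
      hence "norm (f u - of_real (?w * ?w) * f u) = (1 - ?w * ?w) * norm (f u)"
        using \<open>?w * ?w \<le> 1\<close> by (simp only: norm_mult norm_of_real)
      also have "\<dots> \<le> 2 * \<delta> * u * norm (f u)"
        by (intro mult_right_mono) (use \<open>1 - ?w * ?w \<le> 2 * \<delta> * u\<close> in auto)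
      finally show ?thesis .
    qed
    hence "?W * norm (f u - of_real (?w * ?w) * f u) \<le> ?W * (2 * \<delta> * u * norm (f u))"
      using W0 by (intro mult_left_mono)
    also have "\<dots> \<le> ?W * (2 * \<delta> * (1 + u) * norm (f u))"
      using W0 \<delta>(1) u by (intro mult_left_mono mult_right_mono) auto
    also have "\<dots> = 2 * \<delta> * ((1 + u) ^ Suc N * norm (f u))" by simp
    also have "\<dots> \<le> 2 * \<delta> * B" using \<delta>(1) B[OF u] by (intro mult_left_mono) auto
    finally have 2: "?W * norm (f u - of_real (?w * ?w) * f u) \<le> \<eta> / 2" using \<delta>(2) by simp
    have "norm (f u - ?S) \<le> norm (f u - of_real (?w * ?w) * f u) + norm (of_real (?w * ?w) * f u - ?S)"
      using norm_triangle_ineq[of "f u - of_real (?w * ?w) * f u" "of_real (?w * ?w) * f u - ?S"] by simp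
    from mult_left_mono[OF this W0] 1 2 show "?W * norm (f u - ?S) \<le> \<eta>"
      by (simp only: distrib_left)
  qed
qed


definition exp_sum :: "nat \<Rightarrow> (nat \<Rightarrow> complex) \<Rightarrow> (nat \<Rightarrow> real) \<Rightarrow> nat \<Rightarrow> real \<Rightarrow> complex" where
  "exp_sum n c a m u = (\<Sum>i<n. c i * expseq (a i) m u)"

lemma exp_sum_0: "exp_sum 0 c a = (\<lambda>m u. 0)"
  by (simp add: exp_sum_def fun_eq_iff)

lemma exp_sum_Suc: "exp_sum (Suc n) c a = (\<lambda>m u. exp_sum n c a m u - (- c n) * expseq (a n) m u)"
  by (simp add: exp_sum_def fun_eq_iff)

lemma rapid_on_zero: "rapid_on S (\<lambda>m u. 0)"
  by (auto simp: rapid_on_def deriv_seq_on_def)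

lemma rapid_on_exp_sum: "(\<And>i. i < n \<Longrightarrow> a i > 0) \<Longrightarrow> rapid_on {0..} (exp_sum n c a)"
proof (induction n)
  case 0
  show ?case unfolding exp_sum_0 by (rule rapid_on_zero)
next
  case (Suc n)
  show ?case unfolding exp_sum_Suc
    by (intro rapid_on_diff_scale rapid_on_expseq Suc.IH) (use Suc.prems in auto)
qed

lemma exp_sum_dense:
  assumes h: "rapid_on {0..} h" and \<eta>: "\<eta> > 0"
  shows "\<exists>n c a. (\<forall>i. a i > 0) \<and> seq_bound M N \<eta> (\<lambda>m u. h m u - 1 * exp_sum n c a m u)"
proof -
  \<comment> \<open>\<open>pi ^ M\<close> is the price of \<open>M\<close> integrations from
    infinity.\<close>
  have \<eta>': "\<eta> / pi ^ M > 0" using \<eta> by simp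
  obtain B where "seq_bound M (Suc (N + 2 * M)) B h" using rapid_on_seq_bound[OF h] .
  hence B: "(1 + u) ^ Suc (N + 2 * M) * norm (h M u) \<le> B" if "u \<ge> 0" for u
    by (rule seq_boundD[OF _ order_refl that])
  obtain n c and \<delta> :: real where \<delta>: "\<delta> > 0" and le: "\<forall>u\<ge>0.
      (1 + u) ^ (N + 2 * M) * norm (h M u - (\<Sum>i<n. c i * of_real (exp (- (Suc i * \<delta>) * u)))) \<le> \<eta> / pi ^ M"
    using exp_dense_weighted[OF deriv_seq_on_continuous[OF rapid_on_deriv_seq[OF h]] B \<eta>']
    by blast
  define a where "a i = Suc i * \<delta>" for i
  \<comment> \<open>Dividing by \<open>(- a i) ^ M\<close> undoes the factor from \<open>M\<close>
    differentiations, so that the \<open>M\<close>-th derivative of the new sum is the approximant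
    just found.\<close>
  define c' where "c' i = c i / of_real ((- a i) ^ M)" for i
  have a: "a i > 0" for i using \<delta> by (simp add: a_def)
  have top: "exp_sum n c' a M u = (\<Sum>i<n. c i * of_real (exp (- (Suc i * \<delta>) * u)))" for u
    unfolding exp_sum_def c'_def expseq_def
  proof (intro sum.cong refl)
    fix i
    have nz: "complex_of_real ((- a i) ^ M) \<noteq> 0" using a[of i] by simp
    have cancel: "z / w * (w * e) = z * e" if "w \<noteq> 0" for z w e :: complex
      using that by simp
    show "c i / of_real ((- a i) ^ M) * of_real ((- a i) ^ M * exp (- a i * u)) = c i * of_real (exp (- (Suc i * \<delta>) * u))"
      unfolding of_real_mult cancel[OF nz] by (simp only: a_def)
  qed
  have R: "rapid_on {0..} (\<lambda>m u. h m u - 1 * exp_sum n c' a m u)"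
    by (intro rapid_on_diff_scale h rapid_on_exp_sum a)
  have "seq_bound 0 (N + 2 * M) (\<eta> / pi ^ M) (\<lambda>m u. h (m + M) u - 1 * exp_sum n c' a (m + M) u)"
    using le by (simp add: seq_bound_def top)
  from seq_bound_from_top_derivative[OF R this] have "seq_bound M N \<eta> (\<lambda>m u. h m u - 1 * exp_sum n c' a m u)"
    by simp
  with a show ?thesis by blast
qed

section \<open>Profiles of radial Schwartz functions\<close>

lemma has_vector_derivative_partial_deriv:
  fixes F :: "real ^ 'n::finite \<Rightarrow> complex"
  assumes "F differentiable (at (s *\<^sub>R axis i 1))"
  shows "((\<lambda>s. F (s *\<^sub>R axis i 1)) has_vector_derivative partial_deriv i F (s *\<^sub>R axis i 1)) (at s)"
proof -
  let ?G = "\<lambda>t. F (s *\<^sub>R axis i 1 + t *\<^sub>R axis i 1)"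
  have "F \<circ> (\<lambda>t. s *\<^sub>R axis i 1 + t *\<^sub>R axis i 1) differentiable (at 0)"
    by (rule differentiable_chain_at) (use assms in \<open>auto intro!: derivative_intros\<close>)
  hence "(?G has_vector_derivative partial_deriv i F (s *\<^sub>R axis i 1)) (at 0)"
    unfolding partial_deriv_def o_def by (simp add: vector_derivative_works)
  hence "(?G has_vector_derivative partial_deriv i F (s *\<^sub>R axis i 1)) (at ((\<lambda>r. r - s) s))" by simp
  moreover have "((\<lambda>r. r - s) has_vector_derivative 1) (at s)"
    by (auto intro!: derivative_eq_intros simp flip: has_real_derivative_iff_has_vector_derivative)
  ultimately have "(?G \<circ> (\<lambda>r. r - s) has_vector_derivative 1 *\<^sub>R partial_deriv i F (s *\<^sub>R axis i 1)) (at s)"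
    by (intro vector_diff_chain_at)
  thus ?thesis by (simp add: o_def scaleR_add_left[symmetric])
qed

lemma one_plus_power_le:
  fixes x :: real
  assumes "x \<ge> 0"
  shows "(1 + x) ^ N \<le> 2 ^ N * (1 + x ^ N)"
proof (cases "x \<le> 1")
  case True
  hence "(1 + x) ^ N \<le> 2 ^ N" using assms by (intro power_mono) auto
  also have "\<dots> \<le> 2 ^ N * (1 + x ^ N)" using assms by simp
  finally show ?thesis .
next
  case False
  hence "(1 + x) ^ N \<le> (2 * x) ^ N" by (intro power_mono) auto
  also have "\<dots> \<le> 2 ^ N * (1 + x ^ N)" using assms by (simp add: power_mult_distrib)
  finally show ?thesis .
qed

lemma rapid_on_axis:
  fixes f :: "real ^ 2 \<Rightarrow> complex"
  assumes f: "schwartz f"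
  shows "rapid_on UNIV (\<lambda>n s. iter_partial_deriv (replicate n 1) f (s *\<^sub>R axis 1 1))"
  unfolding rapid_on_def deriv_seq_on_def
proof (intro conjI allI ballI)
  fix n and s :: real
  have "iter_partial_deriv (replicate n 1) f differentiable (at (s *\<^sub>R axis 1 1))"
    using f by (simp add: schwartz_def)
  from has_vector_derivative_partial_deriv[OF this]
  show "((\<lambda>s. iter_partial_deriv (replicate n 1) f (s *\<^sub>R axis 1 1)) has_vector_derivative
      iter_partial_deriv (replicate (Suc n) 1) f (s *\<^sub>R axis 1 1)) (at s within UNIV)"
    by (simp add: iter_partial_deriv_def)
next
  fix n N :: nat
  let ?g = "iter_partial_deriv (replicate n 1) f"
  have bd: "\<exists>B. \<forall>s. \<bar>s\<bar> ^ k * norm (?g (s *\<^sub>R axis 1 1)) \<le> B" for k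
  proof -
    \<comment> \<open>With the whole exponent on the first coordinate the monomial restricts to
      \<open>s ^ k\<close> on the axis.\<close>
    let ?\<alpha> = "\<lambda>i::2. if i = 1 then k else 0"
    have "bounded (range (\<lambda>x. (\<Prod>i\<in>UNIV. x $ i ^ ?\<alpha> i) *\<^sub>R ?g x))"
      by (rule f[unfolded schwartz_def, THEN conjunct2, THEN spec, of ?\<alpha>, THEN spec, of "replicate n 1"])
    then obtain B where B: "\<And>x. norm ((\<Prod>i\<in>UNIV. x $ i ^ ?\<alpha> i) *\<^sub>R ?g x) \<le> B"
      unfolding bounded_iff by blast
    have "\<bar>s\<bar> ^ k * norm (?g (s *\<^sub>R axis 1 1)) \<le> B" for s
      using B[of "s *\<^sub>R axis 1 1"] by (simp add: prod_2 UNIV_2 axis_def abs_mult power_abs)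
    thus ?thesis by blast
  qed
  obtain B0 where B0: "\<And>s. \<bar>s\<bar> ^ 0 * norm (?g (s *\<^sub>R axis 1 1)) \<le> B0" using bd by blast
  obtain B1 where B1: "\<And>s. \<bar>s\<bar> ^ N * norm (?g (s *\<^sub>R axis 1 1)) \<le> B1" using bd by blast
  have "(1 + \<bar>s\<bar>) ^ N * norm (?g (s *\<^sub>R axis 1 1)) \<le> 2 ^ N * (B0 + B1)" for s
  proof -
    have "(1 + \<bar>s\<bar>) ^ N * norm (?g (s *\<^sub>R axis 1 1)) \<le> 2 ^ N * (1 + \<bar>s\<bar> ^ N) * norm (?g (s *\<^sub>R axis 1 1))"
      by (intro mult_right_mono one_plus_power_le) auto
    also have "\<dots> = 2 ^ N * (\<bar>s\<bar> ^ 0 * norm (?g (s *\<^sub>R axis 1 1)) + \<bar>s\<bar> ^ N * norm (?g (s *\<^sub>R axis 1 1)))"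
      by (simp add: algebra_simps)
    also have "\<dots> \<le> 2 ^ N * (B0 + B1)"
      by (intro mult_left_mono add_mono B0 B1) auto
    finally show ?thesis .
  qed
  thus "\<exists>B. \<forall>u\<in>UNIV. (1 + \<bar>u\<bar>) ^ N * norm (?g (u *\<^sub>R axis 1 1)) \<le> B" by blast
qed

text \<open>
  If \<open>\<psi> 0\<close> is even, then \<open>hadamard \<psi> 0\<close> is the smooth extension of \<open>\<psi>' x / (2 x)\<close>, the derivative of \<open>\<psi>\<close>
  with respect to \<open>x\<^sup>2\<close>.
\<close>
definition hadamard :: "(nat \<Rightarrow> real \<Rightarrow> complex) \<Rightarrow> nat \<Rightarrow> real \<Rightarrow> complex" where
  "hadamard \<psi> n x = integral {0..1} (\<lambda>v. (v ^ n / 2) *\<^sub>R \<psi> (n + 2) (x * v))"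

lemma continuous_on_UNIV_rapid:
  assumes "rapid_on UNIV \<psi>" "continuous_on A g"
  shows "continuous_on A (\<lambda>x. \<psi> n (g x))"
  by (rule continuous_on_compose2[OF deriv_seq_on_continuous[OF rapid_on_deriv_seq[OF assms(1)]] assms(2)]) auto

lemma deriv_seq_on_hadamard:
  assumes \<psi>: "rapid_on UNIV \<psi>"
  shows "deriv_seq_on UNIV (hadamard \<psi>)"
  unfolding deriv_seq_on_def
proof (intro allI ballI)
  fix n and x :: real
  have "((\<lambda>x. integral (cbox 0 1) (\<lambda>v. (v ^ n / 2) *\<^sub>R \<psi> (n + 2) (x * v))) has_vector_derivative
      integral (cbox 0 1) (\<lambda>v. (v ^ Suc n / 2) *\<^sub>R \<psi> (Suc n + 2) (x * v))) (at x within UNIV)"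
  proof (rule leibniz_rule_vector_derivative)
    fix x v :: real
    have "((\<lambda>x. x * v) has_vector_derivative v) (at x)"
      by (auto intro!: derivative_eq_intros simp flip: has_real_derivative_iff_has_vector_derivative)
    moreover have "(\<psi> (n + 2) has_vector_derivative \<psi> (Suc n + 2) (x * v)) (at (x * v))"
      using rapid_onD[OF \<psi>, of "x * v" "n + 2"] by simp
    ultimately have "(\<psi> (n + 2) \<circ> (\<lambda>x. x * v) has_vector_derivative v *\<^sub>R \<psi> (Suc n + 2) (x * v)) (at x)"
      by (intro vector_diff_chain_at)
    hence "((\<lambda>x. (v ^ n / 2) *\<^sub>R \<psi> (n + 2) (x * v)) has_vector_derivative
        (v ^ n / 2) *\<^sub>R (v *\<^sub>R \<psi> (Suc n + 2) (x * v))) (at x)"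
      unfolding o_def
      by (rule bounded_linear.has_vector_derivative[OF bounded_linear_scaleR_right])
    thus "((\<lambda>x. (v ^ n / 2) *\<^sub>R \<psi> (n + 2) (x * v)) has_vector_derivative
        (v ^ Suc n / 2) *\<^sub>R \<psi> (Suc n + 2) (x * v)) (at x within UNIV)"
      by (simp add: mult.commute)
  next
    show "(\<lambda>v. (v ^ n / 2) *\<^sub>R \<psi> (n + 2) (x * v)) integrable_on cbox 0 1" for x
      by (intro integrable_continuous continuous_intros continuous_on_UNIV_rapid[OF \<psi>]) auto
    show "continuous_on (UNIV \<times> cbox 0 1) (\<lambda>(x, v). (v ^ Suc n / 2) *\<^sub>R \<psi> (Suc n + 2) (x * v))"
      unfolding split_beta by (intro continuous_intros continuous_on_UNIV_rapid[OF \<psi>]) auto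
  qed auto
  thus "(hadamard \<psi> n has_vector_derivative hadamard \<psi> (Suc n) x) (at x within UNIV)"
    by (simp add: hadamard_def[abs_def])
qed

text \<open>Fundamental theorem of calculus for \<open>\<psi> 1 (x * v)\<close> as a function of
  \<open>v\<close> on the unit interval; the vanishing at 0 removes the constant.\<close>

lemma hadamard_0:
  assumes \<psi>: "rapid_on UNIV \<psi>" and 0: "\<psi> 1 0 = 0"
  shows "\<psi> 1 x = of_real (2 * x) * hadamard \<psi> 0 x"
proof -
  have "((\<lambda>v. x *\<^sub>R \<psi> 2 (x * v)) has_integral (\<psi> 1 (x * 1) - \<psi> 1 (x * 0))) {0..1}"
  proof (rule fundamental_theorem_of_calculus)
    fix v :: real
    have "((\<lambda>v. x * v) has_vector_derivative x) (at v)"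
      by (auto intro!: derivative_eq_intros simp flip: has_real_derivative_iff_has_vector_derivative)
    moreover have "(\<psi> 1 has_vector_derivative \<psi> 2 (x * v)) (at (x * v))"
      using rapid_onD[OF \<psi>, of "x * v" 1] by (simp add: numeral_2_eq_2)
    ultimately have "(\<psi> 1 \<circ> (\<lambda>v. x * v) has_vector_derivative x *\<^sub>R \<psi> 2 (x * v)) (at v)"
      by (intro vector_diff_chain_at)
    thus "((\<lambda>v. \<psi> 1 (x * v)) has_vector_derivative x *\<^sub>R \<psi> 2 (x * v)) (at v within {0..1})"
      by (simp add: o_def has_vector_derivative_at_within)
  qed auto
  hence "\<psi> 1 x = x *\<^sub>R integral {0..1} (\<lambda>v. \<psi> 2 (x * v))"
    using 0 by (simp add: has_integral_iff)
  also have "\<dots> = of_real (2 * x) * hadamard \<psi> 0 x"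
    by (simp add: hadamard_def scaleR_conv_of_real numeral_2_eq_2)
  finally show ?thesis .
qed

text \<open>Leibniz rule for the \<open>n\<close>-th derivative of
  \<open>2 * x * hadamard \<psi> 0 x\<close>. For \<open>n = 0\<close> the truncated index
  \<open>n - 1\<close> is harmless, as its coefficient is 0.\<close>

lemma hadamard_rec:
  assumes \<psi>: "rapid_on UNIV \<psi>" and 0: "\<psi> 1 0 = 0"
  shows "\<psi> (Suc n) x = of_real (2 * x) * hadamard \<psi> n x + of_real (2 * real n) * hadamard \<psi> (n - 1) x"
proof (rule deriv_seq_on_unique[of UNIV "\<lambda>n. \<psi> (Suc n)"
      "\<lambda>n x. of_real (2 * x) * hadamard \<psi> n x + of_real (2 * real n) * hadamard \<psi> (n - 1) x"])
  show "deriv_seq_on UNIV (\<lambda>n. \<psi> (Suc n))"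
    using rapid_on_deriv_seq[OF rapid_on_Suc[OF \<psi>]] .
  show "deriv_seq_on UNIV (\<lambda>n x. of_real (2 * x) * hadamard \<psi> n x + of_real (2 * real n) * hadamard \<psi> (n - 1) x)"
    unfolding deriv_seq_on_def
  proof (intro allI ballI)
    fix n and x :: real
    note d = deriv_seq_onD[OF deriv_seq_on_hadamard[OF \<psi>] UNIV_I]
    have x: "((\<lambda>x. complex_of_real (2 * x)) has_vector_derivative of_real 2) (at x)"
      by (intro has_vector_derivative_of_real) (auto intro!: derivative_eq_intros)
    have 1: "((\<lambda>x. of_real (2 * real n) * hadamard \<psi> (n - 1) x) has_vector_derivative
        of_real (2 * real n) * hadamard \<psi> n x) (at x)"
    proof (cases n)
      case (Suc m)
      show ?thesis using has_vector_derivative_mult_right[OF d[of "n - 1" x], of "of_real (2 * real n)"] Suc by simp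
    qed simp
    from has_vector_derivative_add[OF has_vector_derivative_mult[OF x d[of n x]] 1]
    have "((\<lambda>x. of_real (2 * x) * hadamard \<psi> n x + of_real (2 * real n) * hadamard \<psi> (n - 1) x) has_vector_derivative
        of_real (2 * x) * hadamard \<psi> (Suc n) x + of_real 2 * hadamard \<psi> n x + of_real (2 * real n) * hadamard \<psi> n x) (at x)"
      by simp
    thus "((\<lambda>x. of_real (2 * x) * hadamard \<psi> n x + of_real (2 * real n) * hadamard \<psi> (n - 1) x) has_vector_derivative
        of_real (2 * x) * hadamard \<psi> (Suc n) x + of_real (2 * real (Suc n)) * hadamard \<psi> (Suc n - 1) x) (at x within UNIV)"
      by (rule has_vector_derivative_eq_rhs[OF has_vector_derivative_at_within]) (simp add: algebra_simps)
  qed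
  show "\<psi> (Suc 0) x = of_real (2 * x) * hadamard \<psi> 0 x + of_real (2 * real 0) * hadamard \<psi> (0 - 1) x" for x
    using hadamard_0[OF assms] by simp
qed auto

text \<open>The integral loses the decay near \<open>v = 0\<close> and is used for boundedness only.
  Decay comes from \<open>hadamard_rec\<close>: solved for
  \<open>2 * x * hadamard \<psi> n x\<close>, it buys one power of the weight per induction
  step.\<close>

lemma rapid_on_hadamard:
  assumes \<psi>: "rapid_on UNIV \<psi>" and 0: "\<psi> 1 0 = 0"
  shows "rapid_on UNIV (hadamard \<psi>)"
  unfolding rapid_on_def
proof (intro conjI deriv_seq_on_hadamard \<psi> allI)
  fix n N
  show "\<exists>B. \<forall>u\<in>UNIV. (1 + \<bar>u\<bar>) ^ N * norm (hadamard \<psi> n u) \<le> B"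
  proof (induction N arbitrary: n)
    case 0
    obtain B where B: "B \<ge> 0" "\<And>u. (1 + \<bar>u\<bar>) ^ 0 * norm (\<psi> (n + 2) u) \<le> B"
      using rapid_on_bound[OF \<psi>, of 0 "n + 2"] by auto
    have "norm (hadamard \<psi> n x) \<le> B" for x
    proof -
      have "norm (hadamard \<psi> n x) \<le> integral {0..1} (\<lambda>v::real. B)"
        unfolding hadamard_def
      proof (rule integral_norm_bound_integral)
        show "(\<lambda>v. (v ^ n / 2) *\<^sub>R \<psi> (n + 2) (x * v)) integrable_on {0..1}"
          by (intro integrable_continuous_interval continuous_intros continuous_on_UNIV_rapid[OF \<psi>]) auto
        fix v :: real assume v: "v \<in> {0..1}"
        have "norm ((v ^ n / 2) *\<^sub>R \<psi> (n + 2) (x * v)) = (v ^ n / 2) * norm (\<psi> (n + 2) (x * v))"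
          using v by simp
        also have "\<dots> \<le> 1 * B"
          using v B by (intro mult_mono) (auto simp: power_le_one intro: order_trans[of _ 1])
        finally show "norm ((v ^ n / 2) *\<^sub>R \<psi> (n + 2) (x * v)) \<le> B" by simp
      qed auto
      thus ?thesis by simp
    qed
    thus ?case by auto
  next
    case (Suc N)
    obtain B1 where B1: "\<And>u. (1 + \<bar>u\<bar>) ^ N * norm (hadamard \<psi> n u) \<le> B1" using Suc.IH[of n] by auto
    obtain B2 where B2: "\<And>u. (1 + \<bar>u\<bar>) ^ N * norm (hadamard \<psi> (n - 1) u) \<le> B2" using Suc.IH[of "n - 1"] by auto
    obtain B3 where B3: "\<And>u. (1 + \<bar>u\<bar>) ^ N * norm (\<psi> (Suc n) u) \<le> B3"
      using rapid_on_bound[OF \<psi>, of N "Suc n"] by auto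
    have "(1 + \<bar>u\<bar>) ^ Suc N * norm (hadamard \<psi> n u) \<le> B1 + B3 + 2 * n * B2" for u
    proof -
      let ?w = "(1 + \<bar>u\<bar>) ^ N"
      have "of_real (2 * u) * hadamard \<psi> n u = \<psi> (Suc n) u - of_real (2 * real n) * hadamard \<psi> (n - 1) u"
        by (subst hadamard_rec[OF assms]) simp
      hence "norm (of_real (2 * u) * hadamard \<psi> n u) \<le> norm (\<psi> (Suc n) u) + norm (of_real (2 * real n) * hadamard \<psi> (n - 1) u)"
        using norm_triangle_ineq4 by metis
      hence "2 * (\<bar>u\<bar> * norm (hadamard \<psi> n u)) \<le> norm (\<psi> (Suc n) u) + 2 * n * norm (hadamard \<psi> (n - 1) u)"
        by (simp add: norm_mult abs_mult)
      moreover have "0 \<le> \<bar>u\<bar> * norm (hadamard \<psi> n u)" by simp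
      ultimately have "norm (hadamard \<psi> n u) + \<bar>u\<bar> * norm (hadamard \<psi> n u) \<le>
          norm (hadamard \<psi> n u) + norm (\<psi> (Suc n) u) + 2 * n * norm (hadamard \<psi> (n - 1) u)"
        by linarith
      hence "?w * (norm (hadamard \<psi> n u) + \<bar>u\<bar> * norm (hadamard \<psi> n u)) \<le>
          ?w * (norm (hadamard \<psi> n u) + norm (\<psi> (Suc n) u) + 2 * n * norm (hadamard \<psi> (n - 1) u))"
        by (intro mult_left_mono) auto
      also have "\<dots> = ?w * norm (hadamard \<psi> n u) + ?w * norm (\<psi> (Suc n) u) + 2 * n * (?w * norm (hadamard \<psi> (n - 1) u))"
        by (simp add: algebra_simps)
      also have "\<dots> \<le> B1 + B3 + 2 * n * B2"
        by (intro add_mono mult_left_mono B1 B2 B3) auto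
      finally show ?thesis by (simp add: algebra_simps)
    qed
    thus ?case by auto
  qed
qed

text \<open>Evenness is encoded by the odd derivatives at 0 because this passes to
  \<open>hadamard \<psi>\<close> by inspection of the integral, \<open>n + 2\<close> having the
  parity of \<open>n\<close>; thus \<open>hadamard\<close> can be iterated.\<close>

definition even_seq :: "(nat \<Rightarrow> real \<Rightarrow> complex) \<Rightarrow> bool" where
  "even_seq \<psi> \<longleftrightarrow> rapid_on UNIV \<psi> \<and> (\<forall>n. odd n \<longrightarrow> \<psi> n 0 = 0)"

lemma even_seq_hadamard: "even_seq \<psi> \<Longrightarrow> even_seq (hadamard \<psi>)"
  by (auto simp: even_seq_def hadamard_def[of _ _ 0] intro!: rapid_on_hadamard)

lemma even_seq_funpow: "even_seq \<psi> \<Longrightarrow> even_seq ((hadamard ^^ m) \<psi>)"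
  by (induction m) (auto intro: even_seq_hadamard)

lemma even_seqI:
  assumes \<psi>: "rapid_on UNIV \<psi>" and even: "\<And>x. \<psi> 0 (- x) = \<psi> 0 x"
  shows "even_seq \<psi>"
  unfolding even_seq_def
proof (intro conjI \<psi> allI impI)
  fix n :: nat assume n: "odd n"
  have "\<psi> n 0 = (-1) ^ n * \<psi> n (- 0)"
  proof (rule deriv_seq_on_unique[of UNIV \<psi> "\<lambda>n x. (-1) ^ n * \<psi> n (- x)"])
    show "deriv_seq_on UNIV (\<lambda>n x. (-1) ^ n * \<psi> n (- x))"
      unfolding deriv_seq_on_def
    proof (intro allI ballI)
      fix n and x :: real
      have "(uminus has_vector_derivative (-1)) (at x)"
        by (auto intro!: derivative_eq_intros simp flip: has_real_derivative_iff_has_vector_derivative)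
      moreover have "(\<psi> n has_vector_derivative \<psi> (Suc n) (- x)) (at (- x))"
        using rapid_onD[OF \<psi>, of "- x" n] by simp
      ultimately have "(\<psi> n \<circ> uminus has_vector_derivative (-1) *\<^sub>R \<psi> (Suc n) (- x)) (at x)"
        by (intro vector_diff_chain_at)
      from has_vector_derivative_mult_right[OF this, of "(-1) ^ n"]
      show "((\<lambda>x. (-1) ^ n * \<psi> n (- x)) has_vector_derivative (-1) ^ Suc n * \<psi> (Suc n) (- x)) (at x within UNIV)"
        by (simp add: o_def)
    qed
  qed (use even rapid_on_deriv_seq[OF \<psi>] in auto)
  thus "\<psi> n 0 = 0" using n by simp
qed

text \<open>\<open>hadamard\<close> differentiates with respect to \<open>x^2\<close>, so its
  iterates at \<open>sqrt u\<close> are the derivatives in \<open>u\<close>; continuity settles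
  \<open>u = 0\<close>. The exponent of the weight doubles because of
  \<open>1 + u <= (1 + sqrt u)^2\<close>.\<close>

lemma rapid_on_sqrt_comp:
  assumes \<psi>: "even_seq \<psi>"
  shows "rapid_on {0..} (\<lambda>m u. (hadamard ^^ m) \<psi> 0 (sqrt u))"
proof -
  define \<Psi> where "\<Psi> m = (hadamard ^^ m) \<psi>" for m
  have \<Psi>: "rapid_on UNIV (\<Psi> m)" "\<Psi> m 1 0 = 0" for m
    using even_seq_funpow[OF \<psi>, of m] by (auto simp: even_seq_def \<Psi>_def)
  have cont: "continuous_on A (\<lambda>u. \<Psi> m 0 (sqrt u))" for m A
    by (intro continuous_on_UNIV_rapid[OF \<Psi>(1)] continuous_intros)
  have "deriv_seq_on {0..} (\<lambda>m u. \<Psi> m 0 (sqrt u))"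
    unfolding deriv_seq_on_def
  proof (intro allI ballI has_vector_derivative_Ici_I cont)
    fix m and t :: real assume t: "t > 0"
    have "(\<Psi> m 0 has_vector_derivative of_real (2 * sqrt t) * \<Psi> (Suc m) 0 (sqrt t)) (at (sqrt t))"
      using rapid_onD[OF \<Psi>(1), of "sqrt t" m 0] hadamard_0[OF \<Psi>, of m "sqrt t"]
      by (simp add: \<Psi>_def)
    moreover have "(sqrt has_vector_derivative (inverse (sqrt t) / 2)) (at t)"
      using DERIV_real_sqrt[OF t] by (simp add: has_real_derivative_iff_has_vector_derivative)
    ultimately have "(\<Psi> m 0 \<circ> sqrt has_vector_derivative
        (inverse (sqrt t) / 2) *\<^sub>R (of_real (2 * sqrt t) * \<Psi> (Suc m) 0 (sqrt t))) (at t)"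
      by (intro vector_diff_chain_at)
    thus "((\<lambda>u. \<Psi> m 0 (sqrt u)) has_vector_derivative \<Psi> (Suc m) 0 (sqrt t)) (at t)"
      unfolding o_def by (rule has_vector_derivative_eq_rhs) (use t in \<open>simp add: scaleR_conv_of_real field_simps\<close>)
  qed auto
  moreover have "\<exists>B. \<forall>u\<in>{0..}. (1 + \<bar>u\<bar>) ^ N * norm (\<Psi> m 0 (sqrt u)) \<le> B" for m N
  proof -
    obtain B where B: "\<And>x. (1 + \<bar>x\<bar>) ^ (2 * N) * norm (\<Psi> m 0 x) \<le> B"
      using rapid_on_bound[OF \<Psi>(1), of "2 * N" m 0] by auto
    have "(1 + \<bar>u\<bar>) ^ N * norm (\<Psi> m 0 (sqrt u)) \<le> B" if "u \<ge> 0" for u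
    proof -
      have "(1 + \<bar>u\<bar>) ^ N \<le> ((1 + \<bar>sqrt u\<bar>)\<^sup>2) ^ N"
        using that by (intro power_mono) (auto simp: power2_sum)
      also have "\<dots> = (1 + \<bar>sqrt u\<bar>) ^ (2 * N)" by (simp add: power_mult)
      finally have "(1 + \<bar>u\<bar>) ^ N * norm (\<Psi> m 0 (sqrt u)) \<le> (1 + \<bar>sqrt u\<bar>) ^ (2 * N) * norm (\<Psi> m 0 (sqrt u))"
        by (intro mult_right_mono) auto
      also have "\<dots> \<le> B" by (rule B)
      finally show ?thesis .
    qed
    thus ?thesis by auto
  qed
  ultimately show ?thesis unfolding rapid_on_def \<Psi>_def by blast
qed

lemma radial_schwartz_profile:
  assumes f: "schwartz f" and rad: "radial f"
  obtains h where "rapid_on {0..} h" "\<And>x. f x = h 0 ((norm x)\<^sup>2)"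
proof -
  define \<psi> where "\<psi> n s = iter_partial_deriv (replicate n 1) f (s *\<^sub>R axis 1 1)" for n s
  obtain H where H: "\<And>x. f x = H ((norm x)\<^sup>2)" using rad by (auto simp: radial_def)
  have \<psi>0: "\<psi> 0 s = H (s\<^sup>2)" for s
    by (simp add: \<psi>_def iter_partial_deriv_def H norm_axis_1 power_mult_distrib)
  have "rapid_on UNIV \<psi>" using rapid_on_axis[OF f] by (simp add: \<psi>_def[abs_def])
  hence "even_seq \<psi>" by (rule even_seqI) (simp add: \<psi>0)
  from rapid_on_sqrt_comp[OF this] show ?thesis
    by (rule that) (simp add: \<psi>0 H)
qed

section \<open>The planar Fourier transform of a radial function\<close>

lemma lborel_vec2: "(lborel :: (real ^ 2) measure) =
    distr lborel borel (\<lambda>p. fst p *\<^sub>R axis 1 1 + snd p *\<^sub>R axis 2 1)" (is "_ = distr _ _ ?T")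
proof (rule lborel_eqI)
  have T: "?T \<in> borel_measurable borel"
    by (intro borel_measurable_continuous_onI continuous_intros)
  fix l u :: "real ^ 2" assume le: "\<And>b. b \<in> Basis \<Longrightarrow> l \<bullet> b \<le> u \<bullet> b"
  have le': "l $ i \<le> u $ i" for i
    using le[of "axis i 1"] by (simp add: inner_axis axis_in_Basis_iff)
  have B: "(Basis :: (real ^ 2) set) = {axis 1 1, axis 2 1}"
    by (auto simp: Basis_vec_def UNIV_2)
  have ne: "axis 1 1 \<noteq> (axis 2 1 :: real ^ 2)" by (simp add: axis_eq_axis)
  have axis_2: "axis 1 (1::real) $ (2::2) = 0" "axis 2 (1::real) $ (1::2) = 0"
    by (simp_all add: axis_def)
  have vim: "?T -` box l u = box (l $ 1, l $ 2) (u $ 1, u $ 2)"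
    by (auto simp: mem_box B inner_axis axis_2 Basis_prod_def ball_Un)
  have "emeasure (distr lborel borel ?T) (box l u) = emeasure lborel (box (l $ 1, l $ 2) (u $ 1, u $ 2))"
    using T by (subst emeasure_distr) (auto simp: vim)
  also have "\<dots> = ennreal (\<Prod>b\<in>Basis. ((u $ 1, u $ 2) - (l $ 1, l $ 2)) \<bullet> b)"
    using le' by (subst emeasure_lborel_box) (auto simp: Basis_prod_def)
  also have "(\<Prod>b\<in>Basis. ((u $ 1, u $ 2) - (l $ 1, l $ 2)) \<bullet> b) = (u $ 1 - l $ 1) * (u $ 2 - l $ 2)"
    by (simp add: Basis_prod_def)
  also have "\<dots> = (\<Prod>b\<in>Basis. (u - l) \<bullet> b)"
    unfolding B using ne by (simp add: inner_axis)
  finally show "emeasure (distr lborel borel ?T) (box l u) = ennreal (\<Prod>b\<in>Basis. (u - l) \<bullet> b)" .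
qed simp

text \<open>\<open>(1 + x^2) * (1 + y^2) <= (1 + x^2 + y^2)^2\<close> provides an integrable
  majorant of product form.\<close>

lemma integrable_square_comp_pair:
  assumes h: "rapid_on {0..} h"
  shows "integrable (lborel \<Otimes>\<^sub>M lborel) (\<lambda>(x, y). h 0 (x\<^sup>2 + y\<^sup>2) * exp (\<i> * of_real (c * x)))"
proof -
  obtain B where B: "seq_bound 0 2 B h" using rapid_on_seq_bound[OF h] .
  let ?g = "\<lambda>(x, y). B * (inverse (1 + x\<^sup>2) * inverse (1 + y\<^sup>2)) :: real"
  have g: "integrable (lborel \<Otimes>\<^sub>M lborel) ?g"
  proof (rule lborel_pair.Fubini_integrable)
    show "?g \<in> borel_measurable (lborel \<Otimes>\<^sub>M lborel)" by measurable
    show "integrable lborel (\<lambda>x. LINT y|lborel. norm (?g (x, y)))"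
      using integrable_inverse_1_plus_square_real by (simp add: abs_mult)
    show "AE x in lborel. integrable lborel (\<lambda>y. ?g (x, y))"
      using integrable_inverse_1_plus_square_real by simp
  qed
  show ?thesis
  proof (rule Bochner_Integration.integrable_bound[OF g])
    have "continuous_on UNIV (\<lambda>p::real\<times>real. h 0 ((fst p)\<^sup>2 + (snd p)\<^sup>2))"
      by (rule continuous_on_compose2[OF deriv_seq_on_continuous[OF rapid_on_deriv_seq[OF h]]])
         (auto intro!: continuous_intros)
    hence "continuous_on UNIV (\<lambda>p::real\<times>real. h 0 ((fst p)\<^sup>2 + (snd p)\<^sup>2) * exp (\<i> * of_real (c * fst p)))"
      by (intro continuous_intros)
    hence "(\<lambda>p::real\<times>real. h 0 ((fst p)\<^sup>2 + (snd p)\<^sup>2) * exp (\<i> * of_real (c * fst p))) \<in> borel_measurable borel"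
      by (rule borel_measurable_continuous_onI)
    thus "(\<lambda>(x, y). h 0 (x\<^sup>2 + y\<^sup>2) * exp (\<i> * of_real (c * x))) \<in> borel_measurable (lborel \<Otimes>\<^sub>M lborel)"
      unfolding lborel_prod measurable_lborel2 by (simp add: split_beta')
    show "AE p in lborel \<Otimes>\<^sub>M lborel. norm (case p of (x, y) \<Rightarrow> h 0 (x\<^sup>2 + y\<^sup>2) * exp (\<i> * of_real (c * x))) \<le> norm (?g p)"
    proof (rule AE_I2)
      fix p :: "real \<times> real"
      obtain x y where p: "p = (x, y)" by (cases p)
      have pos: "1 + x\<^sup>2 > 0" "1 + y\<^sup>2 > 0" by (simp_all add: add_pos_nonneg)
      have "(1 + x\<^sup>2) * (1 + y\<^sup>2) * norm (h 0 (x\<^sup>2 + y\<^sup>2)) \<le> (1 + (x\<^sup>2 + y\<^sup>2))\<^sup>2 * norm (h 0 (x\<^sup>2 + y\<^sup>2))"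
        unfolding power2_eq_square[of "1 + (x\<^sup>2 + y\<^sup>2)"] by (intro mult_right_mono mult_mono) auto
      also have "\<dots> \<le> B" by (rule seq_boundD[OF B]) auto
      finally have "norm (h 0 (x\<^sup>2 + y\<^sup>2)) * ((1 + x\<^sup>2) * (1 + y\<^sup>2)) \<le> B"
        by (simp only: mult.commute)
      hence "norm (h 0 (x\<^sup>2 + y\<^sup>2)) \<le> B / ((1 + x\<^sup>2) * (1 + y\<^sup>2))"
        using pos by (subst pos_le_divide_eq) auto
      hence "norm (h 0 (x\<^sup>2 + y\<^sup>2)) \<le> B * (inverse (1 + x\<^sup>2) * inverse (1 + y\<^sup>2))"
        by (simp add: divide_inverse)
      also have "\<dots> \<le> norm (?g p)" by (simp add: p)
      finally show "norm (case p of (x, y) \<Rightarrow> h 0 (x\<^sup>2 + y\<^sup>2) * exp (\<i> * of_real (c * x))) \<le> norm (?g p)"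
        by (simp add: p norm_mult)
    qed
  qed
qed

text \<open>By Fubini the integral over the second coordinate is the Abel transform; of the
  remaining exponential only the cosine survives, the sine part being odd. Points on the first axis
  are those that \<open>radial_profile\<close> evaluates.\<close>

lemma fourier_radial:
  assumes h: "rapid_on {0..} h" and f: "\<And>x. f x = h 0 ((norm x)\<^sup>2)" and s: "s \<ge> 0"
  shows "fourier f (sqrt s *\<^sub>R axis 1 1) = fcos (abel h) s"
proof -
  define c where "c = 2 * pi * sqrt s"
  let ?T = "\<lambda>p. fst p *\<^sub>R axis 1 1 + snd p *\<^sub>R axis 2 1 :: real ^ 2"
  let ?F = "\<lambda>x. f x * exp (2 * of_real pi * \<i> * of_real (x \<bullet> (sqrt s *\<^sub>R axis 1 1)))"
  have n: "(norm (x *\<^sub>R axis 1 1 + y *\<^sub>R axis 2 1 :: real ^ 2))\<^sup>2 = x\<^sup>2 + y\<^sup>2" for x y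
    unfolding power2_norm_eq_inner by (simp add: inner_vec_def sum_2 axis_def power2_eq_square)
  have ip: "(x *\<^sub>R axis 1 1 + y *\<^sub>R axis 2 1 :: real ^ 2) \<bullet> (sqrt s *\<^sub>R axis 1 1) = sqrt s * x" for x y
    by (simp add: inner_add_left inner_axis_axis)
  have FT: "?F (?T p) = (case p of (x, y) \<Rightarrow> h 0 (x\<^sup>2 + y\<^sup>2) * exp (\<i> * of_real (c * x)))" for p
    by (cases p) (simp only: f n ip fst_conv snd_conv prod.case, simp add: c_def mult_ac)
  have "continuous_on UNIV (\<lambda>x::real^2. h 0 ((norm x)\<^sup>2))"
    by (rule continuous_on_compose2[OF deriv_seq_on_continuous[OF rapid_on_deriv_seq[OF h]]])
       (auto intro!: continuous_intros)
  hence "continuous_on UNIV ?F" unfolding f by (intro continuous_intros)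
  hence meas: "?F \<in> borel_measurable borel" by (rule borel_measurable_continuous_onI)
  have T: "?T \<in> borel_measurable lborel"
    unfolding measurable_lborel2 by (intro borel_measurable_continuous_onI continuous_intros)
  have "fourier f (sqrt s *\<^sub>R axis 1 1) = (LINT p|lborel. ?F (?T p))"
    unfolding fourier_def by (subst lborel_vec2, subst integral_distr[OF T meas]) simp
  also have "\<dots> = (LINT p|(lborel \<Otimes>\<^sub>M lborel). (case p of (x, y) \<Rightarrow> h 0 (x\<^sup>2 + y\<^sup>2) * exp (\<i> * of_real (c * x))))"
    unfolding FT lborel_prod ..
  also have "\<dots> = (LINT x|lborel. LINT y|lborel. h 0 (x\<^sup>2 + y\<^sup>2) * exp (\<i> * of_real (c * x)))"
    using lborel_pair.integral_fst'[OF integrable_square_comp_pair[OF h, of c]] by simp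
  also have "\<dots> = (LINT x|lborel. abel h 0 (x\<^sup>2) * exp (\<i> * of_real (c * x)))"
    by (simp add: abel_def)
  also have "\<dots> = (LINT x|lborel. abel h 0 (x\<^sup>2) * of_real (cos (c * x)) + \<i> * (abel h 0 (x\<^sup>2) * of_real (sin (c * x))))"
  proof -
    have "exp (\<i> * of_real t) = of_real (cos t) + \<i> * of_real (sin t)" for t
      by (simp add: exp_Euler cos_of_real sin_of_real)
    thus ?thesis by (simp only: distrib_left mult.left_commute)
  qed
  also have "\<dots> = (LINT x|lborel. abel h 0 (x\<^sup>2) * of_real (cos (c * x))) +
      \<i> * (LINT x|lborel. abel h 0 (x\<^sup>2) * of_real (sin (c * x)))"
  proof -
    note A = rapid_on_abel[OF h]
    obtain B where B: "seq_bound 0 3 B (abel h)" using rapid_on_seq_bound[OF A] .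
    have "integrable lborel (\<lambda>x. abel h 0 (x\<^sup>2) * of_real (sin (c * x)))"
    proof (rule integral_bound_inverse_1_plus_square)
      show "continuous_on UNIV (\<lambda>x. abel h 0 (x\<^sup>2) * complex_of_real (sin (c * x)))"
        by (intro continuous_intros A)
      show "norm (abel h 0 (x\<^sup>2) * complex_of_real (sin (c * x))) \<le> B * inverse (1 + x\<^sup>2)" for x
      proof -
        have "norm (abel h 0 (x\<^sup>2) * complex_of_real (sin (c * x))) \<le> norm (abel h 0 (x\<^sup>2)) * 1"
          unfolding norm_mult by (intro mult_left_mono) auto
        thus ?thesis using square_comp_bound(1)[OF B, of 0 x] by simp
      qed
    qed
    thus ?thesis
      by (subst Bochner_Integration.integral_add[OF integrable_fcos[OF A] integrable_mult_right]) auto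
  qed
  also have "(LINT x|lborel. abel h 0 (x\<^sup>2) * of_real (sin (c * x))) = 0"
  proof -
    let ?g = "\<lambda>x. abel h 0 (x\<^sup>2) * complex_of_real (sin (c * x))"
    have "(LINT x|lborel. ?g x) = (LINT x|lborel. ?g (0 + (-1) * x))"
      by (subst lborel_integral_real_affine[of "-1" ?g 0]) auto
    also have "\<dots> = - (LINT x|lborel. ?g x)" by simp
    finally show ?thesis by simp
  qed
  finally show ?thesis by (simp add: fcos_def c_def)
qed

section \<open>Growth of the coefficients\<close>

text \<open>The strict bound by 2 makes the reduction contract; it also puts the nodes
  \<open>2 * n / \<lambda>\<close> at or beyond \<open>n\<close>.\<close>

lemma hecke_lambda_bounds:
  assumes "l \<ge> 6"
  shows "1 \<le> hecke_lambda l" "hecke_lambda l < 2"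
proof -
  have l: "0 < pi / l" "pi / l \<le> pi / 3" using assms by (auto simp: field_simps)
  have "cos (pi / 3) \<le> cos (pi / l)"
    by (rule cos_monotone_0_pi_le) (use l pi_gt_zero in auto)
  thus "1 \<le> hecke_lambda l" by (simp add: hecke_lambda_def cos_60)
  have "pi / l \<le> pi" using l(2) pi_gt_zero by linarith
  hence "cos (pi / l) < cos 0"
    by (intro cos_monotone_0_pi l(1)) auto
  thus "hecke_lambda l < 2" by (simp add: hecke_lambda_def)
qed

lemma norm_hecke_q: "norm (hecke_q l z) = exp (- (2 * pi / hecke_lambda l) * Im z)"
  by (simp add: hecke_q_def norm_exp_eq_Re Re_divide_of_real mult.assoc)

text \<open>Absolute convergence follows from convergence at half the height, where
  \<open>|q|\<close> is larger.\<close>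

lemma summable_norm_q_expansion:
  assumes b: "has_q_expansion l g b" and lam: "hecke_lambda l > 0" and z: "Im z > 0"
  shows "summable (\<lambda>n. norm (b n) * norm (hecke_q l z) ^ n)"
proof -
  define w where "w = \<i> * of_real (Im z / 2)"
  have w: "Im w = Im z / 2" by (simp add: w_def)
  have "summable (\<lambda>n. b n * hecke_q l w ^ n)"
    using b z w by (auto simp: has_q_expansion_def upper_half_plane_def sums_iff)
  moreover have "norm (hecke_q l z) < norm (hecke_q l w)"
    unfolding norm_hecke_q w using lam z by (simp add: divide_strict_right_mono)
  ultimately have "summable (\<lambda>n. norm (b n * hecke_q l z ^ n))" by (rule powser_insidea)
  thus ?thesis by (simp add: norm_mult norm_power)
qed

lemma q_expansion_bounded:
  assumes b: "has_q_expansion l g b" and lam: "hecke_lambda l > 0" and y: "y > 0"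
  obtains G where "G \<ge> 0" "\<And>z. Im z \<ge> y \<Longrightarrow> norm (g z) \<le> G"
proof
  define q where "q = norm (hecke_q l (\<i> * of_real y))"
  have q: "summable (\<lambda>n. norm (b n) * q ^ n)"
    unfolding q_def by (rule summable_norm_q_expansion[OF b lam]) (use y in simp)
  have q0: "q \<ge> 0" by (simp add: q_def)
  show "(\<Sum>n. norm (b n) * q ^ n) \<ge> 0" by (intro suminf_nonneg q) (use q0 in auto)
  fix z :: complex assume z: "Im z \<ge> y"
  have le: "norm (hecke_q l z) \<le> q"
    unfolding q_def norm_hecke_q using lam z by (simp add: divide_right_mono)
  have s: "summable (\<lambda>n. norm (b n * hecke_q l z ^ n))"
    using summable_norm_q_expansion[OF b lam, of z] z y by (simp add: norm_mult norm_power)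
  have "g z = (\<Sum>n. b n * hecke_q l z ^ n)"
    using b z y by (auto simp: has_q_expansion_def upper_half_plane_def sums_iff)
  also have "norm \<dots> \<le> (\<Sum>n. norm (b n * hecke_q l z ^ n))" by (rule summable_norm[OF s])
  also have "\<dots> \<le> (\<Sum>n. norm (b n) * q ^ n)"
    by (intro suminf_le s q) (use le in \<open>auto simp: norm_mult norm_power intro!: mult_left_mono power_mono\<close>)
  finally show "norm (g z) \<le> (\<Sum>n. norm (b n) * q ^ n)" .
qed

section \<open>Raising points by inversion and translation, and growth at the real axis\<close>

context
  fixes lam :: real and g :: "complex \<Rightarrow> complex" and r :: nat
  assumes lam: "0 < lam" "lam < 2"
    and periodic: "\<And>z. Im z > 0 \<Longrightarrow> g (z + of_real lam) = g z"
    and inversion: "\<And>z. Im z > 0 \<Longrightarrow> norm (g (- 1 / z)) = norm z ^ r * norm (g z)"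
begin

lemma periodic_int:
  assumes z: "Im z > 0"
  shows "g (z + of_real (lam * of_int m)) = g z"
proof -
  have nat: "g (z + of_real (lam * of_nat n)) = g z" if "Im z > 0" for n z
  proof (induction n)
    case (Suc n)
    have "g ((z + of_real (lam * of_nat n)) + of_real lam) = g (z + of_real (lam * of_nat n))"
      by (rule periodic) (use that in simp)
    thus ?case using Suc by (simp add: algebra_simps)
  qed simp
  show ?thesis
  proof (cases "m \<ge> 0")
    case True
    thus ?thesis using nat[OF z, of "nat m"] by simp
  next
    case False
    have "g ((z + of_real (lam * of_int m)) + of_real (lam * of_nat (nat (- m)))) = g (z + of_real (lam * of_int m))"
      by (rule nat) (use z in simp)
    thus ?thesis using False by (simp add: algebra_simps)
  qed
qed

text \<open>Points already in the strip stay put and the others move by the nearest multiple of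
  \<open>lam\<close>, so that \<open>|Re w| <= |Re z|\<close> in either case.\<close>

lemma translate_strip:
  assumes z: "Im z > 0"
  obtains w where "Im w = Im z" "\<bar>Re w\<bar> \<le> lam / 2" "\<bar>Re w\<bar> \<le> \<bar>Re z\<bar>" "g w = g z"
proof (cases "\<bar>Re z\<bar> \<le> lam / 2")
  case False
  define m where "m = - round (Re z / lam)"
  define w where "w = z + of_real (lam * of_int m)"
  have "\<bar>of_int (round (Re z / lam)) - Re z / lam\<bar> \<le> 1 / 2"
    by (rule of_int_round_abs_le)
  hence "lam * \<bar>of_int (round (Re z / lam)) - Re z / lam\<bar> \<le> lam * (1 / 2)"
    using lam by (intro mult_left_mono) auto
  moreover have "lam * \<bar>of_int (round (Re z / lam)) - Re z / lam\<bar> = \<bar>Re w\<bar>"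
  proof -
    have "lam * \<bar>of_int (round (Re z / lam)) - Re z / lam\<bar> =
        \<bar>lam * (of_int (round (Re z / lam)) - Re z / lam)\<bar>"
      using lam by (simp add: abs_mult)
    also have "lam * (of_int (round (Re z / lam)) - Re z / lam) = - Re w"
      using lam by (simp add: w_def m_def algebra_simps)
    finally show ?thesis by simp
  qed
  ultimately have "\<bar>Re w\<bar> \<le> lam / 2" by simp
  thus ?thesis using that[of w] periodic_int[OF z, of m] False by (auto simp: w_def)
qed (use that in auto)

text \<open>
  The quantity \<open>(\<bar>z\<bar>\<^sup>2 + 1) / Im z\<close> is twice the hyperbolic cosine of the distance from \<open>z\<close>
  to \<open>\<i>\<close>: it is invariant under inversion and does not increase when \<open>z\<close> is translated
  into the strip, so it bounds the imaginary part that the reduction ends with.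
\<close>
lemma reduction:
  assumes \<rho>: "lam\<^sup>2 / 4 + y0\<^sup>2 \<le> \<rho>" "\<rho> < 1" and y0: "y0 > 0"
    and z: "Im z > 0" "\<bar>Re z\<bar> \<le> lam / 2" "Im z \<ge> y0 * \<rho> ^ n"
  shows "\<exists>w. Im w \<ge> y0 \<and> Im w ^ r * norm (g w) ^ 2 = Im z ^ r * norm (g z) ^ 2 \<and>
    ((norm w)\<^sup>2 + 1) / Im w \<le> ((norm z)\<^sup>2 + 1) / Im z"
  using z
proof (induction n arbitrary: z)
  case 0
  thus ?case by auto
next
  case (Suc n)
  have \<rho>0: "\<rho> > 0" using \<rho>(1) y0 by (smt (verit) zero_less_power2 zero_le_power2 divide_nonneg_pos)
  show ?case
  proof (cases "Im z \<ge> y0")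
    case True
    thus ?thesis by auto
  next
    case False
    have z0: "z \<noteq> 0" using Suc.prems(1) by auto
    have nz: "(norm z)\<^sup>2 > 0" using z0 by simp
    have "(Re z)\<^sup>2 \<le> (lam / 2)\<^sup>2" using Suc.prems(2) lam by (simp add: abs_le_square_iff[symmetric])
    moreover have "(Im z)\<^sup>2 \<le> y0\<^sup>2" using False Suc.prems(1) by (intro power_mono) auto
    \<comment> \<open>In the strip and below height \<open>y0\<close> one has
      \<open>|z|^2 <= \<rho> < 1\<close>, so inversion raises the point by a factor of at least
      \<open>1 / \<rho>\<close>; \<open>n\<close> bounds the number of inversions still to
      come.\<close>
    ultimately have n\<rho>: "(norm z)\<^sup>2 \<le> \<rho>"
      using \<rho>(1) unfolding cmod_power2 by (simp add: power_divide)
    have Im: "Im (- 1 / z) = Im z / (norm z)\<^sup>2"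
      by (simp add: Im_divide cmod_power2)
    have nm: "(norm (- 1 / z))\<^sup>2 = 1 / (norm z)\<^sup>2" by (simp add: norm_divide power_divide)
    have Im0: "Im (- 1 / z) > 0" unfolding Im using Suc.prems(1) nz by simp
    obtain w where w: "Im w = Im (- 1 / z)" "\<bar>Re w\<bar> \<le> lam / 2" "\<bar>Re w\<bar> \<le> \<bar>Re (- 1 / z)\<bar>" "g w = g (- 1 / z)"
      using translate_strip[OF Im0] .
    have "y0 * \<rho> ^ n \<le> Im z / \<rho>"
      using Suc.prems(3) \<rho>0 by (simp add: field_simps)
    also have "\<dots> \<le> Im z / (norm z)\<^sup>2"
      using n\<rho> nz \<rho>0 Suc.prems(1) by (intro divide_left_mono) auto
    finally have "Im w \<ge> y0 * \<rho> ^ n" using w(1) Im by simp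
    then obtain v where v: "Im v \<ge> y0" "Im v ^ r * norm (g v) ^ 2 = Im w ^ r * norm (g w) ^ 2"
        "((norm v)\<^sup>2 + 1) / Im v \<le> ((norm w)\<^sup>2 + 1) / Im w"
      using Suc.IH[of w] w Im0 by auto
    \<comment> \<open>The invariant is the square of the usual
      \<open>Im z ^ (r / 2) * |g z|\<close>, which avoids half-integral exponents.\<close>
    have "Im w ^ r * norm (g w) ^ 2 = Im z ^ r * norm (g z) ^ 2"
    proof -
      have "Im w ^ r * norm (g w) ^ 2 = (Im z / (norm z)\<^sup>2) ^ r * (norm z ^ r * norm (g z))\<^sup>2"
        by (simp only: w(1,4) Im inversion[OF Suc.prems(1)])
      also have "\<dots> = Im z ^ r * norm (g z) ^ 2"
        using z0 by (simp add: power_divide power_mult_distrib power_mult[symmetric] mult.commute)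
      finally show ?thesis .
    qed
    moreover have "((norm w)\<^sup>2 + 1) / Im w \<le> ((norm z)\<^sup>2 + 1) / Im z"
    proof -
      have "(Re w)\<^sup>2 \<le> (Re (- 1 / z))\<^sup>2" using w(3) by (simp only: abs_le_square_iff)
      hence "(norm w)\<^sup>2 \<le> (norm (- 1 / z))\<^sup>2" unfolding cmod_power2 w(1) by simp
      hence "((norm w)\<^sup>2 + 1) / Im w \<le> ((norm (- 1 / z))\<^sup>2 + 1) / Im (- 1 / z)"
        unfolding w(1) using Im0 by (intro divide_right_mono) auto
      also have "\<dots> = ((norm z)\<^sup>2 + 1) / Im z"
        unfolding nm Im using nz Suc.prems(1) by (simp add: field_simps)
      finally show ?thesis .
    qed
    ultimately show ?thesis using v by (intro exI[of _ v]) auto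
  qed
qed

text \<open>Every point can be moved to some \<open>w\<close> with \<open>Im w >= y0\<close>, where
  \<open>g\<close> is bounded, and the invariant carries the bound back. \<open>Im w\<close> may be
  large, but is at most \<open>3 / Im z\<close>; this estimate is what raises the exponent from
  \<open>r / 2\<close> to \<open>r\<close>.\<close>

lemma growth_near_real_axis:
  assumes G: "\<And>y. y > 0 \<Longrightarrow> \<exists>G\<ge>0. \<forall>z. Im z \<ge> y \<longrightarrow> norm (g z) \<le> G"
  obtains C where "C \<ge> 0" "\<And>z. 0 < Im z \<Longrightarrow> Im z \<le> 1 \<Longrightarrow> norm (g z) \<le> C / Im z ^ r"
proof -
  define d where "d = 1 - lam\<^sup>2 / 4"
  have "lam\<^sup>2 < 2\<^sup>2" using lam by (intro power_strict_mono) auto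
  hence d: "d > 0" by (simp add: d_def)
  \<comment> \<open>This makes \<open>lam^2 / 4 + y0^2\<close> equal to \<open>1 - d / 2\<close>,
    hence less than 1.\<close>
  define y0 where "y0 = sqrt (d / 2)"
  define \<rho> where "\<rho> = lam\<^sup>2 / 4 + y0\<^sup>2"
  have y0: "y0 > 0" "y0\<^sup>2 = d / 2" using d by (simp_all add: y0_def)
  have \<rho>: "0 < \<rho>" "\<rho> < 1" using y0 d lam by (simp_all add: \<rho>_def d_def add_nonneg_pos)
  obtain G where G: "G \<ge> 0" "\<And>z. Im z \<ge> y0 \<Longrightarrow> norm (g z) \<le> G" using G[OF y0(1)] by blast
  show ?thesis
  proof (rule that)
    show "0 \<le> G * 3 ^ r" using G by simp
    fix z :: complex assume z: "0 < Im z" "Im z \<le> 1"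
    obtain v where v: "Im v = Im z" "\<bar>Re v\<bar> \<le> lam / 2" "g v = g z"
      using translate_strip[OF z(1)] by metis
    have "(\<lambda>n. y0 * \<rho> ^ n) \<longlonglongrightarrow> y0 * 0"
      using \<rho> by (intro tendsto_intros LIMSEQ_power_zero) auto
    hence "eventually (\<lambda>n. y0 * \<rho> ^ n < Im z) sequentially"
      using z(1) by (intro order_tendstoD(2)) auto
    then obtain n where n: "y0 * \<rho> ^ n < Im z" by (auto simp: eventually_sequentially)
    obtain w where w: "Im w \<ge> y0" "Im w ^ r * norm (g w) ^ 2 = Im v ^ r * norm (g v) ^ 2"
        "((norm w)\<^sup>2 + 1) / Im w \<le> ((norm v)\<^sup>2 + 1) / Im v"
      using reduction[of y0 \<rho> v n] y0 \<rho> v z n by (auto simp: \<rho>_def)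
    have w0: "Im w > 0" using w(1) y0(1) by simp
    have "Im w * Im w \<le> (norm w)\<^sup>2 + 1"
      unfolding cmod_power2 by (simp add: power2_eq_square)
    hence "Im w \<le> ((norm w)\<^sup>2 + 1) / Im w" using w0 by (simp add: pos_le_divide_eq)
    also have "\<dots> \<le> ((norm v)\<^sup>2 + 1) / Im v" by fact
    \<comment> \<open>The 3 is \<open>1 + 1 + 1\<close>: in the strip
      \<open>|Re v| <= lam / 2 < 1\<close>, and \<open>Im v <= 1\<close>.\<close>
    also have "\<dots> \<le> 3 / Im z"
    proof -
      have "(Re v)\<^sup>2 \<le> 1\<^sup>2" using v(2) lam by (subst abs_le_square_iff[symmetric]) auto
      moreover have "(Im v)\<^sup>2 \<le> 1\<^sup>2" using v(1) z by (intro power_mono) auto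
      ultimately have "(norm v)\<^sup>2 + 1 \<le> 3" unfolding cmod_power2 by simp
      thus ?thesis unfolding v(1) using z by (intro divide_right_mono) auto
    qed
    finally have Imw: "Im w \<le> 3 / Im z" .
    have "Im z ^ r * norm (g z) ^ 2 = Im w ^ r * norm (g w) ^ 2" using w(2) v by simp
    also have "\<dots> \<le> (3 / Im z) ^ r * G ^ 2"
      using Imw w0 G(2)[OF w(1)] z by (intro mult_mono power_mono) auto
    finally have "Im z ^ r * (Im z ^ r * norm (g z) ^ 2) \<le> Im z ^ r * ((3 / Im z) ^ r * G ^ 2)"
      using z by (intro mult_left_mono) auto
    also have "\<dots> = 3 ^ r * G ^ 2" using z by (simp add: power_divide)
    also have "\<dots> \<le> 3 ^ r * 3 ^ r * G ^ 2"
      by (intro mult_right_mono) auto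
    finally have "(Im z ^ r * norm (g z))\<^sup>2 \<le> (G * 3 ^ r)\<^sup>2"
      by (simp add: power2_eq_square mult_ac)
    hence "Im z ^ r * norm (g z) \<le> G * 3 ^ r"
      by (rule power2_le_imp_le) (use G in simp)
    thus "norm (g z) \<le> G * 3 ^ r / Im z ^ r"
      using z by (simp add: pos_le_divide_eq mult.commute)
  qed
qed

end

section \<open>Coefficient bounds from Cauchy's inequality\<close>

lemma hecke_q_surj:
  assumes lam: "hecke_lambda l > 0" and q: "q \<noteq> 0"
  obtains z where "hecke_q l z = q"
proof
  show "hecke_q l (of_real (hecke_lambda l) * Ln q / (2 * of_real pi * \<i>)) = q"
    using lam q by (simp add: hecke_q_def)
qed

text \<open>Hecke's estimate: the circle of radius \<open>R\<close> is the image of the line at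
  height \<open>y = 1 / (1 + n)\<close>, where \<open>1 / R ^ n\<close> stays below
  \<open>exp (2 * pi / \<lambda>)\<close> and \<open>1 / y ^ r\<close> is the polynomial factor. The
  shift to \<open>1 + n\<close> includes \<open>n = 0\<close> and keeps
  \<open>y <= 1\<close>.\<close>

lemma q_expansion_coeff_growth:
  assumes b: "has_q_expansion l g b" and lam: "hecke_lambda l > 0"
    and C: "C \<ge> 0" "\<And>z. 0 < Im z \<Longrightarrow> Im z \<le> 1 \<Longrightarrow> norm (g z) \<le> C / Im z ^ r"
  shows "norm (b n) \<le> C * exp (2 * pi / hecke_lambda l) * (1 + n) ^ r"
proof -
  let ?F = "Abs_fps b" and ?L = "hecke_lambda l"
  define y where "y = 1 / (1 + real n)"
  define R where "R = exp (- (2 * pi / ?L) * y)"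
  have y: "0 < y" "y \<le> 1" by (auto simp: y_def)
  have R: "0 < R" by (simp add: R_def)
  define z0 where "z0 = \<i> * of_real (y / 2)"
  have "summable (\<lambda>n. b n * hecke_q l z0 ^ n)"
    using b y by (auto simp: has_q_expansion_def upper_half_plane_def sums_iff z0_def)
  hence "conv_radius b \<ge> norm (hecke_q l z0)" by (rule conv_radius_geI)
  moreover have "R < norm (hecke_q l z0)"
    unfolding R_def norm_hecke_q using y lam by (simp add: z0_def divide_strict_right_mono)
  ultimately have rad: "ereal R < fps_conv_radius ?F"
    unfolding fps_conv_radius_def fps_nth_Abs_fps
    by (meson ereal_less_eq(3) less_ereal.simps(1) less_le_trans)
  have sub: "cball (0::complex) R \<subseteq> eball 0 (fps_conv_radius ?F)"
  proof
    fix x :: complex assume "x \<in> cball 0 R"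
    hence "ereal (dist 0 x) \<le> ereal R" by simp
    also note rad
    finally show "x \<in> eball 0 (fps_conv_radius ?F)" by simp
  qed
  have D: "norm ((deriv ^^ n) (eval_fps ?F) 0) \<le> fact n * (C / y ^ r) / R ^ n"
  proof (rule Cauchy_inequality[OF _ _ R])
    show "eval_fps ?F holomorphic_on ball 0 R"
      by (rule holomorphic_on_eval_fps) (use sub in force)
    show "continuous_on (cball 0 R) (eval_fps ?F)"
      by (rule continuous_on_eval_fps[THEN continuous_on_subset, OF sub])
    fix q :: complex assume q: "norm (0 - q) = R"
    hence "q \<noteq> 0" using R by auto
    then obtain z where z: "hecke_q l z = q" using hecke_q_surj[OF lam] by blast
    have "Im z = y"
      using q norm_hecke_q[of l z] lam unfolding z R_def by simp
    moreover from this have "eval_fps ?F q = g z"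
      using b y z by (auto simp: has_q_expansion_def upper_half_plane_def eval_fps_def sums_iff)
    ultimately show "norm (eval_fps ?F q) \<le> C / y ^ r" using C(2)[of z] y by simp
  qed
  have "b n = (deriv ^^ n) (eval_fps ?F) 0 / fact n"
    using fps_nth_conv_deriv[of ?F n] rad R by (simp add: less_trans[of 0 "ereal R"])
  hence "norm (b n) = norm ((deriv ^^ n) (eval_fps ?F) 0) / fact n"
    by (simp add: norm_divide)
  also have "\<dots> \<le> fact n * (C / y ^ r) / R ^ n / fact n"
    by (rule divide_right_mono[OF D]) simp
  also have "\<dots> = (C / y ^ r) / R ^ n" by simp
  also have "(C / y ^ r) / R ^ n = C * (1 + n) ^ r * exp (n * (2 * pi / ?L * y))"
    by (simp add: y_def R_def exp_minus power_divide field_simps exp_of_nat_mult[symmetric])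
  also have "n * (2 * pi / ?L * y) = (2 * pi / ?L) * (n / (1 + real n))" by (simp add: y_def)
  also have "C * (1 + n) ^ r * exp \<dots> \<le> C * (1 + n) ^ r * exp (2 * pi / ?L * 1)"
    using C(1) lam by (intro mult_left_mono iffD2[OF exp_le_cancel_iff]) auto
  finally show ?thesis by (simp add: mult_ac)
qed

lemma hecke_forms_coeff_growth:
  assumes l: "l \<ge> 6" and \<eta>: "norm \<eta> = 1" and g: "g \<in> hecke_forms l \<eta> (int r)"
    and b: "has_q_expansion l g b"
  obtains C where "C \<ge> 0" "\<And>n. norm (b n) \<le> C * (1 + real n) ^ r"
proof -
  note lam = hecke_lambda_bounds[OF l]
  have lam0: "0 < hecke_lambda l" using lam by simp
  have per: "g (z + of_real (hecke_lambda l)) = g z" if "Im z > 0" for z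
    using g that by (auto simp: hecke_forms_def upper_half_plane_def)
  have inv: "norm (g (- 1 / z)) = norm z ^ r * norm (g z)" if "Im z > 0" for z
  proof -
    have z: "z \<noteq> 0" using that by auto
    have "g z = \<eta> * (\<i> / z) ^ r * g (- 1 / z)"
      using g that by (simp add: hecke_forms_def upper_half_plane_def)
    hence "norm (g z) = norm (g (- 1 / z)) / norm z ^ r"
      by (simp add: norm_mult norm_power norm_divide \<eta> power_divide)
    thus ?thesis using z by simp
  qed
  obtain C where C: "C \<ge> 0" "\<And>z. 0 < Im z \<Longrightarrow> Im z \<le> 1 \<Longrightarrow> norm (g z) \<le> C / Im z ^ r"
  proof (rule growth_near_real_axis[OF lam0 lam(2) per inv])
    fix y :: real assume "y > 0"
    from q_expansion_bounded[OF b lam0 this] show "\<exists>G\<ge>0. \<forall>z. Im z \<ge> y \<longrightarrow> norm (g z) \<le> G"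
      by metis
  qed (use that in auto)
  show ?thesis
    by (rule that[of "C * exp (2 * pi / hecke_lambda l)"])
       (use q_expansion_coeff_growth[OF b lam0 C] C(1) in auto)
qed

section \<open>The summation formula\<close>

lemma radial_deriv_fourier_sym:
  assumes h: "rapid_on {0..} h" and f: "\<And>x. f x = h 0 ((norm x)\<^sup>2)" and t: "t \<ge> 0"
  shows "radial_deriv k (fourier_sym \<epsilon> f) t = h k t + \<epsilon> * radial_fourier_deriv h k t"
proof (rule radial_deriv_eq[of "\<lambda>k t. h k t + \<epsilon> * radial_fourier_deriv h k t"])
  show "deriv_seq_on {0..} (\<lambda>k t. h k t + \<epsilon> * radial_fourier_deriv h k t)"
    using deriv_seq_on_diff_scale[OF rapid_on_deriv_seq[OF h] deriv_seq_on_radial_fourier_deriv[OF h], of "- \<epsilon>"]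
    by simp
  show "radial_profile (fourier_sym \<epsilon> f) t = h 0 t + \<epsilon> * radial_fourier_deriv h 0 t" if "t \<ge> 0" for t
    using that by (simp add: radial_profile_def fourier_sym_def f fourier_radial[OF h f] norm_axis_1
        radial_fourier_deriv_def)
qed fact

section \<open>The summation functional on profiles\<close>

context
  fixes l k :: nat and \<epsilon> :: complex and g :: "complex \<Rightarrow> complex" and b :: "nat \<Rightarrow> complex"
  assumes l: "l \<ge> 6" and \<epsilon>: "\<epsilon> \<in> {1, - 1}"
    and g: "g \<in> hecke_forms l (- \<epsilon>) (2 * int k + 1)" and b: "has_q_expansion l g b"
begin

definition summand :: "(nat \<Rightarrow> real \<Rightarrow> complex) \<Rightarrow> nat \<Rightarrow> complex" where
  "summand h n = b n * (h k (2 * real n / hecke_lambda l) +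
     \<epsilon> * radial_fourier_deriv h k (2 * real n / hecke_lambda l))"

lemma node_bounds: "0 \<le> 2 * real n / hecke_lambda l" "real n \<le> 2 * real n / hecke_lambda l"
proof -
  note lam = hecke_lambda_bounds[OF l]
  show "0 \<le> 2 * real n / hecke_lambda l" using lam by simp
  have "real n * hecke_lambda l \<le> real n * 2" using lam by (intro mult_left_mono) auto
  thus "real n \<le> 2 * real n / hecke_lambda l" using lam by (simp add: pos_le_divide_eq)
qed

text \<open>The constants precede \<open>h\<close>: this is the continuity of the functional. Of the
  decay of order \<open>2 * k + 3\<close> in the bracket, \<open>2 * k + 1\<close> pays for
  \<open>b n\<close> and 2 is left for summability.\<close>

lemma summand_bound:
  "\<exists>C\<ge>0. \<exists>M N. \<forall>h B n. rapid_on {0..} h \<longrightarrow> seq_bound M N B h \<longrightarrow>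
    norm (summand h n) \<le> C * B * inverse ((1 + real n)\<^sup>2)"
proof -
  let ?r = "2 * k + 1"
  have "norm (- \<epsilon>) = 1" using \<epsilon> by auto
  moreover have "g \<in> hecke_forms l (- \<epsilon>) (int ?r)" using g by (simp add: add.commute)
  ultimately obtain A where A: "A \<ge> 0" "\<And>n. norm (b n) \<le> A * (1 + real n) ^ ?r"
    using hecke_forms_coeff_growth[OF l _ _ b] by blast
  obtain C M N where C: "\<And>h B s. rapid_on {0..} h \<Longrightarrow> seq_bound M N B h \<Longrightarrow> s \<ge> 0 \<Longrightarrow>
    (1 + s) ^ (?r + 2) * norm (of_real (pi\<^sup>2) ^ k * fcos ((antideriv ^^ k) (abel h)) s) \<le> C * B"
    using fcos_abel_deriv_bound[of "?r + 2" k] by blast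
  show ?thesis
  proof (intro exI conjI allI impI)
    show "0 \<le> A * (1 + \<bar>C\<bar>)" using A by simp
    fix h B n assume h: "rapid_on {0..} h" and B: "seq_bound (max M k) (max N (?r + 2)) B h"
    define u where "u = 2 * real n / hecke_lambda l"
    note u = node_bounds[of n, folded u_def]
    have pos: "(1 + real n) ^ (?r + 2) > 0" by simp
    have le: "(1 + real n) ^ (?r + 2) \<le> (1 + u) ^ (?r + 2)" using u by (intro power_mono) auto
    have B0: "B \<ge> 0" using seq_bound_nonneg[OF B] .
    have 1: "(1 + u) ^ (?r + 2) * norm (h k u) \<le> B"
      by (rule seq_boundD_le[OF B]) (use u in auto)
    have 2: "(1 + u) ^ (?r + 2) * norm (radial_fourier_deriv h k u) \<le> \<bar>C\<bar> * B"
    proof -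
      have "(1 + u) ^ (?r + 2) * norm (radial_fourier_deriv h k u) \<le> C * B"
        unfolding radial_fourier_deriv_def by (rule C[OF h seq_bound_mono[OF B]]) (use u in auto)
      also have "\<dots> \<le> \<bar>C\<bar> * B" using B0 by (intro mult_right_mono) auto
      finally show ?thesis .
    qed
    have "(1 + real n) ^ (?r + 2) * norm (h k u + \<epsilon> * radial_fourier_deriv h k u) \<le>
        (1 + u) ^ (?r + 2) * (norm (h k u) + norm (radial_fourier_deriv h k u))"
      using \<epsilon> by (intro mult_mono le order_trans[OF norm_triangle_ineq]) (use u in \<open>auto simp: norm_mult\<close>)
    also have "\<dots> \<le> (1 + \<bar>C\<bar>) * B" using 1 2 by (simp add: distrib_left distrib_right)
    finally have t: "norm (h k u + \<epsilon> * radial_fourier_deriv h k u) \<le> (1 + \<bar>C\<bar>) * B / (1 + real n) ^ (?r + 2)"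
      using pos by (simp only: pos_le_divide_eq mult.commute)
    have "norm (summand h n) = norm (b n) * norm (h k u + \<epsilon> * radial_fourier_deriv h k u)"
      by (simp add: summand_def u_def norm_mult)
    also have "\<dots> \<le> (A * (1 + real n) ^ ?r) * ((1 + \<bar>C\<bar>) * B / (1 + real n) ^ (?r + 2))"
      by (intro mult_mono A(2) t) (use A(1) in auto)
    also have "\<dots> = A * (1 + \<bar>C\<bar>) * B * inverse ((1 + real n)\<^sup>2)"
    proof -
      have "(A * W) * (X / (W * V)) = A * X * inverse V" if "W \<noteq> 0" for W V X :: real
        using that by (simp add: field_simps)
      from this[of "(1 + real n) ^ ?r" "(1 + \<bar>C\<bar>) * B" "(1 + real n)\<^sup>2"] show ?thesis
        by (simp only: power_add mult.assoc) (simp add: add_nonneg_eq_0_iff)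
    qed
    finally show "norm (summand h n) \<le> A * (1 + \<bar>C\<bar>) * B * inverse ((1 + real n)\<^sup>2)" .
  qed
qed

lemma summand_diff_scale:
  assumes "rapid_on {0..} h" "rapid_on {0..} e"
  shows "summand (\<lambda>m u. h m u - c * e m u) n = summand h n - c * summand e n"
  unfolding summand_def radial_fourier_deriv_diff_scale[OF assms node_bounds(1)]
  by (simp add: algebra_simps)

text \<open>With \<open>\<alpha> = pi * a\<close> and \<open>z = \<i> * a\<close>, the function
  \<open>exp (- \<alpha> * u)\<close> takes the value \<open>q ^ n\<close> at the node
  \<open>2 * n / \<lambda>\<close>. Both halves of the sum are then multiples of values of
  \<open>g\<close>, at \<open>z\<close> and at \<open>- 1 / z\<close>, and the sign
  \<open>- \<epsilon>\<close> in the transformation law makes them cancel.\<close>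

lemma summand_expseq_sums:
  assumes \<alpha>: "\<alpha> > 0"
  shows "summand (expseq \<alpha>) sums 0"
proof -
  note lam = hecke_lambda_bounds[OF l]
  define a where "a = \<alpha> / pi"
  have a: "a > 0" "\<alpha> = pi * a" using \<alpha> by (simp_all add: a_def)
  define z where "z = \<i> * complex_of_real a"
  define z' where "z' = \<i> * complex_of_real (1 / a)"
  have z: "z \<in> upper_half_plane" "z' \<in> upper_half_plane"
    using a by (auto simp: z_def z'_def upper_half_plane_def)
  have inv: "- 1 / z = z'" using a by (simp add: z_def z'_def field_simps)
  have q: "hecke_q l (\<i> * of_real c) ^ n = of_real (exp (- (pi * c) * (2 * real n / hecke_lambda l)))" for c n
  proof -
    have "hecke_q l (\<i> * of_real c) ^ n = exp (of_nat n * (2 * of_real pi * \<i> * (\<i> * of_real c) / of_real (hecke_lambda l)))"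
      by (simp only: hecke_q_def exp_of_nat_mult)
    also have "of_nat n * (2 * of_real pi * \<i> * (\<i> * of_real c) / of_real (hecke_lambda l)) =
        complex_of_real (- (pi * c) * (2 * real n / hecke_lambda l))"
      by (simp add: field_simps)
    finally show ?thesis by (simp only: exp_of_real)
  qed
  have s1: "(\<lambda>n. b n * of_real (exp (- (pi * a) * (2 * real n / hecke_lambda l)))) sums g z"
    using b[unfolded has_q_expansion_def, rule_format, OF z(1)] unfolding z_def q .
  have s2: "(\<lambda>n. b n * of_real (exp (- (pi * (1 / a)) * (2 * real n / hecke_lambda l)))) sums g z'"
    using b[unfolded has_q_expansion_def, rule_format, OF z(2)] unfolding z'_def q .
  have "(\<lambda>n. of_real ((- (pi * a)) ^ k) * (b n * of_real (exp (- (pi * a) * (2 * real n / hecke_lambda l)))) +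
      \<epsilon> * of_real (1 / a * (- (pi * (1 / a))) ^ k) * (b n * of_real (exp (- (pi * (1 / a)) * (2 * real n / hecke_lambda l)))))
    sums (of_real ((- (pi * a)) ^ k) * g z + \<epsilon> * of_real (1 / a * (- (pi * (1 / a))) ^ k) * g z')"
    by (intro sums_add sums_mult s1 s2)
  also have "(\<lambda>n. of_real ((- (pi * a)) ^ k) * (b n * of_real (exp (- (pi * a) * (2 * real n / hecke_lambda l)))) +
      \<epsilon> * of_real (1 / a * (- (pi * (1 / a))) ^ k) * (b n * of_real (exp (- (pi * (1 / a)) * (2 * real n / hecke_lambda l)))))
    = summand (expseq \<alpha>)"
  proof
    fix n
    have 1: "pi / \<alpha> = 1 / a" "pi\<^sup>2 / \<alpha> = pi * (1 / a)" using a by (simp_all add: power2_eq_square)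
    show "of_real ((- (pi * a)) ^ k) * (b n * of_real (exp (- (pi * a) * (2 * real n / hecke_lambda l)))) +
      \<epsilon> * of_real (1 / a * (- (pi * (1 / a))) ^ k) * (b n * of_real (exp (- (pi * (1 / a)) * (2 * real n / hecke_lambda l))))
      = summand (expseq \<alpha>) n"
      unfolding summand_def radial_fourier_deriv_expseq[OF \<alpha> node_bounds(1)] 1
      unfolding expseq_def a(2) of_real_mult
      by (simp only: distrib_left mult_ac)
  qed
  also have "of_real ((- (pi * a)) ^ k) * g z + \<epsilon> * of_real (1 / a * (- (pi * (1 / a))) ^ k) * g z' = 0"
  proof -
    have "g z = - \<epsilon> * (\<i> / z) powi (2 * int k + 1) * g (- 1 / z)"
      using g z(1) by (auto simp: hecke_forms_def)
    also have "\<i> / z = of_real (1 / a)" by (simp add: z_def)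
    also have "complex_of_real (1 / a) powi (2 * int k + 1) = of_real ((1 / a) ^ (2 * k + 1))"
      by (metis of_real_power power_int_of_nat of_nat_Suc of_nat_mult of_nat_numeral Suc_eq_plus1 add.commute)
    finally have gz: "g z = - \<epsilon> * of_real ((1 / a) ^ (2 * k + 1)) * g z'" unfolding inv .
    have "(- (pi * a)) ^ k * (1 / a) ^ (2 * k + 1) = 1 / a * (- (pi * (1 / a))) ^ k"
    proof -
      have "(- (pi * a)) ^ k * (1 / a) ^ (2 * k + 1) = 1 / a * ((- (pi * a)) * (1 / a)\<^sup>2) ^ k"
      proof -
        have "(1 / a) ^ (2 * k + 1) = ((1 / a)\<^sup>2) ^ k * (1 / a)"
          by (simp only: power_add power_mult power_one_right)
        thus ?thesis by (simp only: power_mult_distrib mult_ac)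
      qed
      also have "(- (pi * a)) * (1 / a)\<^sup>2 = - (pi * (1 / a))" using a by (simp add: power2_eq_square)
      finally show ?thesis .
    qed
    from this[symmetric] show ?thesis unfolding gz by (simp only: of_real_mult) (simp add: algebra_simps)
  qed
  finally show ?thesis .
qed

lemma summand_exp_sum_sums:
  assumes "\<And>i. a i > 0"
  shows "summand (exp_sum n c a) sums 0"
proof (induction n)
  case 0
  have "summand (\<lambda>m u. 0) n = 0" for n
    using summand_diff_scale[OF rapid_on_zero rapid_on_zero, of 1 n] by simp
  thus ?case by (simp add: exp_sum_0)
next
  case (Suc n)
  have "(\<lambda>j. summand (exp_sum n c a) j - (- c n) * summand (expseq (a n)) j) sums (0 - (- c n) * 0)"
    by (intro sums_diff sums_mult Suc summand_expseq_sums assms)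
  thus ?case
    unfolding exp_sum_Suc using assms
    by (simp only: summand_diff_scale[OF rapid_on_exp_sum rapid_on_expseq] mult_zero_right diff_zero)
qed

text \<open>The functional vanishes on exponential sums, and these come within any
  \<open>\<eta>\<close> of \<open>h\<close> in the one seminorm that dominates it.\<close>

lemma summand_sums:
  assumes h: "rapid_on {0..} h"
  shows "summand h sums 0"
proof -
  obtain C M N where C: "C \<ge> 0" "\<And>h B n. rapid_on {0..} h \<Longrightarrow> seq_bound M N B h \<Longrightarrow>
      norm (summand h n) \<le> C * B * inverse ((1 + real n)\<^sup>2)"
    using summand_bound by blast
  have S: "summable (\<lambda>n. inverse ((1 + real n)\<^sup>2))"
    using inverse_power_summable[of 2, where ?'a = real, THEN summable_ignore_initial_segment, of 1] by simp
  define Z where "Z = (\<Sum>n. inverse ((1 + real n)\<^sup>2))"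
  have Z: "Z \<ge> 0" unfolding Z_def by (intro suminf_nonneg S) auto
  have bound: "summable (summand e)" "norm (suminf (summand e)) \<le> C * B * Z"
    if e: "rapid_on {0..} e" and B: "seq_bound M N B e" for e B
  proof -
    have S': "summable (\<lambda>n. C * B * inverse ((1 + real n)\<^sup>2))" by (intro summable_mult S)
    have n: "summable (\<lambda>n. norm (summand e n))"
      by (rule summable_comparison_test[OF _ S']) (use C(2)[OF e B] in auto)
    thus "summable (summand e)" by (rule summable_norm_cancel)
    have "norm (suminf (summand e)) \<le> (\<Sum>n. norm (summand e n))" by (rule summable_norm[OF n])
    also have "\<dots> \<le> (\<Sum>n. C * B * inverse ((1 + real n)\<^sup>2))"
      by (intro suminf_le C(2)[OF e B] n S')
    also have "\<dots> = C * B * Z" unfolding Z_def by (rule suminf_mult[OF S])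
    finally show "norm (suminf (summand e)) \<le> C * B * Z" .
  qed
  obtain B where "seq_bound M N B h" using rapid_on_seq_bound[OF h] .
  note sum = bound(1)[OF h this]
  have small: "norm (suminf (summand h)) \<le> C * \<eta> * Z" if "\<eta> > 0" for \<eta>
  proof -
    obtain n c a where a: "\<And>i. a i > 0"
      and E: "seq_bound M N \<eta> (\<lambda>m u. h m u - 1 * exp_sum n c a m u)"
      using exp_sum_dense[OF h \<open>\<eta> > 0\<close>] by blast
    have R: "rapid_on {0..} (exp_sum n c a)" by (rule rapid_on_exp_sum[OF a])
    note b = bound(2)[OF rapid_on_diff_scale[OF h R] E]
    have "summand (\<lambda>m u. h m u - 1 * exp_sum n c a m u) = (\<lambda>j. summand h j - 1 * summand (exp_sum n c a) j)"
      using summand_diff_scale[OF h R] by blast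
    moreover have "(\<lambda>j. summand h j - 1 * summand (exp_sum n c a) j) sums (suminf (summand h) - 1 * 0)"
      by (intro sums_diff sums_mult summand_exp_sum_sums a summable_sums sum)
    ultimately show ?thesis using b by (simp add: sums_iff)
  qed
  have "norm (suminf (summand h)) \<le> 0 + e" if "e > 0" for e
  proof -
    \<comment> \<open>Adding 1 keeps the divisor positive when \<open>C * Z = 0\<close>.\<close>
    have "C * Z + 1 > 0" using C(1) Z by (simp add: add_nonneg_pos)
    hence "C * (e / (C * Z + 1)) * Z \<le> e"
      using that by (simp add: field_simps)
    moreover have "e / (C * Z + 1) > 0" using C(1) Z that by (simp add: add_nonneg_pos)
    ultimately show ?thesis using small[of "e / (C * Z + 1)"] by simp
  qed
  hence "norm (suminf (summand h)) \<le> 0" by (rule field_le_epsilon)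
  thus ?thesis using sum by (simp add: sums_iff)
qed

end

theorem theorem1p7:
  fixes l k :: nat
    and \<epsilon> :: complex
    and g :: "complex \<Rightarrow> complex"
    and b :: "nat \<Rightarrow> complex"
    and f :: "real ^ 2 \<Rightarrow> complex"
  assumes "l \<ge> 6" and "l mod 4 = 2"
    and "\<epsilon> \<in> {1, - 1}"
    and "g \<in> hecke_forms l (- \<epsilon>) (2 * int k + 1)"
    and "has_q_expansion l g b"
    and "schwartz f" and "radial f"
  shows "(\<lambda>n. b n * radial_deriv k (fourier_sym \<epsilon> f) (2 * real n / hecke_lambda l)) sums 0"
proof -
  obtain h where h: "rapid_on {0..} h" and f: "\<And>x. f x = h 0 ((norm x)\<^sup>2)"
    using radial_schwartz_profile[OF assms(6,7)] by blast
  note ctx = assms(1,3,4,5)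
  \<comment> \<open>The nodes are nonnegative, so there the one-sided derivatives are the entries of
    \<open>h\<close> and of its transform.\<close>
  have "summand l k \<epsilon> b h = (\<lambda>n. b n * radial_deriv k (fourier_sym \<epsilon> f) (2 * real n / hecke_lambda l))"
    unfolding summand_def[OF ctx]
    by (simp only: radial_deriv_fourier_sym[OF h f node_bounds(1)[OF ctx]])
  with summand_sums[OF ctx h] show ?thesis by simp
qed

end
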